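(* Let $\alpha,\alpha',\beta\ge0$, and let $(a_p)_{p\ge1}$, $(b_p)_{p\ge1}$ be sequences of nonzero real numbers with $\sum_p|a_p|^2=\sum_p|b_p|^2=1$. For $\lambda=(\lambda_p)_{p\ge1}$ let $\langle\cdot\rangle'$ be the quenched Gibbs average for the perturbed Hamiltonian $$H_{N}(\sigma)=-\sum_{p\ge1}\Big[a_{p}\sum_{\nu=1}^{P^{(p)}_{\alpha N}}J^{(p)}_{\nu}\sigma_{i^{p,1}_{\nu}}\cdots\sigma_{i^{p,p}_{\nu}}+b_{p}\lambda_{p}\sum_{\nu=1}^{P'^{(p)}_{\alpha'}}J'^{(p)}_{\nu}\sigma_{j^{p,1}_{\nu}}\cdots\sigma_{j^{p,p}_{\nu}}\Big]$$ (see the context). Then, with the possible exception of a zero measure set of values of the perturbing parameters $\lambda$, for all integers $r,s,m,n\ge1$, $$\lim_{N\to\infty}\ \sum_{a=0}^{\min\{2r,2s\}}(-1)^{a+1}\frac{(2r+2s-a-1)!}{a!\,(2r-a)!\,(2s-a)!}\ \langle q^m_{2r}\,q^n_{2s}\rangle'_a=0 ,$$ where $q^m$, $q^n$ are powers and $\langle q^m_{2r}q^n_{2s}\rangle'_a=\mathbb{E}\,(\omega')^{\otimes(2r+2s-a)}\big(q^m_{1,\ldots,2r}\;q^n_{1,\ldots,a,2r+1,\ldots,2r+2s-a}\big)$ (the two overlaps share exactly $a$ replicas).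
   Context: Spin configurations are $\sigma\in\Sigma=\{-1,1\}^N$. In the Hamiltonian, for each $p\ge1$, $P^{(p)}_{\alpha N}$ and $P'^{(p)}_{\alpha'}$ are Poisson random variables of means $\alpha N$ and $\alpha'$; all $J^{(p)}_\nu,J'^{(p)}_\nu$ are i.i.d. uniform on $\{-1,1\}$; all indices $i^{p,k}_\nu,j^{p,k}_\nu$ are i.i.d. uniform on $\{1,\ldots,N\}$; all these (quenched) variables are mutually independent. The $\lambda_p$ are independent real perturbing parameters. A set of values of $\lambda$ has zero measure if, for every $L>0$, its intersection with $[-L,L]^{\mathbb{N}}$ is null for the product of the uniform probability measures on $[-L,L]$. The Gibbs measure $\omega'$ on $\Sigma$ has weights proportional to $\exp(-\beta H_N(\sigma))$; $\mathbb{E}$ is expectation over the quenched variables; replicas $\sigma^{(1)},\sigma^{(2)},\ldots$ are independent samples from $\omega'$ with the same quenched variables, and $\langle\cdot\rangle'=\mathbb{E}(\omega')^{\otimes k}(\cdot)$ for the needed number $k$ of replicas. Overlaps: $q_{r_1\cdots r_n}=\frac1N\sum_{i=1}^N\sigma_i^{(r_1)}\cdots\sigma_i^{(r_n)}$. *)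

theory Defs
  imports "HOL-Probability.Probability"
begin

text \<open>The library's Poisson distribution requires a strictly positive rate.\<close>

definition poisson_law :: "real \<Rightarrow> nat pmf" where
  "poisson_law rate = (if rate = 0 then return_pmf 0 else poisson_pmf rate)"

text \<open>
  The random variables have different value types. To express their mutual independence through
  \<open>indep_vars\<close>, they are collected into one integer-valued family indexed by labels. All variables
  are discrete, and the embedding of the naturals into the integers is injective, so this generates
  the same sigma-algebras as the original variables.
\<close>

datatype label =
    NumP nat | NumP' nat
  | CoupJ nat nat | CoupJ' nat nat
  | IndI nat nat nat | IndJ nat nat nat

definition labels :: "label set" where
  "labels =
     {NumP p | p. p \<ge> 1} \<union> {NumP' p | p. p \<ge> 1} \<union>
     {CoupJ p \<nu> | p \<nu>. p \<ge> 1 \<and> \<nu> \<ge> 1} \<union> {CoupJ' p \<nu> | p \<nu>. p \<ge> 1 \<and> \<nu> \<ge> 1} \<union>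
     {IndI p k \<nu> | p k \<nu>. 1 \<le> k \<and> k \<le> p \<and> \<nu> \<ge> 1} \<union>
     {IndJ p k \<nu> | p k \<nu>. 1 \<le> k \<and> k \<le> p \<and> \<nu> \<ge> 1}"

fun label_family ::
  "(nat \<Rightarrow> 'w \<Rightarrow> nat) \<Rightarrow> (nat \<Rightarrow> 'w \<Rightarrow> nat) \<Rightarrow>
   (nat \<Rightarrow> nat \<Rightarrow> 'w \<Rightarrow> int) \<Rightarrow> (nat \<Rightarrow> nat \<Rightarrow> 'w \<Rightarrow> int) \<Rightarrow>
   (nat \<Rightarrow> nat \<Rightarrow> nat \<Rightarrow> 'w \<Rightarrow> nat) \<Rightarrow> (nat \<Rightarrow> nat \<Rightarrow> nat \<Rightarrow> 'w \<Rightarrow> nat) \<Rightarrow> label \<Rightarrow> 'w \<Rightarrow> int" where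
  "label_family P P' J J' i j (NumP p) w = int (P p w)"
| "label_family P P' J J' i j (NumP' p) w = int (P' p w)"
| "label_family P P' J J' i j (CoupJ p \<nu>) w = J p \<nu> w"
| "label_family P P' J J' i j (CoupJ' p \<nu>) w = J' p \<nu> w"
| "label_family P P' J J' i j (IndI p k \<nu>) w = int (i p k \<nu> w)"
| "label_family P P' J J' i j (IndJ p k \<nu>) w = int (j p k \<nu> w)"

locale quenched_disorder = prob_space M for M :: "'w measure" +
  fixes N :: nat and \<alpha> \<alpha>' :: real
    and P P' :: "nat \<Rightarrow> 'w \<Rightarrow> nat"
    and J J' :: "nat \<Rightarrow> nat \<Rightarrow> 'w \<Rightarrow> int"
    and i j :: "nat \<Rightarrow> nat \<Rightarrow> nat \<Rightarrow> 'w \<Rightarrow> nat"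
  assumes mutually_indep:
      "indep_vars (\<lambda>_. count_space UNIV) (label_family P P' J J' i j) labels"
    and distr_P:
      "\<And>p. p \<ge> 1 \<Longrightarrow> distr M (count_space UNIV) (P p) = measure_pmf (poisson_law (\<alpha> * real N))"
    and distr_P':
      "\<And>p. p \<ge> 1 \<Longrightarrow> distr M (count_space UNIV) (P' p) = measure_pmf (poisson_law \<alpha>')"
    and distr_J:
      "\<And>p \<nu>. p \<ge> 1 \<Longrightarrow> \<nu> \<ge> 1 \<Longrightarrow>
         distr M (count_space UNIV) (J p \<nu>) = measure_pmf (pmf_of_set {-1, 1})"
    and distr_J':
      "\<And>p \<nu>. p \<ge> 1 \<Longrightarrow> \<nu> \<ge> 1 \<Longrightarrow>
         distr M (count_space UNIV) (J' p \<nu>) = measure_pmf (pmf_of_set {-1, 1})"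
    and distr_i:
      "\<And>p k \<nu>. 1 \<le> k \<Longrightarrow> k \<le> p \<Longrightarrow> \<nu> \<ge> 1 \<Longrightarrow>
         distr M (count_space UNIV) (i p k \<nu>) = measure_pmf (pmf_of_set {1..N})"
    and distr_j:
      "\<And>p k \<nu>. 1 \<le> k \<Longrightarrow> k \<le> p \<Longrightarrow> \<nu> \<ge> 1 \<Longrightarrow>
         distr M (count_space UNIV) (j p k \<nu>) = measure_pmf (pmf_of_set {1..N})"

definition configs :: "nat \<Rightarrow> (nat \<Rightarrow> real) set" where
  "configs N = {1..N} \<rightarrow>\<^sub>E {-1, 1}"

definition pspin_sum ::
  "nat \<Rightarrow> nat \<Rightarrow> (nat \<Rightarrow> int) \<Rightarrow> (nat \<Rightarrow> nat \<Rightarrow> nat) \<Rightarrow> (nat \<Rightarrow> real) \<Rightarrow> real" where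
  "pspin_sum p n J i \<sigma> = (\<Sum>\<nu>=1..n. real_of_int (J \<nu>) * (\<Prod>k=1..p. \<sigma> (i k \<nu>)))"

text \<open>
  The sum over all \<open>p \<ge> 1\<close> is the limit of its partial sums. With square-summable coefficients
  and bounded \<open>lam\<close> it converges almost surely, in general only conditionally.
\<close>

definition hamiltonian ::
  "(nat \<Rightarrow> real) \<Rightarrow> (nat \<Rightarrow> real) \<Rightarrow> (nat \<Rightarrow> real) \<Rightarrow>
   (nat \<Rightarrow> 'w \<Rightarrow> nat) \<Rightarrow> (nat \<Rightarrow> 'w \<Rightarrow> nat) \<Rightarrow>
   (nat \<Rightarrow> nat \<Rightarrow> 'w \<Rightarrow> int) \<Rightarrow> (nat \<Rightarrow> nat \<Rightarrow> 'w \<Rightarrow> int) \<Rightarrow>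
   (nat \<Rightarrow> nat \<Rightarrow> nat \<Rightarrow> 'w \<Rightarrow> nat) \<Rightarrow> (nat \<Rightarrow> nat \<Rightarrow> nat \<Rightarrow> 'w \<Rightarrow> nat) \<Rightarrow>
   'w \<Rightarrow> (nat \<Rightarrow> real) \<Rightarrow> real" where
  "hamiltonian a b lam P P' J J' i j w \<sigma> =
     - (\<Sum>t. let p = Suc t in
          a p * pspin_sum p (P p w) (\<lambda>\<nu>. J p \<nu> w) (\<lambda>k \<nu>. i p k \<nu> w) \<sigma>
          + b p * lam p * pspin_sum p (P' p w) (\<lambda>\<nu>. J' p \<nu> w) (\<lambda>k \<nu>. j p k \<nu> w) \<sigma>)"

definition gibbs :: "nat \<Rightarrow> real \<Rightarrow> ((nat \<Rightarrow> real) \<Rightarrow> real) \<Rightarrow> (nat \<Rightarrow> real) \<Rightarrow> real" where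
  "gibbs N \<beta> H \<sigma> = exp (- \<beta> * H \<sigma>) / (\<Sum>\<tau>\<in>configs N. exp (- \<beta> * H \<tau>))"

text \<open>Expectation under the \<open>k\<close>-fold product of the Gibbs measure; \<open>s l\<close> is the \<open>l\<close>-th replica.\<close>

definition replica_avg ::
  "nat \<Rightarrow> real \<Rightarrow> ((nat \<Rightarrow> real) \<Rightarrow> real) \<Rightarrow> nat \<Rightarrow> ((nat \<Rightarrow> nat \<Rightarrow> real) \<Rightarrow> real) \<Rightarrow> real" where
  "replica_avg N \<beta> H k F =
     (\<Sum>s\<in>{1..k} \<rightarrow>\<^sub>E configs N. (\<Prod>l=1..k. gibbs N \<beta> H (s l)) * F s)"

definition quenched_avg ::
  "'w measure \<Rightarrow> nat \<Rightarrow> real \<Rightarrow> ('w \<Rightarrow> (nat \<Rightarrow> real) \<Rightarrow> real) \<Rightarrow> nat \<Rightarrow>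
   ((nat \<Rightarrow> nat \<Rightarrow> real) \<Rightarrow> real) \<Rightarrow> real" where
  "quenched_avg M N \<beta> H k F = (\<integral>w. replica_avg N \<beta> (H w) k F \<partial>M)"

definition overlap :: "nat \<Rightarrow> nat set \<Rightarrow> (nat \<Rightarrow> nat \<Rightarrow> real) \<Rightarrow> real" where
  "overlap N R s = (1 / real N) * (\<Sum>x=1..N. \<Prod>l\<in>R. s l x)"

definition shared_overlap_avg ::
  "'w measure \<Rightarrow> nat \<Rightarrow> real \<Rightarrow> ('w \<Rightarrow> (nat \<Rightarrow> real) \<Rightarrow> real) \<Rightarrow>
   nat \<Rightarrow> nat \<Rightarrow> nat \<Rightarrow> nat \<Rightarrow> nat \<Rightarrow> real" where
  "shared_overlap_avg M N \<beta> H r s m n c =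
     quenched_avg M N \<beta> H (2 * r + 2 * s - c)
       (\<lambda>\<sigma>. overlap N {1..2 * r} \<sigma> ^ m * overlap N ({1..c} \<union> {2 * r + 1..2 * r + 2 * s - c}) \<sigma> ^ n)"

text \<open>
  Parameter sequences are extensional functions on the indices \<open>p \<ge> 1\<close>. Completion expresses that
  a null set need only be contained in a measurable set of measure zero.
\<close>

definition zero_measure :: "(nat \<Rightarrow> real) set \<Rightarrow> bool" where
  "zero_measure Z \<longleftrightarrow>
     (\<forall>L>0. Z \<inter> ({1..} \<rightarrow>\<^sub>E {-L..L}) \<in>
        null_sets (completion (PiM {1..} (\<lambda>_. uniform_measure lborel {-L..L}))))"

end

theory Submission
  imports Defs
begin

text \<open>
  The identities hold for every bounded parameter sequence, so the exceptional set is the set of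
  unbounded ones.

  Suppose \<open>\<alpha>, \<beta> > 0\<close>. The number of \<open>p\<close>-spin terms is Poisson of mean \<open>\<alpha> N\<close>, so adding one more
  changes the law of the disorder by \<open>O(1 / sqrt N)\<close> in total variation, even if the sites of the
  new term are chosen with a bias that depends on all the other terms. Bias \<open>p - m\<close> of the sites
  towards those carrying many one-spin terms of positive sign. Such a site is frozen with high probability,
  whatever else acts on it, and its sign is absorbed by the symmetric coupling. Hence a \<open>p\<close>-spin term
  acts like an \<open>m\<close>-spin term with coupling constant \<open>t p = tanh (\<beta> * a p)\<close>, and for all \<open>p > m\<close> the limit
  is unchanged if the Gibbs measure is tilted by \<open>1 + t p * J * A\<close>, with \<open>A\<close> a product of \<open>m\<close> random
  spins. Applied to the observable \<open>\<omega>(B)^(2s)\<close>, with \<open>B\<close> a product of \<open>n\<close> random spins, this says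
  that a power series in \<open>t\<close> tends to zero at all the points \<open>t p\<close>. These are nonzero and accumulate
  at zero, so every coefficient tends to zero, and the coefficient of \<open>t^(2r)\<close> is \<open>- 2s\<close> times the
  left-hand side of the identity.

  If \<open>\<alpha> = 0\<close> or \<open>\<beta> = 0\<close>, only boundedly many interactions matter and all overlaps vanish.
\<close>

section \<open>Poisson samples\<close>

text \<open>Adding an m-spin term directly tests the identities at the single strength
  \<open>tanh (\<beta> * a m)\<close>, and one value of a power series does not determine its
  coefficients. Freezing the surplus sites is what provides infinitely many strengths for the same
  m. The obstacle is that the remaining interactions can oppose the one-spin terms arbitrarily, so
  no fixed number of fields freezes a site. Instead the bias weights a site with j positive fields
  by the inverse Poisson probability of j, for j below a cutoff L. The number of fields then becomes
  uniform on L values, of which only boundedly many can leave the spin unfrozen: an error of order 1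
  / L whatever the other terms are. The cost is a constant that depends on L but is divided by sqrt
  N, so N grows first and L afterwards. Boundedness of the parameters enters through
  square-summability of \<open>b p * lam p\<close>, which makes the Hamiltonian converge almost
  surely; every sequence in one of the boxes of \<open>zero_measure\<close> is bounded.\<close>

primrec iid_mset :: "nat \<Rightarrow> 'a pmf \<Rightarrow> 'a multiset pmf" where
  "iid_mset 0 q = return_pmf {#}"
| "iid_mset (Suc k) q = bind_pmf q (\<lambda>x. map_pmf (add_mset x) (iid_mset k q))"

text \<open>The Poisson point process with intensity \<open>\<mu>\<close> times \<open>q\<close>,
  atoms allowed. Multisets suffice since the energy does not see the order of the terms, and adding
  a term becomes a single operation.\<close>

definition poisson_mset :: "real \<Rightarrow> 'a pmf \<Rightarrow> 'a multiset pmf" where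
  "poisson_mset \<mu> q = bind_pmf (poisson_law \<mu>) (\<lambda>k. iid_mset k q)"

section \<open>The Mecke formula\<close>

lemma nn_integral_pmf_swap:
  "(\<integral>\<^sup>+x. \<integral>\<^sup>+y. f x y \<partial>measure_pmf B \<partial>measure_pmf A) = (\<integral>\<^sup>+y. \<integral>\<^sup>+x. f x y \<partial>measure_pmf A \<partial>measure_pmf B)"
  using arg_cong[OF bind_commute_pmf[of A B "\<lambda>x y. return_pmf (x, y)"],
      of "\<lambda>p. \<integral>\<^sup>+z. f (fst z) (snd z) \<partial>measure_pmf p"]
  by simp

lemma nn_integral_iid_mset_Suc:
  "(\<integral>\<^sup>+\<xi>. f \<xi> \<partial>iid_mset (Suc k) q) = (\<integral>\<^sup>+x. \<integral>\<^sup>+\<xi>. f (add_mset x \<xi>) \<partial>iid_mset k q \<partial>q)"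
  by simp

text \<open>The points of an iid sample are exchangeable, so each of the \<open>Suc k\<close>
  summands contributes as if its point had been drawn first. The induction separates the first point
  \<open>y\<close> and treats it as a fixed part of the test function for the others.\<close>

lemma mecke_iid_mset:
  fixes g :: "'a \<Rightarrow> 'a multiset \<Rightarrow> ennreal"
  shows "(\<integral>\<^sup>+\<xi>. (\<Sum>x\<in>#\<xi>. g x \<xi>) \<partial>iid_mset (Suc k) q)
       = of_nat (Suc k) * (\<integral>\<^sup>+x. \<integral>\<^sup>+\<xi>. g x (add_mset x \<xi>) \<partial>iid_mset k q \<partial>q)"
proof (induction k arbitrary: g)
  case 0
  show ?case by simp
next
  case (Suc k)
  let ?I = "\<integral>\<^sup>+x. \<integral>\<^sup>+\<xi>. g x (add_mset x \<xi>) \<partial>iid_mset (Suc k) q \<partial>q"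
  have "(\<integral>\<^sup>+\<xi>. (\<Sum>x\<in>#\<xi>. g x \<xi>) \<partial>iid_mset (Suc (Suc k)) q)
      = (\<integral>\<^sup>+y. \<integral>\<^sup>+\<xi>. (g y (add_mset y \<xi>) + (\<Sum>x\<in>#\<xi>. g x (add_mset y \<xi>))) \<partial>iid_mset (Suc k) q \<partial>q)"
    by (subst nn_integral_iid_mset_Suc) simp
  also have "\<dots> = (\<integral>\<^sup>+y. ((\<integral>\<^sup>+\<xi>. g y (add_mset y \<xi>) \<partial>iid_mset (Suc k) q)
      + (\<integral>\<^sup>+\<xi>. (\<Sum>x\<in>#\<xi>. g x (add_mset y \<xi>)) \<partial>iid_mset (Suc k) q)) \<partial>q)"
    by (subst nn_integral_add) (simp_all del: iid_mset.simps)
  also have "\<dots> = (\<integral>\<^sup>+y. ((\<integral>\<^sup>+\<xi>. g y (add_mset y \<xi>) \<partial>iid_mset (Suc k) q)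
      + of_nat (Suc k) * (\<integral>\<^sup>+x. \<integral>\<^sup>+\<xi>. g x (add_mset x (add_mset y \<xi>)) \<partial>iid_mset k q \<partial>q)) \<partial>q)"
    by (subst Suc.IH[where g = "\<lambda>x \<xi>. g x (add_mset y \<xi>)" for y])
       (simp only: add_mset_commute)
  also have "\<dots> = ?I + of_nat (Suc k) * (\<integral>\<^sup>+y. \<integral>\<^sup>+x. \<integral>\<^sup>+\<xi>. g x (add_mset x (add_mset y \<xi>)) \<partial>iid_mset k q \<partial>q \<partial>q)"
    by (subst nn_integral_add) (simp_all add: nn_integral_cmult del: iid_mset.simps)
  also have "(\<integral>\<^sup>+y. \<integral>\<^sup>+x. \<integral>\<^sup>+\<xi>. g x (add_mset x (add_mset y \<xi>)) \<partial>iid_mset k q \<partial>q \<partial>q)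
      = (\<integral>\<^sup>+x. \<integral>\<^sup>+y. \<integral>\<^sup>+\<xi>. g x (add_mset x (add_mset y \<xi>)) \<partial>iid_mset k q \<partial>q \<partial>q)"
    by (rule nn_integral_pmf_swap)
  also have "\<dots> = ?I"
    by (subst nn_integral_iid_mset_Suc) simp
  also have "?I + of_nat (Suc k) * ?I = of_nat (Suc (Suc k)) * ?I"
    by (simp add: distrib_right)
  finally show ?case .
qed

text \<open>Since k \<mu>^k / k! = \<mu> \<mu>^(k-1) / (k-1)!, the sum shifts by one index. At zero
  the truncated \<open>k - 1\<close> is multiplied by zero.\<close>

lemma nn_integral_poisson_law_Suc:
  assumes "\<mu> \<ge> 0"
  shows "(\<integral>\<^sup>+k. of_nat k * F (k - 1) \<partial>poisson_law \<mu>) = ennreal \<mu> * (\<integral>\<^sup>+k. F k \<partial>poisson_law \<mu>)"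
proof (cases "\<mu> = 0")
  case True
  then show ?thesis by (simp add: poisson_law_def)
next
  case False
  with assms have pos: "\<mu> > 0" by simp
  have *: "(\<integral>\<^sup>+k. G k \<partial>poisson_law \<mu>) = (\<Sum>k. ennreal (\<mu> ^ k / fact k * exp (-\<mu>)) * G k)" for G :: "nat \<Rightarrow> ennreal"
    using pos by (simp add: poisson_law_def nn_integral_measure_pmf nn_integral_count_space_nat)
  have "(\<integral>\<^sup>+k. of_nat k * F (k - 1) \<partial>poisson_law \<mu>)
      = (\<Sum>k. ennreal (\<mu> ^ Suc k / fact (Suc k) * exp (-\<mu>)) * (of_nat (Suc k) * F k))"
  proof -
    let ?f = "\<lambda>k. ennreal (\<mu> ^ k / fact k * exp (-\<mu>)) * (of_nat k * F (k - 1))"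
    have "(\<lambda>k. ?f (Suc k)) sums (\<Sum>k. ?f (Suc k))"
      by (intro summable_sums summableI)
    from sums_unique[OF sums_Suc[OF this]] show ?thesis
      unfolding * by simp
  qed
  also have "\<dots> = (\<Sum>k. ennreal \<mu> * (ennreal (\<mu> ^ k / fact k * exp (-\<mu>)) * F k))"
  proof (intro suminf_cong)
    fix k
    have "ennreal (\<mu> ^ Suc k / fact (Suc k) * exp (-\<mu>)) * of_nat (Suc k)
        = ennreal (\<mu> ^ Suc k / fact (Suc k) * exp (-\<mu>) * real (Suc k))"
      using pos by (subst ennreal_mult) (auto simp flip: ennreal_of_nat_eq_real_of_nat simp del: of_nat_Suc)
    also have "\<mu> ^ Suc k / fact (Suc k) * exp (-\<mu>) * real (Suc k) = \<mu> * (\<mu> ^ k / fact k * exp (-\<mu>))"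
      by (simp add: divide_simps del: of_nat_Suc)
    also have "ennreal \<dots> = ennreal \<mu> * ennreal (\<mu> ^ k / fact k * exp (-\<mu>))"
      using pos by (subst ennreal_mult) auto
    finally show "ennreal (\<mu> ^ Suc k / fact (Suc k) * exp (-\<mu>)) * (of_nat (Suc k) * F k)
        = ennreal \<mu> * (ennreal (\<mu> ^ k / fact k * exp (-\<mu>)) * F k)"
      by (metis mult.assoc)
  qed
  also have "\<dots> = ennreal \<mu> * (\<integral>\<^sup>+k. F k \<partial>poisson_law \<mu>)"
    unfolding * by simp
  finally show ?thesis .
qed

text \<open>Mixing the formula for a fixed number of points over the Poisson number: the index shift
  absorbs the factor k and leaves \<open>\<mu>\<close> together with a sample of the original
  law.\<close>

lemma mecke_poisson_mset_nn:
  fixes g :: "'a \<Rightarrow> 'a multiset \<Rightarrow> ennreal"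
  assumes "\<mu> \<ge> 0"
  shows "(\<integral>\<^sup>+\<xi>. (\<Sum>x\<in>#\<xi>. g x \<xi>) \<partial>poisson_mset \<mu> q)
       = ennreal \<mu> * (\<integral>\<^sup>+x. \<integral>\<^sup>+\<xi>. g x (add_mset x \<xi>) \<partial>poisson_mset \<mu> q \<partial>q)"
proof -
  have step: "(\<integral>\<^sup>+\<xi>. (\<Sum>x\<in>#\<xi>. g x \<xi>) \<partial>iid_mset k q)
      = of_nat k * (\<integral>\<^sup>+x. \<integral>\<^sup>+\<xi>. g x (add_mset x \<xi>) \<partial>iid_mset (k - 1) q \<partial>q)" for k
    using mecke_iid_mset[where g = g and q = q and k = "k - 1"] by (cases k) simp_all
  let ?F = "\<lambda>k. \<integral>\<^sup>+x. \<integral>\<^sup>+\<xi>. g x (add_mset x \<xi>) \<partial>iid_mset k q \<partial>q"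
  have "(\<integral>\<^sup>+\<xi>. (\<Sum>x\<in>#\<xi>. g x \<xi>) \<partial>poisson_mset \<mu> q) = (\<integral>\<^sup>+k. of_nat k * ?F (k - 1) \<partial>poisson_law \<mu>)"
    unfolding poisson_mset_def nn_integral_bind_pmf step ..
  also have "\<dots> = ennreal \<mu> * (\<integral>\<^sup>+k. ?F k \<partial>poisson_law \<mu>)"
    by (rule nn_integral_poisson_law_Suc[OF assms])
  also have "(\<integral>\<^sup>+k. \<integral>\<^sup>+x. \<integral>\<^sup>+\<xi>. g x (add_mset x \<xi>) \<partial>iid_mset k q \<partial>q \<partial>poisson_law \<mu>)
     = (\<integral>\<^sup>+x. \<integral>\<^sup>+k. \<integral>\<^sup>+\<xi>. g x (add_mset x \<xi>) \<partial>iid_mset k q \<partial>poisson_law \<mu> \<partial>q)"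
    by (rule nn_integral_pmf_swap)
  finally show ?thesis by (simp add: poisson_mset_def)
qed

lemma of_nat_size_eq_sum_mset: "of_nat (size \<xi>) = (\<Sum>x\<in>#\<xi>. 1 :: 'b :: comm_semiring_1)"
  by (induction \<xi>) (auto simp: add.commute)

lemma size_poisson_mset_nn:
  assumes "\<mu> \<ge> 0"
  shows "(\<integral>\<^sup>+\<xi>. of_nat (size \<xi>) \<partial>poisson_mset \<mu> q) = ennreal \<mu>"
  using mecke_poisson_mset_nn[OF assms, where g = "\<lambda>_ _. 1" and q = q]
  by (simp add: of_nat_size_eq_sum_mset del: sum_mset_constant)

lemma integrable_size_poisson_mset:
  assumes "\<mu> \<ge> 0"
  shows "integrable (poisson_mset \<mu> q) (\<lambda>\<xi>. real (size \<xi>))"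
proof (rule integrableI_nonneg)
  show "(\<integral>\<^sup>+\<xi>. ennreal (real (size \<xi>)) \<partial>poisson_mset \<mu> q) < \<infinity>"
    using size_poisson_mset_nn[OF assms, of q] by (simp add: ennreal_of_nat_eq_real_of_nat)
qed auto

lemma expectation_size_poisson_mset:
  assumes "\<mu> \<ge> 0"
  shows "(\<integral>\<xi>. real (size \<xi>) \<partial>poisson_mset \<mu> q) = \<mu>"
  using size_poisson_mset_nn[OF assms, of q] assms
  by (subst integral_eq_nn_integral) (auto simp: ennreal_of_nat_eq_real_of_nat)

lemma abs_sum_mset_le:
  fixes f :: "'a \<Rightarrow> real"
  assumes "\<And>x. x \<in># \<xi> \<Longrightarrow> \<bar>f x\<bar> \<le> B"
  shows "\<bar>\<Sum>x\<in>#\<xi>. f x\<bar> \<le> B * real (size \<xi>)"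
  using assms
proof (induction \<xi>)
  case (add x \<xi>)
  have "\<bar>f x\<bar> \<le> B" "\<bar>\<Sum>x\<in>#\<xi>. f x\<bar> \<le> B * real (size \<xi>)"
    using add.prems add.IH by auto
  then show ?case by (simp add: algebra_simps)
qed simp

lemma sum_mset_nonneg_real:
  fixes f :: "'a \<Rightarrow> real"
  shows "(\<And>x. x \<in># \<xi> \<Longrightarrow> 0 \<le> f x) \<Longrightarrow> 0 \<le> (\<Sum>x\<in>#\<xi>. f x)"
  by (induction \<xi>) auto

lemma ennreal_sum_mset:
  assumes "\<And>x. x \<in># \<xi> \<Longrightarrow> 0 \<le> f x"
  shows "ennreal (\<Sum>x\<in>#\<xi>. f x) = (\<Sum>x\<in>#\<xi>. ennreal (f x))"
  using assms
proof (induction \<xi>)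
  case (add x \<xi>)
  have "(\<Sum>x\<in>#\<xi>. f x) \<ge> 0" using add.prems by (intro sum_mset_nonneg_real) auto
  then show ?case using add by (simp add: ennreal_plus)
qed simp

text \<open>Linear growth in the size makes both sides finite, as the size has mean
  \<open>\<mu>\<close>; the extended-valued identity then passes to Bochner integrals.\<close>

lemma mecke_poisson_mset_nonneg:
  fixes g :: "'a \<Rightarrow> 'a multiset \<Rightarrow> real" and q :: "'a pmf"
  assumes \<mu>: "\<mu> \<ge> 0"
    and bnd: "\<And>x \<xi>. 0 \<le> g x \<xi>" "\<And>x \<xi>. g x \<xi> \<le> B * (1 + real (size \<xi>))"
  shows "integrable (poisson_mset \<mu> q) (\<lambda>\<xi>. \<Sum>x\<in>#\<xi>. g x \<xi>)"
    and "(\<integral>\<xi>. (\<Sum>x\<in>#\<xi>. g x \<xi>) \<partial>poisson_mset \<mu> q)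
       = \<mu> * (\<integral>x. \<integral>\<xi>. g x (add_mset x \<xi>) \<partial>poisson_mset \<mu> q \<partial>q)"
proof -
  let ?P = "poisson_mset \<mu> q"
  note int_size = integrable_size_poisson_mset[OF \<mu>, of q]
  define G where "G = (\<lambda>x. \<integral>\<xi>. g x (add_mset x \<xi>) \<partial>?P)"
  have int_dom: "integrable ?P (\<lambda>\<xi>. B * (1 + real (size (add_mset x \<xi>))))" for x
    using int_size by simp
  have int_g: "integrable ?P (\<lambda>\<xi>. g x (add_mset x \<xi>))" for x
    by (rule Bochner_Integration.integrable_bound[OF int_dom[of x]])
       (use bnd in \<open>auto simp del: size_add_mset intro!: AE_I2 intro: order_trans[OF _ abs_ge_self]\<close>)
  have G0: "0 \<le> G x" for x
    unfolding G_def using bnd by (intro integral_nonneg_AE) auto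
  have GB: "G x \<le> B * (2 + \<mu>)" for x
  proof -
    have "G x \<le> (\<integral>\<xi>. B * (1 + real (size (add_mset x \<xi>))) \<partial>?P)"
      unfolding G_def using bnd by (intro integral_mono int_g int_dom) (auto simp del: size_add_mset)
    also have "\<dots> = B * (2 + \<mu>)"
      using int_size by (simp add: expectation_size_poisson_mset[OF \<mu>] measure_pmf.prob_space[simplified])
    finally show ?thesis .
  qed
  have int_G: "integrable q G"
    using G0 GB by (intro measure_pmf.integrable_const_bound[where B = "B * (2 + \<mu>)"]) auto
  have nn: "(\<integral>\<^sup>+\<xi>. ennreal (\<Sum>x\<in>#\<xi>. g x \<xi>) \<partial>?P) = ennreal (\<mu> * (\<integral>x. G x \<partial>q))"
  proof -
    have "(\<integral>\<^sup>+\<xi>. ennreal (\<Sum>x\<in>#\<xi>. g x \<xi>) \<partial>?P)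
        = ennreal \<mu> * (\<integral>\<^sup>+x. \<integral>\<^sup>+\<xi>. ennreal (g x (add_mset x \<xi>)) \<partial>?P \<partial>q)"
      by (simp add: ennreal_sum_mset bnd mecke_poisson_mset_nn[OF \<mu>])
    also have "(\<integral>\<^sup>+x. \<integral>\<^sup>+\<xi>. ennreal (g x (add_mset x \<xi>)) \<partial>?P \<partial>q) = (\<integral>\<^sup>+x. ennreal (G x) \<partial>q)"
      unfolding G_def by (intro nn_integral_cong nn_integral_eq_integral int_g) (use bnd in auto)
    also have "\<dots> = ennreal (\<integral>x. G x \<partial>q)"
      by (intro nn_integral_eq_integral int_G) (use G0 in auto)
    also have "ennreal \<mu> * \<dots> = ennreal (\<mu> * (\<integral>x. G x \<partial>q))"
      using \<mu> G0 by (intro ennreal_mult[symmetric] integral_nonneg_AE) auto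
    finally show ?thesis .
  qed
  have S0: "0 \<le> (\<Sum>x\<in>#\<xi>. g x \<xi>)" for \<xi>
    using bnd by (intro sum_mset_nonneg_real) auto
  show "integrable ?P (\<lambda>\<xi>. \<Sum>x\<in>#\<xi>. g x \<xi>)"
    by (rule integrableI_nonneg) (use nn S0 in auto)
  have "0 \<le> \<mu> * (\<integral>x. G x \<partial>q)"
    using \<mu> G0 by (intro mult_nonneg_nonneg integral_nonneg_AE) auto
  then show "(\<integral>\<xi>. (\<Sum>x\<in>#\<xi>. g x \<xi>) \<partial>?P) = \<mu> * (\<integral>x. \<integral>\<xi>. g x (add_mset x \<xi>) \<partial>?P \<partial>q)"
    using nn S0 unfolding G_def by (subst integral_eq_nn_integral) auto
qed

text \<open>Adding the dominating function \<open>B * (1 + size)\<close> makes \<open>g\<close>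
  nonnegative. The sum and the dominating function both fall under the nonnegative case, and the
  difference is taken at the end.\<close>

lemma mecke_poisson_mset:
  fixes g :: "'a \<Rightarrow> 'a multiset \<Rightarrow> real" and q :: "'a pmf"
  assumes \<mu>: "\<mu> \<ge> 0" and bnd: "\<And>x \<xi>. \<bar>g x \<xi>\<bar> \<le> B * (1 + real (size \<xi>))"
  shows "integrable (poisson_mset \<mu> q) (\<lambda>\<xi>. \<Sum>x\<in>#\<xi>. g x \<xi>)"
    and "(\<integral>\<xi>. (\<Sum>x\<in>#\<xi>. g x \<xi>) \<partial>poisson_mset \<mu> q)
       = \<mu> * (\<integral>x. \<integral>\<xi>. g x (add_mset x \<xi>) \<partial>poisson_mset \<mu> q \<partial>q)"
proof -
  let ?P = "poisson_mset \<mu> q"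
  define h where "h = (\<lambda>(x::'a) \<xi>. B * (1 + real (size (\<xi>::'a multiset))))"
  have h: "0 \<le> h x \<xi>" "h x \<xi> \<le> (2 * B) * (1 + real (size \<xi>))" for x \<xi>
  proof -
    have "0 \<le> B * (1 + real (size \<xi>))" using bnd[of x \<xi>] by linarith
    then show "0 \<le> h x \<xi>" "h x \<xi> \<le> (2 * B) * (1 + real (size \<xi>))" by (auto simp: h_def)
  qed
  have gh: "0 \<le> g x \<xi> + h x \<xi>" "g x \<xi> + h x \<xi> \<le> (2 * B) * (1 + real (size \<xi>))" for x \<xi>
    using bnd[of x \<xi>] by (auto simp: h_def abs_le_iff)
  note m1 = mecke_poisson_mset_nonneg[OF \<mu>, where g = "\<lambda>x \<xi>. g x \<xi> + h x \<xi>" and q = q, OF gh]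
  note m2 = mecke_poisson_mset_nonneg[OF \<mu>, where g = h and q = q, OF h]
  have eq: "(\<Sum>x\<in>#\<xi>. g x \<xi>) = (\<Sum>x\<in>#\<xi>. g x \<xi> + h x \<xi>) - (\<Sum>x\<in>#\<xi>. h x \<xi>)" for \<xi>
    by (simp add: sum_mset.distrib)
  show "integrable ?P (\<lambda>\<xi>. \<Sum>x\<in>#\<xi>. g x \<xi>)"
    unfolding eq by (intro Bochner_Integration.integrable_diff m1 m2)
  note int_size = integrable_size_poisson_mset[OF \<mu>, of q]
  have int_h: "integrable ?P (\<lambda>\<xi>. h x (add_mset x \<xi>))" for x
    using int_size by (simp add: h_def)
  have int_g: "integrable ?P (\<lambda>\<xi>. g x (add_mset x \<xi>))" for x
    by (rule Bochner_Integration.integrable_bound[OF int_h[of x]])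
       (use bnd in \<open>auto simp: h_def simp del: size_add_mset intro!: AE_I2 intro: order_trans[OF _ abs_ge_self]\<close>)
  have hval: "(\<integral>\<xi>. h x (add_mset x \<xi>) \<partial>?P) = B * (2 + \<mu>)" for x
    using int_size by (simp add: h_def expectation_size_poisson_mset[OF \<mu>] measure_pmf.prob_space[simplified])
  have gval: "\<bar>\<integral>\<xi>. g x (add_mset x \<xi>) \<partial>?P\<bar> \<le> B * (2 + \<mu>)" for x
  proof -
    have "\<bar>\<integral>\<xi>. g x (add_mset x \<xi>) \<partial>?P\<bar> \<le> (\<integral>\<xi>. \<bar>g x (add_mset x \<xi>)\<bar> \<partial>?P)"
      by (rule integral_abs_bound)
    also have "\<dots> \<le> (\<integral>\<xi>. h x (add_mset x \<xi>) \<partial>?P)"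
      using bnd int_g int_h by (intro integral_mono) (auto simp: h_def simp del: size_add_mset)
    finally show ?thesis by (simp add: hval)
  qed
  have int_qg: "integrable q (\<lambda>x. \<integral>\<xi>. g x (add_mset x \<xi>) \<partial>?P)"
    using gval by (intro measure_pmf.integrable_const_bound[where B = "B * (2 + \<mu>)"]) auto
  have "(\<integral>\<xi>. (\<Sum>x\<in>#\<xi>. g x \<xi>) \<partial>?P)
      = (\<integral>\<xi>. (\<Sum>x\<in>#\<xi>. g x \<xi> + h x \<xi>) \<partial>?P) - (\<integral>\<xi>. (\<Sum>x\<in>#\<xi>. h x \<xi>) \<partial>?P)"
    unfolding eq by (intro Bochner_Integration.integral_diff m1 m2)
  also have "\<dots> = \<mu> * ((\<integral>x. (\<integral>\<xi>. g x (add_mset x \<xi>) \<partial>?P) + B * (2 + \<mu>) \<partial>q) - (\<integral>x. B * (2 + \<mu>) \<partial>q))"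
    using int_g int_h by (simp only: m1 m2 hval right_diff_distrib Bochner_Integration.integral_add)
  also have "\<dots> = \<mu> * (\<integral>x. \<integral>\<xi>. g x (add_mset x \<xi>) \<partial>?P \<partial>q)"
    using int_qg by simp
  finally show "(\<integral>\<xi>. (\<Sum>x\<in>#\<xi>. g x \<xi>) \<partial>?P)
      = \<mu> * (\<integral>x. \<integral>\<xi>. g x (add_mset x \<xi>) \<partial>?P \<partial>q)" .
qed

section \<open>Linear statistics and the insertion of a point\<close>

text \<open>The second moment is a second use of the Mecke formula: inserting \<open>x\<close> into
  the factor \<open>S\<close> raises it by \<open>\<rho> x\<close>, and this shift accounts for the
  whole variance.\<close>

lemma poisson_mset_linear_moments:
  fixes \<rho> :: "'a \<Rightarrow> real" and q :: "'a pmf"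
  assumes \<mu>: "\<mu> \<ge> 0" and \<rho>: "\<And>x. \<bar>\<rho> x\<bar> \<le> W"
  shows "integrable (poisson_mset \<mu> q) (\<lambda>\<xi>. \<Sum>x\<in>#\<xi>. \<rho> x)"
    and "(\<integral>\<xi>. (\<Sum>x\<in>#\<xi>. \<rho> x) \<partial>poisson_mset \<mu> q) = \<mu> * (\<integral>x. \<rho> x \<partial>q)"
    and "integrable (poisson_mset \<mu> q) (\<lambda>\<xi>. (\<Sum>x\<in>#\<xi>. \<rho> x)\<^sup>2)"
    and "(\<integral>\<xi>. (\<Sum>x\<in>#\<xi>. \<rho> x)\<^sup>2 \<partial>poisson_mset \<mu> q)
      = \<mu> * (\<integral>x. (\<rho> x)\<^sup>2 \<partial>q) + (\<mu> * (\<integral>x. \<rho> x \<partial>q))\<^sup>2"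
proof -
  let ?P = "poisson_mset \<mu> q"
  define S where "S = (\<lambda>\<xi>. \<Sum>x\<in>#\<xi>. \<rho> x)"
  have W0: "W \<ge> 0" using \<rho>[of undefined] by linarith
  have b1: "\<bar>\<rho> x\<bar> \<le> W * (1 + real (size \<xi>))" for x and \<xi> :: "'a multiset"
  proof -
    have "W * 1 \<le> W * (1 + real (size \<xi>))" using W0 by (intro mult_left_mono) auto
    with \<rho>[of x] show ?thesis by simp
  qed
  have Sb: "\<bar>S \<xi>\<bar> \<le> W * real (size \<xi>)" for \<xi>
    unfolding S_def by (rule abs_sum_mset_le) (rule \<rho>)
  have b2: "\<bar>\<rho> x * S \<xi>\<bar> \<le> (W * W) * (1 + real (size \<xi>))" for x \<xi>
  proof -
    have "\<bar>\<rho> x * S \<xi>\<bar> \<le> W * (W * real (size \<xi>))"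
      unfolding abs_mult using W0 \<rho> Sb by (intro mult_mono) auto
    also have "\<dots> \<le> (W * W) * (1 + real (size \<xi>))" by (simp add: algebra_simps)
    finally show ?thesis .
  qed
  note M1 = mecke_poisson_mset[OF \<mu>, where g = "\<lambda>x \<xi>. \<rho> x", OF b1, where q = q]
  note M2 = mecke_poisson_mset[OF \<mu>, where g = "\<lambda>x \<xi>. \<rho> x * S \<xi>", OF b2, where q = q]
  have sq: "(S \<xi>)\<^sup>2 = (\<Sum>x\<in>#\<xi>. \<rho> x * S \<xi>)" for \<xi>
    by (simp add: power2_eq_square sum_mset_distrib_right S_def)
  show int1: "integrable ?P (\<lambda>\<xi>. \<Sum>x\<in>#\<xi>. \<rho> x)" by (rule M1)
  show e1: "(\<integral>\<xi>. (\<Sum>x\<in>#\<xi>. \<rho> x) \<partial>?P) = \<mu> * (\<integral>x. \<rho> x \<partial>q)"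
    using M1(2) by (simp add: measure_pmf.prob_space[simplified])
  show "integrable ?P (\<lambda>\<xi>. (\<Sum>x\<in>#\<xi>. \<rho> x)\<^sup>2)"
    using M2(1) unfolding sq[symmetric] by (simp add: S_def)
  have intS: "integrable ?P S" using int1 by (simp add: S_def)
  have eS: "(\<integral>\<xi>. S \<xi> \<partial>?P) = \<mu> * (\<integral>x. \<rho> x \<partial>q)" using e1 by (simp add: S_def)
  have int\<rho>: "integrable q \<rho>" "integrable q (\<lambda>x. (\<rho> x)\<^sup>2)"
    using \<rho> W0 by (auto intro: measure_pmf.integrable_const_bound[where B = W]
        measure_pmf.integrable_const_bound[where B = "W\<^sup>2"] simp: power2_le_iff_abs_le)
  have "(\<integral>\<xi>. (S \<xi>)\<^sup>2 \<partial>?P) = \<mu> * (\<integral>x. \<integral>\<xi>. \<rho> x * S (add_mset x \<xi>) \<partial>?P \<partial>q)"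
    unfolding sq by (rule M2(2))
  also have "(\<lambda>x. \<integral>\<xi>. \<rho> x * S (add_mset x \<xi>) \<partial>?P) = (\<lambda>x. (\<rho> x)\<^sup>2 + \<rho> x * (\<mu> * (\<integral>x. \<rho> x \<partial>q)))"
  proof
    fix x
    have "(\<integral>\<xi>. \<rho> x * S (add_mset x \<xi>) \<partial>?P) = (\<integral>\<xi>. (\<rho> x)\<^sup>2 + \<rho> x * S \<xi> \<partial>?P)"
      by (simp add: S_def power2_eq_square distrib_left)
    also have "\<dots> = (\<rho> x)\<^sup>2 + \<rho> x * (\<mu> * (\<integral>x. \<rho> x \<partial>q))"
      using intS eS by (simp add: measure_pmf.prob_space[simplified])
    finally show "(\<integral>\<xi>. \<rho> x * S (add_mset x \<xi>) \<partial>?P) = \<dots>" .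
  qed
  also have "(\<integral>x. (\<rho> x)\<^sup>2 + \<rho> x * (\<mu> * (\<integral>x. \<rho> x \<partial>q)) \<partial>q)
      = (\<integral>x. (\<rho> x)\<^sup>2 \<partial>q) + (\<integral>x. \<rho> x \<partial>q) * (\<mu> * (\<integral>x. \<rho> x \<partial>q))"
    using int\<rho> by simp
  finally show "(\<integral>\<xi>. (\<Sum>x\<in>#\<xi>. \<rho> x)\<^sup>2 \<partial>?P) = \<mu> * (\<integral>x. (\<rho> x)\<^sup>2 \<partial>q) + (\<mu> * (\<integral>x. \<rho> x \<partial>q))\<^sup>2"
    by (simp add: S_def power2_eq_square algebra_simps)
qed

text \<open>The number of points is Poisson, so its fluctuations are of order \<open>sqrt \<mu>\<close> and adding
  one more point is invisible as \<open>\<mu>\<close> grows.\<close>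

lemma poisson_mset_insert_stable:
  fixes \<rho> :: "'a \<Rightarrow> real" and g :: "'a multiset \<Rightarrow> real" and q :: "'a pmf"
  assumes \<mu>: "\<mu> > 0" and \<rho>: "\<And>x. \<bar>\<rho> x\<bar> \<le> W" and g: "\<And>\<xi>. \<bar>g \<xi>\<bar> \<le> 1"
  shows "\<bar>\<integral>x. \<integral>\<xi>. \<rho> x * (g (add_mset x \<xi>) - g \<xi>) \<partial>poisson_mset \<mu> q \<partial>q\<bar> \<le> W / sqrt \<mu>"
proof -
  let ?P = "poisson_mset \<mu> q"
  define S where "S = (\<lambda>\<xi>. \<Sum>x\<in>#\<xi>. \<rho> x)"
  define r where "r = (\<integral>x. \<rho> x \<partial>q)"
  have W0: "W \<ge> 0" using \<rho>[of undefined] by linarith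
  have mom: "integrable ?P S" "(\<integral>\<xi>. S \<xi> \<partial>?P) = \<mu> * r" "integrable ?P (\<lambda>\<xi>. (S \<xi>)\<^sup>2)"
      "(\<integral>\<xi>. (S \<xi>)\<^sup>2 \<partial>?P) = \<mu> * (\<integral>x. (\<rho> x)\<^sup>2 \<partial>q) + (\<mu> * r)\<^sup>2"
    using poisson_mset_linear_moments[OF less_imp_le[OF \<mu>], of \<rho> W q, OF \<rho>]
    by (simp_all add: S_def r_def)
  have int_g: "integrable ?P g" "integrable ?P (\<lambda>\<xi>. g (add_mset x \<xi>))" for x
    using g by (auto intro!: measure_pmf.integrable_const_bound[where B = 1])
  have int_\<rho>: "integrable q \<rho>"
    using \<rho> by (intro measure_pmf.integrable_const_bound[where B = W]) auto
  have gb: "\<bar>\<integral>\<xi>. g (f \<xi>) \<partial>?P\<bar> \<le> 1" for f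
  proof -
    have "\<bar>\<integral>\<xi>. g (f \<xi>) \<partial>?P\<bar> \<le> (\<integral>\<xi>. \<bar>g (f \<xi>)\<bar> \<partial>?P)" by (rule integral_abs_bound)
    also have "\<dots> \<le> 1"
      using g by (intro measure_pmf.integral_le_const measure_pmf.integrable_const_bound[where B = 1]) auto
    finally show ?thesis .
  qed
  have int_\<rho>g: "integrable q (\<lambda>x. \<rho> x * (\<integral>\<xi>. g (add_mset x \<xi>) \<partial>?P))"
  proof (rule measure_pmf.integrable_const_bound[where B = "W * 1"])
    show "AE x in q. norm (\<rho> x * (\<integral>\<xi>. g (add_mset x \<xi>) \<partial>?P)) \<le> W * 1"
      unfolding real_norm_def abs_mult using \<rho> gb W0 by (intro AE_I2 mult_mono) auto
  qed simp
  have b: "\<bar>\<rho> x * g \<xi>\<bar> \<le> W * (1 + real (size \<xi>))" for x \<xi>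
  proof -
    have "\<bar>\<rho> x * g \<xi>\<bar> \<le> W * 1"
      unfolding abs_mult using W0 \<rho> g by (intro mult_mono) auto
    also have "W * 1 \<le> W * (1 + real (size \<xi>))" using W0 by (intro mult_left_mono) auto
    finally show ?thesis .
  qed
  note M = mecke_poisson_mset[OF less_imp_le[OF \<mu>], where g = "\<lambda>x \<xi>. \<rho> x * g \<xi>", OF b, where q = q]
  have Sg: "(\<Sum>x\<in>#\<xi>. \<rho> x * g \<xi>) = S \<xi> * g \<xi>" for \<xi>
    by (simp add: S_def sum_mset_distrib_right)
  have int_Sg: "integrable ?P (\<lambda>\<xi>. S \<xi> * g \<xi>)" using M(1) by (simp only: Sg)
  let ?D = "\<lambda>\<xi>. S \<xi> - \<mu> * r"
  have int_D: "integrable ?P (\<lambda>\<xi>. (?D \<xi>)\<^sup>2)"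
    using mom by (simp add: power2_diff measure_pmf.prob_space[simplified])
  have var: "(\<integral>\<xi>. (?D \<xi>)\<^sup>2 \<partial>?P) \<le> \<mu> * W\<^sup>2"
  proof -
    have "(\<integral>\<xi>. (?D \<xi>)\<^sup>2 \<partial>?P) = \<mu> * (\<integral>x. (\<rho> x)\<^sup>2 \<partial>q)"
    proof -
      have "(\<integral>\<xi>. (?D \<xi>)\<^sup>2 \<partial>?P) = (\<integral>\<xi>. (S \<xi>)\<^sup>2 + (\<mu> * r)\<^sup>2 - 2 * S \<xi> * (\<mu> * r) \<partial>?P)"
        by (simp add: power2_diff)
      also have "\<dots> = \<mu> * (\<integral>x. (\<rho> x)\<^sup>2 \<partial>q) + (\<mu> * r)\<^sup>2 + (\<mu> * r)\<^sup>2 - 2 * (\<mu> * r) * (\<mu> * r)"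
        using mom by (simp add: measure_pmf.prob_space[simplified])
      finally show ?thesis by (simp add: power2_eq_square)
    qed
    also have "(\<integral>x. (\<rho> x)\<^sup>2 \<partial>q) \<le> W\<^sup>2"
      using \<rho> W0 by (intro measure_pmf.integral_le_const measure_pmf.integrable_const_bound[where B = "W\<^sup>2"])
        (auto simp: power2_le_iff_abs_le)
    finally show ?thesis using \<mu> by simp
  qed
  \<comment> \<open>The Mecke formula trades the insertion of a point for the centred sum: the
    expression becomes the covariance of \<open>S\<close> with \<open>g\<close>, which the variance
    of \<open>S\<close> controls.\<close>
  have "\<mu> * (\<integral>x. \<integral>\<xi>. \<rho> x * (g (add_mset x \<xi>) - g \<xi>) \<partial>?P \<partial>q)
      = \<mu> * (\<integral>x. \<integral>\<xi>. \<rho> x * g (add_mset x \<xi>) \<partial>?P \<partial>q) - \<mu> * r * (\<integral>\<xi>. g \<xi> \<partial>?P)"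
    using int_g int_\<rho>g int_\<rho> by (simp add: right_diff_distrib r_def)
  also have "\<dots> = (\<integral>\<xi>. S \<xi> * g \<xi> \<partial>?P) - \<mu> * r * (\<integral>\<xi>. g \<xi> \<partial>?P)"
    using M(2) by (simp only: Sg)
  also have "\<dots> = (\<integral>\<xi>. ?D \<xi> * g \<xi> \<partial>?P)"
    using int_Sg int_g by (simp add: left_diff_distrib)
  finally have eq: "\<mu> * (\<integral>x. \<integral>\<xi>. \<rho> x * (g (add_mset x \<xi>) - g \<xi>) \<partial>?P \<partial>q) = (\<integral>\<xi>. ?D \<xi> * g \<xi> \<partial>?P)" .
  have int_absD: "integrable ?P (\<lambda>\<xi>. \<bar>?D \<xi>\<bar>)" using mom by simp
  have "\<bar>\<integral>\<xi>. ?D \<xi> * g \<xi> \<partial>?P\<bar> \<le> (\<integral>\<xi>. \<bar>?D \<xi> * g \<xi>\<bar> \<partial>?P)" by (rule integral_abs_bound)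
  also have "\<dots> \<le> (\<integral>\<xi>. \<bar>?D \<xi>\<bar> \<partial>?P)"
  proof (intro integral_mono int_absD)
    show "integrable ?P (\<lambda>\<xi>. \<bar>?D \<xi> * g \<xi>\<bar>)"
      using int_Sg int_g by (simp add: left_diff_distrib)
    show "\<bar>?D \<xi> * g \<xi>\<bar> \<le> \<bar>?D \<xi>\<bar>" for \<xi>
      using mult_left_mono[OF g[of \<xi>], of "\<bar>?D \<xi>\<bar>"] by (simp add: abs_mult)
  qed
  also have "\<dots> \<le> sqrt (\<integral>\<xi>. (?D \<xi>)\<^sup>2 \<partial>?P)"
  proof (rule real_le_rsqrt)
    have "0 \<le> measure_pmf.variance ?P (\<lambda>\<xi>. \<bar>?D \<xi>\<bar>)" by simp
    also have "\<dots> = (\<integral>\<xi>. (?D \<xi>)\<^sup>2 \<partial>?P) - (\<integral>\<xi>. \<bar>?D \<xi>\<bar> \<partial>?P)\<^sup>2"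
      using int_absD int_D by (subst measure_pmf.variance_eq) auto
    finally show "(\<integral>\<xi>. \<bar>?D \<xi>\<bar> \<partial>?P)\<^sup>2 \<le> (\<integral>\<xi>. (?D \<xi>)\<^sup>2 \<partial>?P)" by simp
  qed
  also have "\<dots> \<le> sqrt (\<mu> * W\<^sup>2)" using var by (rule real_sqrt_le_mono)
  also have "\<dots> = sqrt \<mu> * W" using W0 by (simp add: real_sqrt_mult)
  finally have "\<mu> * \<bar>\<integral>x. \<integral>\<xi>. \<rho> x * (g (add_mset x \<xi>) - g \<xi>) \<partial>?P \<partial>q\<bar> \<le> sqrt \<mu> * W"
    using \<mu> unfolding eq[symmetric] by (simp add: abs_mult)
  then have "sqrt \<mu> * \<bar>\<integral>x. \<integral>\<xi>. \<rho> x * (g (add_mset x \<xi>) - g \<xi>) \<partial>?P \<partial>q\<bar> \<le> W"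
    using \<mu> real_sqrt_mult_self[of \<mu>] by (smt (verit) mult.assoc mult_le_cancel_left_pos real_sqrt_gt_zero)
  then show ?thesis using \<mu> by (simp add: field_simps)
qed

section \<open>Multiplicity of one point, and void probabilities\<close>

text \<open>The Mecke formula for a function that charges only the point \<open>x\<close>: each of
  its \<open>Suc n\<close> copies is counted once, and inserting \<open>x\<close> raises the
  multiplicity from \<open>n\<close> to \<open>Suc n\<close>.\<close>

lemma poisson_mset_count_shift:
  fixes g :: "'a multiset \<Rightarrow> real" and q :: "'a pmf"
  assumes \<mu>: "\<mu> \<ge> 0" and g: "\<And>\<xi>. \<bar>g \<xi>\<bar> \<le> B"
  shows "real (Suc n) * (\<integral>\<xi>. of_bool (count \<xi> x = Suc n) * g \<xi> \<partial>poisson_mset \<mu> q)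
       = \<mu> * pmf q x * (\<integral>\<xi>. of_bool (count \<xi> x = n) * g (add_mset x \<xi>) \<partial>poisson_mset \<mu> q)"
proof -
  let ?P = "poisson_mset \<mu> q"
  let ?g = "\<lambda>y \<xi>. of_bool (y = x) * (of_bool (count \<xi> x = Suc n) * g \<xi>)"
  have B0: "B \<ge> 0" using g[of undefined] by linarith
  have b: "\<bar>?g y \<xi>\<bar> \<le> B * (1 + real (size \<xi>))" for y \<xi>
  proof -
    have "\<bar>?g y \<xi>\<bar> \<le> B" using g[of \<xi>] B0 by auto
    also have "B * 1 \<le> B * (1 + real (size \<xi>))" using B0 by (intro mult_left_mono) auto
    finally show ?thesis by simp
  qed
  have s: "(\<Sum>y\<in>#\<xi>. ?g y \<xi>) = real (Suc n) * (of_bool (count \<xi> x = Suc n) * g \<xi>)" for \<xi>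
  proof -
    have "(\<Sum>y\<in>#\<xi>. of_bool (y = x)) = real (count \<xi> x)"
      by (induction \<xi>) auto
    then show ?thesis by (simp add: sum_mset_distrib_right[symmetric])
  qed
  have "real (Suc n) * (\<integral>\<xi>. of_bool (count \<xi> x = Suc n) * g \<xi> \<partial>?P) = (\<integral>\<xi>. (\<Sum>y\<in>#\<xi>. ?g y \<xi>) \<partial>?P)"
    unfolding s by simp
  also have "\<dots> = \<mu> * (\<integral>y. \<integral>\<xi>. ?g y (add_mset y \<xi>) \<partial>?P \<partial>q)"
    by (rule mecke_poisson_mset(2)[OF \<mu> b])
  also have "(\<lambda>y. \<integral>\<xi>. ?g y (add_mset y \<xi>) \<partial>?P)
      = (\<lambda>y. indicator {x} y * (\<integral>\<xi>. of_bool (count \<xi> x = n) * g (add_mset x \<xi>) \<partial>?P))"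
    by (auto simp: fun_eq_iff indicator_def)
  also have "(\<integral>y. indicator {x} y * (\<integral>\<xi>. of_bool (count \<xi> x = n) * g (add_mset x \<xi>) \<partial>?P) \<partial>q)
      = pmf q x * (\<integral>\<xi>. of_bool (count \<xi> x = n) * g (add_mset x \<xi>) \<partial>?P)"
    by (simp add: pmf.rep_eq)
  finally show ?thesis by simp
qed

text \<open>The multiplicity of a point is Poisson and independent of the remaining sample, so a
  sample with \<open>n\<close> copies looks like one with none to which \<open>n\<close> copies are
  added. The factorial stays on the left to keep the induction free of division.\<close>

lemma poisson_mset_count_eq:
  fixes g :: "'a multiset \<Rightarrow> real" and q :: "'a pmf"
  assumes \<mu>: "\<mu> \<ge> 0" and g: "\<And>\<xi>. \<bar>g \<xi>\<bar> \<le> B"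
  shows "fact n * (\<integral>\<xi>. of_bool (count \<xi> x = n) * g \<xi> \<partial>poisson_mset \<mu> q)
       = (\<mu> * pmf q x) ^ n * (\<integral>\<xi>. of_bool (count \<xi> x = 0) * g ((add_mset x ^^ n) \<xi>) \<partial>poisson_mset \<mu> q)"
  using g
proof (induction n arbitrary: g)
  case (Suc n)
  let ?P = "poisson_mset \<mu> q"
  have "fact (Suc n) * (\<integral>\<xi>. of_bool (count \<xi> x = Suc n) * g \<xi> \<partial>?P)
      = fact n * (real (Suc n) * (\<integral>\<xi>. of_bool (count \<xi> x = Suc n) * g \<xi> \<partial>?P))"
    by simp
  also have "\<dots> = \<mu> * pmf q x * (fact n * (\<integral>\<xi>. of_bool (count \<xi> x = n) * g (add_mset x \<xi>) \<partial>?P))"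
    by (subst poisson_mset_count_shift[OF \<mu> Suc.prems]) simp
  also have "\<dots> = (\<mu> * pmf q x) ^ Suc n
      * (\<integral>\<xi>. of_bool (count \<xi> x = 0) * g ((add_mset x ^^ Suc n) \<xi>) \<partial>?P)"
    by (subst Suc.IH[where g = "\<lambda>\<xi>. g (add_mset x \<xi>)"]) (auto intro: Suc.prems)
  finally show ?case .
qed simp

text \<open>Every point avoids \<open>A\<close> independently with probability \<open>p\<close>, and
  the generating function of the Poisson number at \<open>p\<close> is the exponential.\<close>

lemma poisson_mset_void:
  fixes q :: "'a pmf"
  assumes \<mu>: "\<mu> \<ge> 0"
  shows "(\<integral>\<xi>. of_bool (\<forall>x\<in>#\<xi>. x \<notin> A) \<partial>poisson_mset \<mu> q) = exp (- \<mu> * measure_pmf.prob q A)"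
proof -
  define p where "p = measure_pmf.prob q (- A)"
  have p01: "0 \<le> p" by (simp add: p_def)
  have p: "p = 1 - measure_pmf.prob q A"
    unfolding p_def using measure_pmf.prob_compl[of A q] by (simp add: Compl_eq_Diff_UNIV)
  have it: "(\<integral>\<^sup>+\<xi>. ennreal (of_bool (\<forall>x\<in>#\<xi>. x \<notin> A)) \<partial>iid_mset k q) = ennreal (p ^ k)" for k
  proof (induction k)
    case (Suc k)
    have "(\<integral>\<^sup>+\<xi>. ennreal (of_bool (\<forall>x\<in>#\<xi>. x \<notin> A)) \<partial>iid_mset (Suc k) q)
        = (\<integral>\<^sup>+x. indicator (- A) x * (\<integral>\<^sup>+\<xi>. ennreal (of_bool (\<forall>x\<in>#\<xi>. x \<notin> A)) \<partial>iid_mset k q) \<partial>q)"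
      unfolding nn_integral_iid_mset_Suc
      by (intro nn_integral_cong) (auto split: split_indicator intro!: nn_integral_cong)
    also have "\<dots> = ennreal p * ennreal (p ^ k)"
      unfolding Suc.IH by (subst nn_integral_multc) (auto simp: p_def measure_pmf.emeasure_eq_measure)
    finally show ?case using p01 by (simp add: ennreal_mult)
  qed simp
  have "(\<integral>\<^sup>+\<xi>. ennreal (of_bool (\<forall>x\<in>#\<xi>. x \<notin> A)) \<partial>poisson_mset \<mu> q) = (\<integral>\<^sup>+k. ennreal (p ^ k) \<partial>poisson_law \<mu>)"
    unfolding poisson_mset_def nn_integral_bind_pmf it ..
  also have "\<dots> = ennreal (exp (- \<mu> * measure_pmf.prob q A))"
  proof (cases "\<mu> = 0")
    case True
    then show ?thesis by (simp add: poisson_law_def)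
  next
    case False
    with \<mu> have pos: "\<mu> > 0" by simp
    have "(\<integral>\<^sup>+k. ennreal (p ^ k) \<partial>poisson_law \<mu>)
       = (\<Sum>k. ennreal (\<mu> ^ k / fact k * exp (-\<mu>)) * ennreal (p ^ k))"
      using pos by (simp add: poisson_law_def nn_integral_measure_pmf nn_integral_count_space_nat)
    also have "\<dots> = (\<Sum>k. ennreal (exp (-\<mu>) * ((\<mu> * p) ^ k /\<^sub>R fact k)))"
      using pos p01 by (intro suminf_cong) (auto simp: power_mult_distrib field_simps simp flip: ennreal_mult)
    also have "\<dots> = ennreal (exp (-\<mu>) * exp (\<mu> * p))"
      using pos p01 by (intro suminf_ennreal_eq sums_mult exp_converges) auto
    also have "exp (-\<mu>) * exp (\<mu> * p) = exp (- \<mu> * measure_pmf.prob q A)"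
      unfolding exp_add[symmetric] p by (simp add: algebra_simps)
    finally show ?thesis .
  qed
  finally have "(\<integral>\<^sup>+\<xi>. ennreal (of_bool (\<forall>x\<in>#\<xi>. x \<notin> A)) \<partial>poisson_mset \<mu> q)
      = ennreal (exp (- \<mu> * measure_pmf.prob q A))" .
  then show ?thesis by (subst integral_eq_nn_integral) auto
qed

section \<open>Gibbs averages and their reweighting\<close>

definition spin :: "(nat \<Rightarrow> real) \<Rightarrow> nat list \<Rightarrow> real" where
  "spin \<sigma> is = prod_list (map \<sigma> is)"

definition Sites :: "nat \<Rightarrow> nat \<Rightarrow> nat list set" where
  "Sites N m = {is. set is \<subseteq> {1..N} \<and> length is = m}"

definition site_mean :: "nat \<Rightarrow> nat \<Rightarrow> (nat list \<Rightarrow> real) \<Rightarrow> real" where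
  "site_mean N m f = (\<Sum>is\<in>Sites N m. f is) / real N ^ m"

text \<open>\<open>W\<close> is an unnormalized weight, so that a change of the Hamiltonian is a
  pointwise product and constant factors cancel.\<close>

definition avg :: "nat \<Rightarrow> ((nat \<Rightarrow> real) \<Rightarrow> real) \<Rightarrow> ((nat \<Rightarrow> real) \<Rightarrow> real) \<Rightarrow> real" where
  "avg N W g = (\<Sum>\<sigma>\<in>configs N. W \<sigma> * g \<sigma>) / (\<Sum>\<sigma>\<in>configs N. W \<sigma>)"

definition pos_weight :: "nat \<Rightarrow> ((nat \<Rightarrow> real) \<Rightarrow> real) \<Rightarrow> bool" where
  "pos_weight N W \<longleftrightarrow> (\<forall>\<sigma>\<in>configs N. 0 < W \<sigma>)"

lemma spin_Nil [simp]: "spin \<sigma> [] = 1"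
  and spin_Cons [simp]: "spin \<sigma> (x # is) = \<sigma> x * spin \<sigma> is"
  and spin_append [simp]: "spin \<sigma> (is @ js) = spin \<sigma> is * spin \<sigma> js"
  by (simp_all add: spin_def)

lemma finite_configs [simp]: "finite (configs N)"
  by (simp add: configs_def finite_PiE)

lemma configs_nonempty [simp]: "configs N \<noteq> {}"
  by (simp add: configs_def PiE_eq_empty_iff)

lemma configs_cases: "\<sigma> \<in> configs N \<Longrightarrow> x \<in> {1..N} \<Longrightarrow> \<sigma> x = 1 \<or> \<sigma> x = -1"
  by (auto simp: configs_def PiE_def Pi_def)

lemma spin_cases:
  assumes "\<sigma> \<in> configs N" "set is \<subseteq> {1..N}"
  shows "spin \<sigma> is = 1 \<or> spin \<sigma> is = -1"
  using assms(2)
proof (induction "is")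
  case (Cons x "is")
  then show ?case using configs_cases[OF assms(1), of x] by auto
qed simp

lemma abs_spin_le_1:
  assumes "\<sigma> \<in> configs N" "set is \<subseteq> {1..N}"
  shows "\<bar>spin \<sigma> is\<bar> \<le> 1"
  using spin_cases[OF assms] by auto

lemma finite_Sites [simp]: "finite (Sites N m)"
  unfolding Sites_def by (rule finite_lists_length_eq) simp

lemma card_Sites [simp]: "card (Sites N m) = N ^ m"
  unfolding Sites_def by (subst card_lists_length_eq) auto

lemma Sites_0 [simp]: "Sites N 0 = {[]}"
  by (auto simp: Sites_def)

lemma Sites_Suc: "Sites N (Suc m) = (\<lambda>(x, is). x # is) ` ({1..N} \<times> Sites N m)"
proof (intro equalityI subsetI)
  fix "is" assume "is \<in> Sites N (Suc m)"
  then show "is \<in> (\<lambda>(x, is). x # is) ` ({1..N} \<times> Sites N m)"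
    by (cases "is") (auto simp: Sites_def intro!: image_eqI[where x = "(hd is, tl is)"])
qed (auto simp: Sites_def)

lemma SitesD: "is \<in> Sites N m \<Longrightarrow> set is \<subseteq> {1..N}"
  by (simp add: Sites_def)

lemma site_mean_0 [simp]: "site_mean N 0 f = f []"
  by (simp add: site_mean_def)

lemma site_mean_Suc: "site_mean N (Suc m) f = (\<Sum>x=1..N. site_mean N m (\<lambda>is. f (x # is))) / real N"
proof -
  have "(\<Sum>is\<in>Sites N (Suc m). f is) = (\<Sum>(x, is)\<in>{1..N} \<times> Sites N m. f (x # is))"
    unfolding Sites_Suc by (subst sum.reindex) (auto simp: inj_on_def case_prod_unfold)
  then show ?thesis
    by (simp add: site_mean_def sum.cartesian_product[symmetric] sum_divide_distrib mult.commute)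
qed

lemma site_mean_append:
  "site_mean N (m + q) f = site_mean N m (\<lambda>is. site_mean N q (\<lambda>ks. f (is @ ks)))"
  by (induction m arbitrary: f) (simp_all add: site_mean_Suc)

lemma site_mean_cong:
  "(\<And>is. is \<in> Sites N m \<Longrightarrow> f is = g is) \<Longrightarrow> site_mean N m f = site_mean N m g"
  by (simp add: site_mean_def)

lemma site_mean_add: "site_mean N m (\<lambda>is. f is + g is) = site_mean N m f + site_mean N m g"
  by (simp add: site_mean_def sum.distrib add_divide_distrib)

lemma site_mean_diff: "site_mean N m (\<lambda>is. f is - g is) = site_mean N m f - site_mean N m g"
  by (simp add: site_mean_def sum_subtractf diff_divide_distrib)

lemma site_mean_cmult: "site_mean N m (\<lambda>is. c * f is) = c * site_mean N m f"
  by (simp add: site_mean_def sum_distrib_left)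

lemma site_mean_cmult_right: "site_mean N m (\<lambda>is. f is * c) = site_mean N m f * c"
  by (simp add: site_mean_def sum_distrib_right)

lemma site_mean_const: "N \<ge> 1 \<Longrightarrow> site_mean N m (\<lambda>_. c) = c"
  by (simp add: site_mean_def)

lemma site_mean_mono:
  "(\<And>is. is \<in> Sites N m \<Longrightarrow> f is \<le> g is) \<Longrightarrow> site_mean N m f \<le> site_mean N m g"
  by (simp add: site_mean_def divide_right_mono sum_mono)

lemma abs_site_mean_le: "\<bar>site_mean N m f\<bar> \<le> site_mean N m (\<lambda>is. \<bar>f is\<bar>)"
  by (simp add: site_mean_def divide_right_mono)

lemma abs_site_mean_bound:
  assumes "N \<ge> 1" "\<And>is. is \<in> Sites N m \<Longrightarrow> \<bar>f is\<bar> \<le> B"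
  shows "\<bar>site_mean N m f\<bar> \<le> B"
proof -
  have "\<bar>site_mean N m f\<bar> \<le> site_mean N m (\<lambda>_. B)"
    using assms by (intro order_trans[OF abs_site_mean_le] site_mean_mono)
  then show ?thesis using assms by (simp add: site_mean_const)
qed

lemma site_mean_prod_list:
  "site_mean N q (\<lambda>ks. prod_list (map w ks)) = ((\<Sum>x=1..N. w x) / real N) ^ q"
  by (induction q) (simp_all add: site_mean_Suc site_mean_cmult sum_distrib_right sum_divide_distrib)

text \<open>The \<open>q\<close> coordinates are exchangeable under the product weight, so all
  summands of the inner sum contribute equally. This turns the total error of \<open>q\<close>
  biased sites into an average over a single site; for \<open>q = 0\<close> the truncated exponent
  is multiplied by zero.\<close>

lemma site_mean_prod_list_sum_list:
  shows "site_mean N q (\<lambda>ks. prod_list (map w ks) * sum_list (map h ks))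
     = real q * (((\<Sum>x=1..N. w x) / real N) ^ (q - 1) * ((\<Sum>x=1..N. w x * h x) / real N))"
proof (induction q)
  case (Suc q)
  have Suc_step: "b * a ^ q + a * (real q * (a ^ (q - 1) * b)) = real (Suc q) * (a ^ q * b)" for a b :: real
    by (cases q) (simp_all add: algebra_simps)
  let ?w = "(\<Sum>x=1..N. w x) / real N" and ?wh = "(\<Sum>x=1..N. w x * h x) / real N"
  have "site_mean N q (\<lambda>ks. prod_list (map w (x # ks)) * sum_list (map h (x # ks)))
     = w x * h x * ?w ^ q + w x * (real q * (?w ^ (q - 1) * ?wh))" for x
  proof -
    have "(\<lambda>ks. prod_list (map w (x # ks)) * sum_list (map h (x # ks)))
        = (\<lambda>ks. (w x * h x) * prod_list (map w ks) + w x * (prod_list (map w ks) * sum_list (map h ks)))"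
      by (simp add: algebra_simps)
    then show ?thesis
      by (simp add: site_mean_add site_mean_cmult site_mean_prod_list Suc.IH)
  qed
  then have "site_mean N (Suc q) (\<lambda>ks. prod_list (map w ks) * sum_list (map h ks))
    = (\<Sum>x=1..N. w x * h x * ?w ^ q + w x * (real q * (?w ^ (q - 1) * ?wh))) / real N"
    by (simp only: site_mean_Suc)
  also have "\<dots> = ?wh * ?w ^ q + ?w * (real q * (?w ^ (q - 1) * ?wh))"
    by (simp only: sum.distrib sum_distrib_right[symmetric] add_divide_distrib times_divide_eq_left)
  also have "\<dots> = real (Suc q) * (?w ^ (Suc q - 1) * ?wh)"
    using Suc_step[of ?wh ?w] by simp
  finally show ?case .
qed simp

lemma pos_weight_sum: "pos_weight N W \<Longrightarrow> 0 < (\<Sum>\<sigma>\<in>configs N. W \<sigma>)"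
  by (intro sum_pos) (auto simp: pos_weight_def)

lemma avg_cong:
  "(\<And>\<sigma>. \<sigma> \<in> configs N \<Longrightarrow> W \<sigma> = W' \<sigma>) \<Longrightarrow> (\<And>\<sigma>. \<sigma> \<in> configs N \<Longrightarrow> g \<sigma> = g' \<sigma>)
    \<Longrightarrow> avg N W g = avg N W' g'"
  by (simp add: avg_def)

lemma avg_add: "avg N W (\<lambda>\<sigma>. g \<sigma> + h \<sigma>) = avg N W g + avg N W h"
  by (simp add: avg_def distrib_left sum.distrib add_divide_distrib)

lemma avg_diff: "avg N W (\<lambda>\<sigma>. g \<sigma> - h \<sigma>) = avg N W g - avg N W h"
  by (simp add: avg_def right_diff_distrib sum_subtractf diff_divide_distrib)

lemma avg_cmult: "avg N W (\<lambda>\<sigma>. c * g \<sigma>) = c * avg N W g"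
  by (simp add: avg_def sum_distrib_left mult.left_commute)

lemma avg_const: "pos_weight N W \<Longrightarrow> avg N W (\<lambda>_. c) = c"
  using pos_weight_sum[of N W] by (simp add: avg_def sum_distrib_right[symmetric])

lemma avg_mono:
  assumes "pos_weight N W" "\<And>\<sigma>. \<sigma> \<in> configs N \<Longrightarrow> g \<sigma> \<le> h \<sigma>"
  shows "avg N W g \<le> avg N W h"
  unfolding avg_def using assms pos_weight_sum[of N W]
  by (intro divide_right_mono sum_mono mult_left_mono) (auto simp: pos_weight_def less_imp_le)

lemma abs_avg_le:
  assumes "pos_weight N W"
  shows "\<bar>avg N W g\<bar> \<le> avg N W (\<lambda>\<sigma>. \<bar>g \<sigma>\<bar>)"
proof -
  have "avg N W g \<le> avg N W (\<lambda>\<sigma>. \<bar>g \<sigma>\<bar>)" "avg N W (\<lambda>\<sigma>. (-1) * g \<sigma>) \<le> avg N W (\<lambda>\<sigma>. \<bar>g \<sigma>\<bar>)"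
    using assms by (auto intro!: avg_mono)
  then show ?thesis unfolding avg_cmult by linarith
qed

lemma abs_avg_bound:
  assumes "pos_weight N W" "\<And>\<sigma>. \<sigma> \<in> configs N \<Longrightarrow> \<bar>g \<sigma>\<bar> \<le> B"
  shows "\<bar>avg N W g\<bar> \<le> B"
  using order_trans[OF abs_avg_le[OF assms(1), of g] avg_mono[OF assms(1), of "\<lambda>\<sigma>. \<bar>g \<sigma>\<bar>" "\<lambda>_. B"]]
    assms(2) by (simp add: avg_const[OF assms(1)])

lemma abs_avg_spin_le_1:
  "pos_weight N W \<Longrightarrow> set is \<subseteq> {1..N} \<Longrightarrow> \<bar>avg N W (\<lambda>\<sigma>. spin \<sigma> is)\<bar> \<le> 1"
  by (intro abs_avg_bound abs_spin_le_1)

lemma pos_weight_mult: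
  "pos_weight N W \<Longrightarrow> (\<And>\<sigma>. \<sigma> \<in> configs N \<Longrightarrow> 0 < D \<sigma>) \<Longrightarrow> pos_weight N (\<lambda>\<sigma>. D \<sigma> * W \<sigma>)"
  by (simp add: pos_weight_def)

lemma avg_reweight:
  assumes "pos_weight N W"
  shows "avg N (\<lambda>\<sigma>. D \<sigma> * W \<sigma>) g = avg N W (\<lambda>\<sigma>. D \<sigma> * g \<sigma>) / avg N W D"
  using pos_weight_sum[OF assms] by (simp add: avg_def mult_ac)

section \<open>Tilted weights\<close>

text \<open>Up to a constant factor this is the effect of one more interaction, by
  \<open>exp_sign\<close> with \<open>t\<close> a hyperbolic tangent.\<close>

definition tilt :: "real \<Rightarrow> nat list \<Rightarrow> ((nat \<Rightarrow> real) \<Rightarrow> real) \<Rightarrow> (nat \<Rightarrow> real) \<Rightarrow> real" where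
  "tilt t is W \<sigma> = (1 + t * spin \<sigma> is) * W \<sigma>"

lemma one_plus_pos: "\<bar>t\<bar> < 1 \<Longrightarrow> \<bar>x\<bar> \<le> 1 \<Longrightarrow> 0 < 1 + t * x" for t x :: real
proof -
  assume "\<bar>t\<bar> < 1" "\<bar>x\<bar> \<le> 1"
  then have "\<bar>t * x\<bar> \<le> \<bar>t\<bar> * 1" unfolding abs_mult by (intro mult_left_mono) auto
  with \<open>\<bar>t\<bar> < 1\<close> show ?thesis by linarith
qed

lemma pos_weight_tilt:
  assumes "pos_weight N W" "\<bar>t\<bar> < 1" "set is \<subseteq> {1..N}"
  shows "pos_weight N (tilt t is W)"
  unfolding tilt_def using assms by (intro pos_weight_mult one_plus_pos abs_spin_le_1)

lemma avg_tilt: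
  assumes "pos_weight N W"
  shows "avg N (tilt t is W) g = (avg N W g + t * avg N W (\<lambda>\<sigma>. spin \<sigma> is * g \<sigma>))
           / (1 + t * avg N W (\<lambda>\<sigma>. spin \<sigma> is))"
proof -
  have "avg N W (\<lambda>\<sigma>. (1 + t * spin \<sigma> is) * g \<sigma>) = avg N W g + t * avg N W (\<lambda>\<sigma>. spin \<sigma> is * g \<sigma>)"
    by (simp add: distrib_right avg_add avg_cmult[symmetric] mult.assoc)
  moreover have "avg N W (\<lambda>\<sigma>. 1 + t * spin \<sigma> is) = 1 + t * avg N W (\<lambda>\<sigma>. spin \<sigma> is)"
    by (simp add: avg_add avg_cmult avg_const[OF assms])
  ultimately show ?thesis
    unfolding tilt_def avg_reweight[OF assms] by simp
qed

text \<open>Numerator and denominator of the tilted average each move by at most the mean of |A -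
  A'|, and both denominators are at least 1 - |t|. The mean is taken under the untilted
  \<open>W\<close>, so that freezing measured before the insertion controls the effect of the
  insertion.\<close>

lemma avg_reweight_lipschitz:
  assumes W: "pos_weight N W" and t: "\<bar>t\<bar> < 1"
    and A: "\<And>\<sigma>. \<sigma> \<in> configs N \<Longrightarrow> \<bar>A \<sigma>\<bar> \<le> 1" "\<And>\<sigma>. \<sigma> \<in> configs N \<Longrightarrow> \<bar>A' \<sigma>\<bar> \<le> 1"
    and B: "\<And>\<sigma>. \<sigma> \<in> configs N \<Longrightarrow> \<bar>B \<sigma>\<bar> \<le> 1"
  shows "\<bar>avg N (\<lambda>\<sigma>. (1 + t * A \<sigma>) * W \<sigma>) B - avg N (\<lambda>\<sigma>. (1 + t * A' \<sigma>) * W \<sigma>) B\<bar>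
       \<le> 2 / (1 - \<bar>t\<bar>) * avg N W (\<lambda>\<sigma>. \<bar>A \<sigma> - A' \<sigma>\<bar>)"
proof -
  define d where "d = avg N W (\<lambda>\<sigma>. \<bar>A \<sigma> - A' \<sigma>\<bar>)"
  define a b u v where "a = avg N W (\<lambda>\<sigma>. 1 + t * A \<sigma>)" and "b = avg N W (\<lambda>\<sigma>. 1 + t * A' \<sigma>)"
    and "u = avg N W (\<lambda>\<sigma>. (1 + t * A \<sigma>) * B \<sigma>)" and "v = avg N W (\<lambda>\<sigma>. (1 + t * A' \<sigma>) * B \<sigma>)"
  have d0: "0 \<le> d" unfolding d_def
    using avg_mono[OF W, of "\<lambda>_. 0"] by (simp add: avg_const[OF W])
  have lower: "1 - \<bar>t\<bar> \<le> avg N W (\<lambda>\<sigma>. 1 + t * C \<sigma>)" if "\<And>\<sigma>. \<sigma> \<in> configs N \<Longrightarrow> \<bar>C \<sigma>\<bar> \<le> 1" for C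
  proof -
    have "1 - \<bar>t\<bar> \<le> 1 + t * C \<sigma>" if \<sigma>: "\<sigma> \<in> configs N" for \<sigma>
    proof -
      have "\<bar>t * C \<sigma>\<bar> \<le> \<bar>t\<bar> * 1" unfolding abs_mult using that \<open>\<And>\<sigma>. \<sigma> \<in> configs N \<Longrightarrow> \<bar>C \<sigma>\<bar> \<le> 1\<close>[OF \<sigma>]
        by (intro mult_left_mono) auto
      then show ?thesis by linarith
    qed
    from avg_mono[OF W this] show ?thesis by (simp add: avg_const[OF W])
  qed
  have a: "1 - \<bar>t\<bar> \<le> a" and b: "1 - \<bar>t\<bar> \<le> b"
    unfolding a_def b_def using A by (auto intro: lower)
  have vb: "\<bar>v / b\<bar> \<le> 1"
  proof -
    have "pos_weight N (\<lambda>\<sigma>. (1 + t * A' \<sigma>) * W \<sigma>)"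
      using W t A by (intro pos_weight_mult one_plus_pos)
    from abs_avg_bound[OF this B] show ?thesis
      unfolding avg_reweight[OF W] by (simp add: v_def b_def)
  qed
  have diff: "\<bar>avg N W (\<lambda>\<sigma>. (1 + t * A \<sigma>) * C \<sigma>) - avg N W (\<lambda>\<sigma>. (1 + t * A' \<sigma>) * C \<sigma>)\<bar> \<le> d"
    if C: "\<And>\<sigma>. \<sigma> \<in> configs N \<Longrightarrow> \<bar>C \<sigma>\<bar> \<le> 1" for C
  proof -
    have "\<bar>avg N W (\<lambda>\<sigma>. (1 + t * A \<sigma>) * C \<sigma> - (1 + t * A' \<sigma>) * C \<sigma>)\<bar>
        \<le> avg N W (\<lambda>\<sigma>. \<bar>(1 + t * A \<sigma>) * C \<sigma> - (1 + t * A' \<sigma>) * C \<sigma>\<bar>)"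
      by (rule abs_avg_le[OF W])
    also have "\<dots> \<le> d"
      unfolding d_def
    proof (rule avg_mono[OF W])
      fix \<sigma> assume \<sigma>: "\<sigma> \<in> configs N"
      have "(1 + t * A \<sigma>) * C \<sigma> - (1 + t * A' \<sigma>) * C \<sigma> = t * C \<sigma> * (A \<sigma> - A' \<sigma>)"
        by (simp add: algebra_simps)
      moreover have "\<bar>t * C \<sigma>\<bar> \<le> 1 * 1"
        unfolding abs_mult using t C[OF \<sigma>] by (intro mult_mono) auto
      ultimately show "\<bar>(1 + t * A \<sigma>) * C \<sigma> - (1 + t * A' \<sigma>) * C \<sigma>\<bar> \<le> \<bar>A \<sigma> - A' \<sigma>\<bar>"
        using mult_right_mono[of "\<bar>t * C \<sigma>\<bar>" 1 "\<bar>A \<sigma> - A' \<sigma>\<bar>"] by (simp add: abs_mult)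
    qed
    finally show ?thesis by (simp add: avg_diff)
  qed
  have ab: "\<bar>b - a\<bar> \<le> d" using diff[of "\<lambda>_. 1"] by (simp add: a_def b_def abs_minus_commute)
  have uv: "\<bar>u - v\<bar> \<le> d" using diff[of B] B by (simp add: u_def v_def)
  have "0 < a" "0 < b" using a b t by linarith+
  \<comment> \<open>The ratio \<open>v / b\<close> is an average under a tilted weight and hence at
    most one in absolute value, so the error is governed by \<open>u - v\<close> and
    \<open>b - a\<close>.\<close>
  then have "u / a - v / b = (u - v + v / b * (b - a)) / a" by (simp add: field_simps)
  also have "\<bar>\<dots>\<bar> \<le> (2 * d) / (1 - \<bar>t\<bar>)"
  proof -
    have "\<bar>v / b * (b - a)\<bar> \<le> 1 * d"
      unfolding abs_mult[of "v / b"] using vb ab by (intro mult_mono) auto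
    then have "\<bar>u - v + v / b * (b - a)\<bar> \<le> d + d"
      using uv by (intro order_trans[OF abs_triangle_ineq] add_mono) simp_all
    then have "\<bar>u - v + v / b * (b - a)\<bar> \<le> 2 * d" by simp
    then have "\<bar>u - v + v / b * (b - a)\<bar> / a \<le> (2 * d) / (1 - \<bar>t\<bar>)"
      using a t d0 by (intro frac_le) auto
    with \<open>0 < a\<close> show ?thesis by (simp add: abs_divide)
  qed
  finally show ?thesis
    unfolding avg_reweight[OF W] by (simp add: d_def a_def b_def u_def v_def)
qed

section \<open>Overlap moments under tilts\<close>

text \<open>The Gibbs average over \<open>k\<close> replicas of the \<open>n\<close>-th power of
  their common overlap, with the replicas already integrated out.\<close>

definition overlap_moment :: "nat \<Rightarrow> nat \<Rightarrow> nat \<Rightarrow> ((nat \<Rightarrow> real) \<Rightarrow> real) \<Rightarrow> real" where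
  "overlap_moment N n k W = site_mean N n (\<lambda>js. avg N W (\<lambda>\<sigma>. spin \<sigma> js) ^ k)"

lemma overlap_moment_cong:
  "(\<And>\<sigma>. \<sigma> \<in> configs N \<Longrightarrow> W \<sigma> = W' \<sigma>) \<Longrightarrow> overlap_moment N n k W = overlap_moment N n k W'"
  unfolding overlap_moment_def by (intro site_mean_cong arg_cong2[where f = power] avg_cong) auto

lemma abs_overlap_moment_le_1:
  assumes "N \<ge> 1" "pos_weight N W"
  shows "\<bar>overlap_moment N n k W\<bar> \<le> 1"
  unfolding overlap_moment_def
  using assms abs_avg_spin_le_1[OF assms(2)]
  by (intro abs_site_mean_bound) (auto simp: power_abs Sites_def intro!: power_le_one)

text \<open>Powers are \<open>k\<close>-Lipschitz on [-1, 1], so the bound for single averages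
  carries over to the moment.\<close>

lemma overlap_moment_lipschitz:
  assumes N: "N \<ge> 1" and W: "pos_weight N W" and t: "\<bar>t\<bar> < 1"
    and A: "\<And>\<sigma>. \<sigma> \<in> configs N \<Longrightarrow> \<bar>A \<sigma>\<bar> \<le> 1" "\<And>\<sigma>. \<sigma> \<in> configs N \<Longrightarrow> \<bar>A' \<sigma>\<bar> \<le> 1"
  shows "\<bar>overlap_moment N n k (\<lambda>\<sigma>. (1 + t * A \<sigma>) * W \<sigma>) - overlap_moment N n k (\<lambda>\<sigma>. (1 + t * A' \<sigma>) * W \<sigma>)\<bar>
       \<le> real k * (2 / (1 - \<bar>t\<bar>)) * avg N W (\<lambda>\<sigma>. \<bar>A \<sigma> - A' \<sigma>\<bar>)"
  unfolding overlap_moment_def site_mean_diff[symmetric]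
proof (rule abs_site_mean_bound[OF N])
  fix js assume js: "js \<in> Sites N n"
  let ?x = "avg N (\<lambda>\<sigma>. (1 + t * A \<sigma>) * W \<sigma>) (\<lambda>\<sigma>. spin \<sigma> js)"
  let ?y = "avg N (\<lambda>\<sigma>. (1 + t * A' \<sigma>) * W \<sigma>) (\<lambda>\<sigma>. spin \<sigma> js)"
  have "\<bar>?x\<bar> \<le> 1" "\<bar>?y\<bar> \<le> 1"
    using W t A SitesD[OF js] by (auto intro!: abs_avg_spin_le_1 pos_weight_mult one_plus_pos)
  then have "\<bar>?x ^ k - ?y ^ k\<bar> \<le> real k * \<bar>?x - ?y\<bar>"
    using norm_power_diff[of ?x ?y k] by simp
  also have "\<dots> \<le> real k * (2 / (1 - \<bar>t\<bar>) * avg N W (\<lambda>\<sigma>. \<bar>A \<sigma> - A' \<sigma>\<bar>))"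
    using abs_spin_le_1 SitesD[OF js] by (intro mult_left_mono avg_reweight_lipschitz W t A) auto
  finally show "\<bar>?x ^ k - ?y ^ k\<bar> \<le> real k * (2 / (1 - \<bar>t\<bar>)) * avg N W (\<lambda>\<sigma>. \<bar>A \<sigma> - A' \<sigma>\<bar>)"
    by (simp add: mult.assoc)
qed

text \<open>The mean over the symmetric sign of the coupling when a term with sites
  \<open>is\<close> is added.\<close>

definition tilted_moment :: "nat \<Rightarrow> nat \<Rightarrow> nat \<Rightarrow> real \<Rightarrow> nat list \<Rightarrow> ((nat \<Rightarrow> real) \<Rightarrow> real) \<Rightarrow> real" where
  "tilted_moment N n k t is W =
     (overlap_moment N n k (tilt t is W) + overlap_moment N n k (tilt (- t) is W)) / 2"

lemma abs_prod_list_le_1: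
  fixes f :: "'a \<Rightarrow> real"
  shows "(\<And>x. x \<in> set xs \<Longrightarrow> \<bar>f x\<bar> \<le> 1) \<Longrightarrow> \<bar>prod_list (map f xs)\<bar> \<le> 1"
proof (induction xs)
  case (Cons x xs)
  then show ?case using mult_mono[of "\<bar>f x\<bar>" 1 "\<bar>prod_list (map f xs)\<bar>" 1] by (simp add: abs_mult)
qed simp

text \<open>Telescoping: one factor is exchanged at a time while the others are at most one in
  absolute value.\<close>

lemma abs_prod_list_diff_le:
  fixes f g :: "'a \<Rightarrow> real"
  assumes "\<And>x. x \<in> set xs \<Longrightarrow> \<bar>f x\<bar> \<le> 1" "\<And>x. x \<in> set xs \<Longrightarrow> \<bar>g x\<bar> \<le> 1"
  shows "\<bar>prod_list (map f xs) - prod_list (map g xs)\<bar> \<le> (\<Sum>x\<leftarrow>xs. \<bar>f x - g x\<bar>)"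
  using assms
proof (induction xs)
  case (Cons x xs)
  have IH: "\<bar>prod_list (map f xs) - prod_list (map g xs)\<bar> \<le> (\<Sum>x\<leftarrow>xs. \<bar>f x - g x\<bar>)"
    using Cons by simp
  have f: "\<bar>f x\<bar> \<le> 1" and g: "\<bar>prod_list (map g xs)\<bar> \<le> 1"
    using Cons.prems by (auto intro: abs_prod_list_le_1)
  have "prod_list (map f (x # xs)) - prod_list (map g (x # xs))
      = f x * (prod_list (map f xs) - prod_list (map g xs)) + (f x - g x) * prod_list (map g xs)"
    by (simp add: algebra_simps)
  also have "\<bar>\<dots>\<bar> \<le> 1 * (\<Sum>x\<leftarrow>xs. \<bar>f x - g x\<bar>) + \<bar>f x - g x\<bar> * 1"
    using f g IH by (intro order_trans[OF abs_triangle_ineq] add_mono) (simp_all only: abs_mult mult_mono abs_ge_zero zero_le_one order_refl)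
  finally show "\<bar>prod_list (map f (x # xs)) - prod_list (map g (x # xs))\<bar> \<le> (\<Sum>x\<leftarrow>x # xs. \<bar>f x - g x\<bar>)"
    by simp
qed simp

text \<open>The distance of a spin from a sign \<open>s\<close> is 1 - s times the spin, whose mean
  is one minus the absolute magnetization. The weaker bound with the square is the quantity that
  \<open>sum_unfrozen_le\<close> controls.\<close>

lemma avg_abs_diff_sign:
  assumes W: "pos_weight N W" and x: "x \<in> {1..N}"
  defines "s \<equiv> if avg N W (\<lambda>\<sigma>. \<sigma> x) \<ge> 0 then 1 else - 1"
  shows "avg N W (\<lambda>\<sigma>. \<bar>\<sigma> x - s\<bar>) \<le> 1 - (avg N W (\<lambda>\<sigma>. \<sigma> x))\<^sup>2"
proof -
  let ?m = "avg N W (\<lambda>\<sigma>. \<sigma> x)"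
  have "avg N W (\<lambda>\<sigma>. \<bar>\<sigma> x - s\<bar>) = avg N W (\<lambda>\<sigma>. 1 - s * \<sigma> x)"
    using configs_cases[OF _ x] by (intro avg_cong) (force simp: s_def)+
  also have "\<dots> = 1 - \<bar>?m\<bar>"
    by (simp add: avg_diff avg_cmult avg_const[OF W]) (simp add: s_def)
  also have "\<dots> \<le> 1 - ?m\<^sup>2"
  proof -
    have "\<bar>?m\<bar> \<le> 1" using abs_avg_spin_le_1[OF W, of "[x]"] x by simp
    then have "\<bar>?m\<bar> * \<bar>?m\<bar> \<le> \<bar>?m\<bar> * 1" by (intro mult_left_mono) auto
    then show ?thesis by (simp add: power2_eq_square)
  qed
  finally show ?thesis .
qed

text \<open>A frozen spin is a deterministic sign, and the symmetric coupling absorbs it.\<close>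

lemma tilted_moment_frozen:
  assumes N: "N \<ge> 1" and W: "pos_weight N W" and t: "\<bar>t\<bar> < 1"
    and "is": "set is \<subseteq> {1..N}" and ks: "set ks \<subseteq> {1..N}"
  shows "\<bar>tilted_moment N n k t (is @ ks) W - tilted_moment N n k t is W\<bar>
       \<le> real k * (2 / (1 - \<bar>t\<bar>)) * (\<Sum>x\<leftarrow>ks. 1 - (avg N W (\<lambda>\<sigma>. \<sigma> x))\<^sup>2)"
proof -
  define s where "s = (\<lambda>x. if avg N W (\<lambda>\<sigma>. \<sigma> x) \<ge> 0 then 1 else - 1 :: real)"
  define S where "S = prod_list (map s ks)"
  define e where "e = (\<Sum>x\<leftarrow>ks. 1 - (avg N W (\<lambda>\<sigma>. \<sigma> x))\<^sup>2)"
  have S: "S = 1 \<or> S = -1"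
    unfolding S_def by (induction ks) (auto simp: s_def)
  have avg_sum_list: "avg N W (\<lambda>\<sigma>. \<Sum>x\<leftarrow>xs. f x \<sigma>) = (\<Sum>x\<leftarrow>xs. avg N W (f x))" for xs :: "nat list" and f
    by (induction xs) (simp_all add: avg_add avg_const[OF W])
  have frozen: "avg N W (\<lambda>\<sigma>. \<bar>spin \<sigma> (is @ ks) - S * spin \<sigma> is\<bar>) \<le> e"
  proof -
    have "avg N W (\<lambda>\<sigma>. \<bar>spin \<sigma> (is @ ks) - S * spin \<sigma> is\<bar>)
        \<le> avg N W (\<lambda>\<sigma>. \<Sum>x\<leftarrow>ks. \<bar>\<sigma> x - s x\<bar>)"
    proof (rule avg_mono[OF W])
      fix \<sigma> assume \<sigma>: "\<sigma> \<in> configs N"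
      have "\<bar>spin \<sigma> (is @ ks) - S * spin \<sigma> is\<bar> = \<bar>spin \<sigma> is\<bar> * \<bar>spin \<sigma> ks - S\<bar>"
        by (simp add: abs_mult[symmetric] algebra_simps)
      also have "\<dots> = \<bar>spin \<sigma> ks - S\<bar>"
        using spin_cases[OF \<sigma> "is"] by auto
      also have "\<dots> \<le> (\<Sum>x\<leftarrow>ks. \<bar>\<sigma> x - s x\<bar>)"
        unfolding spin_def S_def using configs_cases[OF \<sigma>] ks
        by (intro abs_prod_list_diff_le) (force simp: s_def)+
      finally show "\<bar>spin \<sigma> (is @ ks) - S * spin \<sigma> is\<bar> \<le> (\<Sum>x\<leftarrow>ks. \<bar>\<sigma> x - s x\<bar>)" .
    qed
    also have "\<dots> = (\<Sum>x\<leftarrow>ks. avg N W (\<lambda>\<sigma>. \<bar>\<sigma> x - s x\<bar>))"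
      by (rule avg_sum_list)
    also have "\<dots> \<le> e"
      unfolding e_def s_def using ks by (intro sum_list_mono avg_abs_diff_sign[OF W]) auto
    finally show ?thesis .
  qed
  have bound: "\<bar>overlap_moment N n k (tilt u (is @ ks) W) - overlap_moment N n k (tilt (u * S) is W)\<bar>
      \<le> real k * (2 / (1 - \<bar>t\<bar>)) * e" if u: "\<bar>u\<bar> = \<bar>t\<bar>" for u
  proof -
    have eq: "tilt (u * S) is W = (\<lambda>\<sigma>. (1 + u * (S * spin \<sigma> is)) * W \<sigma>)"
      by (simp add: tilt_def fun_eq_iff)
    have "\<bar>overlap_moment N n k (tilt u (is @ ks) W) - overlap_moment N n k (tilt (u * S) is W)\<bar>
       \<le> real k * (2 / (1 - \<bar>u\<bar>)) * avg N W (\<lambda>\<sigma>. \<bar>spin \<sigma> (is @ ks) - S * spin \<sigma> is\<bar>)"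
      unfolding eq tilt_def using "is" ks u t S abs_spin_le_1[of _ N "is @ ks"] abs_spin_le_1[of _ N "is"]
      by (intro overlap_moment_lipschitz N W) (auto simp del: spin_append)
    also have "\<dots> \<le> real k * (2 / (1 - \<bar>t\<bar>)) * e"
      unfolding u using frozen t by (intro mult_left_mono) auto
    finally show ?thesis .
  qed
  \<comment> \<open>As \<open>S\<close> is a sign, \<open>t * S\<close> and \<open>(- t) * S\<close>
    are \<open>t\<close> and \<open>- t\<close> in some order, so the two subtracted moments add up
    to twice the \<open>tilted_moment\<close> without \<open>ks\<close>.\<close>
  have "2 * (tilted_moment N n k t (is @ ks) W - tilted_moment N n k t is W)
      = (overlap_moment N n k (tilt t (is @ ks) W) - overlap_moment N n k (tilt (t * S) is W))
      + (overlap_moment N n k (tilt (- t) (is @ ks) W) - overlap_moment N n k (tilt ((- t) * S) is W))"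
    using S by (auto simp: tilted_moment_def field_simps)
  also have "\<bar>\<dots>\<bar> \<le> 2 * (real k * (2 / (1 - \<bar>t\<bar>)) * e)"
    by (rule order_trans[OF abs_triangle_ineq], rule order_trans[OF add_mono[OF bound[of t] bound[of "- t"]]]) (simp_all add: mult.commute)
  finally show ?thesis unfolding e_def by (simp add: abs_mult)
qed

section \<open>Adding interactions\<close>

text \<open>Minus the Hamiltonian of a sample; the coefficient, common to all terms of one group, is
  left to \<open>perturb\<close>.\<close>

definition energy :: "(int \<times> nat list) multiset \<Rightarrow> (nat \<Rightarrow> real) \<Rightarrow> real" where
  "energy \<xi> \<sigma> = (\<Sum>x\<in>#\<xi>. real_of_int (fst x) * spin \<sigma> (snd x))"

definition perturb ::
  "real \<Rightarrow> (int \<times> nat list) multiset \<Rightarrow> ((nat \<Rightarrow> real) \<Rightarrow> real) \<Rightarrow> (nat \<Rightarrow> real) \<Rightarrow> real" where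
  "perturb c \<xi> W \<sigma> = exp (c * energy \<xi> \<sigma>) * W \<sigma>"

definition term_law :: "nat \<Rightarrow> nat \<Rightarrow> (int \<times> nat list) pmf" where
  "term_law N p = pmf_of_set ({-1, 1} \<times> Sites N p)"

lemma perturb_commute: "perturb c \<xi> (perturb d \<eta> W) = perturb d \<eta> (perturb c \<xi> W)"
  by (simp add: perturb_def fun_eq_iff)

lemma pos_weight_perturb: "pos_weight N W \<Longrightarrow> pos_weight N (perturb c \<xi> W)"
  unfolding perturb_def by (intro pos_weight_mult) auto

text \<open>Every function of a sign is affine; its values at 1 and -1 give the coefficients cosh
  and sinh.\<close>

lemma exp_sign: "s = 1 \<or> s = -1 \<Longrightarrow> exp (c * s) = cosh c * (1 + tanh c * s)" for c s :: real
proof -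
  have "cosh c \<noteq> 0" using cosh_real_pos[of c] by linarith
  then have "cosh c * (1 + tanh c * s) = cosh c + sinh c * s"
    by (simp add: tanh_def field_simps)
  then show "s = 1 \<or> s = -1 \<Longrightarrow> exp (c * s) = cosh c * (1 + tanh c * s)"
    by (auto simp: cosh_plus_sinh cosh_minus_sinh)
qed

lemma perturb_add_mset:
  assumes "\<sigma> \<in> configs N" "set is \<subseteq> {1..N}" "J = 1 \<or> J = -1"
  shows "perturb c (add_mset (J, is) \<xi>) W \<sigma> = cosh c * tilt (tanh c * real_of_int J) is (perturb c \<xi> W) \<sigma>"
proof -
  have s: "real_of_int J * spin \<sigma> is = 1 \<or> real_of_int J * spin \<sigma> is = -1"
    using spin_cases[OF assms(1,2)] assms(3) by auto
  have "perturb c (add_mset (J, is) \<xi>) W \<sigma> = exp (c * (real_of_int J * spin \<sigma> is)) * perturb c \<xi> W \<sigma>"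
    by (simp add: perturb_def energy_def distrib_left exp_add)
  also have "\<dots> = cosh c * tilt (tanh c * real_of_int J) is (perturb c \<xi> W) \<sigma>"
    unfolding exp_sign[OF s] by (simp add: tilt_def)
  finally show ?thesis .
qed

lemma avg_scale: "a \<noteq> 0 \<Longrightarrow> avg N (\<lambda>\<sigma>. a * W \<sigma>) g = avg N W g"
  by (simp add: avg_def mult.assoc flip: sum_distrib_left)

lemma avg_perturb_add_mset:
  assumes "set is \<subseteq> {1..N}" "J = 1 \<or> J = -1"
  shows "avg N (perturb c (add_mset (J, is) \<xi>) W) g = avg N (tilt (tanh c * real_of_int J) is (perturb c \<xi> W)) g"
proof -
  have "avg N (perturb c (add_mset (J, is) \<xi>) W) g
      = avg N (\<lambda>\<sigma>. cosh c * tilt (tanh c * real_of_int J) is (perturb c \<xi> W) \<sigma>) g"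
    using assms by (intro avg_cong perturb_add_mset) auto
  also have "\<dots> = avg N (tilt (tanh c * real_of_int J) is (perturb c \<xi> W)) g"
    using cosh_real_pos[of c] by (intro avg_scale) simp
  finally show ?thesis .
qed

lemma overlap_moment_perturb_add_mset:
  assumes "set is \<subseteq> {1..N}" "J = 1 \<or> J = -1"
  shows "overlap_moment N n k (perturb c (add_mset (J, is) \<xi>) W)
       = overlap_moment N n k (tilt (tanh c * real_of_int J) is (perturb c \<xi> W))"
  unfolding overlap_moment_def avg_perturb_add_mset[OF assms] ..

lemma expectation_term_law:
  fixes h :: "int \<times> nat list \<Rightarrow> real"
  assumes "N \<ge> 1"
  shows "(\<integral>x. h x \<partial>term_law N p) = site_mean N p (\<lambda>is. (h (1, is) + h (-1, is)) / 2)"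
proof -
  have ne: "{-1, 1 :: int} \<times> Sites N p \<noteq> {}"
    using card_Sites[of N p] assms by (auto simp del: card_Sites)
  have "(\<integral>x. h x \<partial>term_law N p) = sum h ({-1, 1} \<times> Sites N p) / real (2 * N ^ p)"
    unfolding term_law_def using ne by (subst integral_pmf_of_set) (auto simp: card_cartesian_product)
  also have "sum h ({-1, 1} \<times> Sites N p) = (\<Sum>is\<in>Sites N p. h (1, is) + h (-1, is))"
    by (subst sum.cartesian_product'[of h]) (simp add: sum.distrib)
  finally show ?thesis by (simp add: site_mean_def sum_divide_distrib)
qed

lemma abs_tanh_less_1: "\<bar>tanh c\<bar> < 1" for c :: real
  using tanh_real_lt_1[of c] tanh_real_gt_neg1[of c] by linarith

section \<open>Exchanging and bounding expectations; insertion of a term\<close>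

text \<open>A shift by \<open>B\<close> reduces the bounded case to nonnegative functions, where
  \<open>nn_integral_pmf_swap\<close> applies.\<close>

lemma pmf_expectation_swap:
  fixes f :: "'a \<Rightarrow> 'b \<Rightarrow> real"
  assumes "\<And>x y. \<bar>f x y\<bar> \<le> B"
  shows "(\<integral>x. \<integral>y. f x y \<partial>measure_pmf q \<partial>measure_pmf p) = (\<integral>y. \<integral>x. f x y \<partial>measure_pmf p \<partial>measure_pmf q)"
proof -
  have B0: "0 \<le> B" using assms[of undefined undefined] by linarith
  have nn: "ennreal (\<integral>x. \<integral>y. h x y \<partial>measure_pmf q \<partial>measure_pmf p)
      = (\<integral>\<^sup>+x. \<integral>\<^sup>+y. ennreal (h x y) \<partial>measure_pmf q \<partial>measure_pmf p)"
    if h: "\<And>x y. 0 \<le> h x y" "\<And>x y. h x y \<le> 2 * B" for h :: "'c \<Rightarrow> 'd \<Rightarrow> real" and p q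
  proof -
    have int_in: "integrable (measure_pmf q) (h x)" for x
      using h by (intro measure_pmf.integrable_const_bound[where B = "2 * B"]) auto
    have "(\<integral>y. h x y \<partial>measure_pmf q) \<le> 2 * B" for x
      using h int_in by (intro measure_pmf.integral_le_const) auto
    moreover have in0: "0 \<le> (\<integral>y. h x y \<partial>measure_pmf q)" for x
      using h by (intro integral_nonneg_AE) auto
    ultimately have "integrable (measure_pmf p) (\<lambda>x. \<integral>y. h x y \<partial>measure_pmf q)"
      by (intro measure_pmf.integrable_const_bound[where B = "2 * B"]) auto
    then have "(\<integral>\<^sup>+x. ennreal (\<integral>y. h x y \<partial>measure_pmf q) \<partial>measure_pmf p)
        = ennreal (\<integral>x. \<integral>y. h x y \<partial>measure_pmf q \<partial>measure_pmf p)"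
      using in0 by (intro nn_integral_eq_integral) auto
    moreover have "(\<integral>\<^sup>+y. ennreal (h x y) \<partial>measure_pmf q) = ennreal (\<integral>y. h x y \<partial>measure_pmf q)" for x
      using h by (intro nn_integral_eq_integral int_in) auto
    ultimately show ?thesis by simp
  qed
  have nonneg: "0 \<le> (\<integral>x. \<integral>y. h x y \<partial>measure_pmf q \<partial>measure_pmf p)"
    if "\<And>x y. 0 \<le> h x y" for h :: "'c \<Rightarrow> 'd \<Rightarrow> real" and p q
    using that by (intro integral_nonneg_AE AE_I2) auto
  have fB: "0 \<le> f x y + B" "f x y + B \<le> 2 * B" for x y
    using assms[of x y] by (auto simp: abs_le_iff)
  have "ennreal (\<integral>x. \<integral>y. f x y + B \<partial>measure_pmf q \<partial>measure_pmf p)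
      = ennreal (\<integral>y. \<integral>x. f x y + B \<partial>measure_pmf p \<partial>measure_pmf q)"
    using nn[of "\<lambda>x y. f x y + B" p q] nn[of "\<lambda>y x. f x y + B" q p] fB
    by (simp add: nn_integral_pmf_swap[where A = p and B = q])
  then have eq: "(\<integral>x. \<integral>y. f x y + B \<partial>measure_pmf q \<partial>measure_pmf p)
      = (\<integral>y. \<integral>x. f x y + B \<partial>measure_pmf p \<partial>measure_pmf q)"
    using nonneg[of "\<lambda>x y. f x y + B"] nonneg[of "\<lambda>y x. f x y + B"] fB by simp
  have shift: "(\<integral>x. \<integral>y. h x y + B \<partial>measure_pmf q \<partial>measure_pmf p)
      = (\<integral>x. \<integral>y. h x y \<partial>measure_pmf q \<partial>measure_pmf p) + B"
    if h: "\<And>x y. \<bar>h x y\<bar> \<le> B" for h :: "'c \<Rightarrow> 'd \<Rightarrow> real" and p q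
  proof -
    have int_in: "integrable (measure_pmf q) (h x)" for x
      using h by (intro measure_pmf.integrable_const_bound[where B = B]) auto
    have "\<bar>\<integral>y. h x y \<partial>measure_pmf q\<bar> \<le> B" for x
      using h int_in by (intro order_trans[OF integral_abs_bound] measure_pmf.integral_le_const) auto
    then have "integrable (measure_pmf p) (\<lambda>x. \<integral>y. h x y \<partial>measure_pmf q)"
      by (intro measure_pmf.integrable_const_bound[where B = B]) auto
    with int_in show ?thesis by (simp add: measure_pmf.prob_space[simplified])
  qed
  show ?thesis
    using eq assms by (simp add: shift)
qed

lemma abs_expectation_pmf_le:
  fixes f :: "'a \<Rightarrow> real"
  assumes "\<And>x. \<bar>f x\<bar> \<le> B"
  shows "\<bar>\<integral>x. f x \<partial>measure_pmf p\<bar> \<le> B"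
  using assms
  by (intro order_trans[OF integral_abs_bound] measure_pmf.integral_le_const
      measure_pmf.integrable_const_bound[where B = B]) auto

lemma integrable_pmf_bounded:
  fixes f :: "'a \<Rightarrow> real"
  assumes "\<And>x. \<bar>f x\<bar> \<le> B"
  shows "integrable (measure_pmf p) f"
  using assms by (intro measure_pmf.integrable_const_bound[where B = B]) auto

lemma prod_list_bound:
  fixes w :: "'a \<Rightarrow> real"
  assumes "\<And>x. \<bar>w x\<bar> \<le> B"
  shows "\<bar>prod_list (map w xs)\<bar> \<le> B ^ length xs"
proof (induction xs)
  case (Cons x xs)
  have "0 \<le> B" using assms[of undefined] by linarith
  then show ?case using mult_mono[OF assms[of x] Cons.IH] by (simp add: abs_mult)
qed simp

text \<open>An instance of \<open>poisson_mset_insert_stable\<close>: the test weight is the product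
  of \<open>w\<close> over the last \<open>q\<close> sites of the inserted term, and averaging over
  its coupling produces \<open>tilted_moment\<close>. Later \<open>w\<close> depends on the one-spin
  terms, which are held fixed when this lemma is applied.\<close>

lemma insert_term_stable:
  assumes N: "N \<ge> 1" and \<mu>: "\<mu> > 0" and W: "pos_weight N W" and w: "\<And>x. \<bar>w x\<bar> \<le> B"
  shows "\<bar>\<integral>\<xi>. site_mean N m (\<lambda>is. site_mean N q (\<lambda>ks. prod_list (map w ks) *
            (tilted_moment N n k (tanh c) (is @ ks) (perturb c \<xi> W) - overlap_moment N n k (perturb c \<xi> W))))
          \<partial>poisson_mset \<mu> (term_law N (m + q))\<bar> \<le> B ^ q / sqrt \<mu>"
proof -
  let ?P = "poisson_mset \<mu> (term_law N (m + q))"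
  define g where "g = (\<lambda>\<xi>. overlap_moment N n k (perturb c \<xi> W))"
  \<comment> \<open>The value zero off \<open>Sites N (m + q)\<close> makes the bound
    \<open>B ^ q\<close> hold for lists of every length.\<close>
  define \<rho> where "\<rho> = (\<lambda>x :: int \<times> nat list. if snd x \<in> Sites N (m + q) then prod_list (map w (drop m (snd x))) else 0)"
  have g1: "\<bar>g \<xi>\<bar> \<le> 1" for \<xi>
    unfolding g_def by (intro abs_overlap_moment_le_1 N pos_weight_perturb W)
  have B0: "0 \<le> B" using w[of undefined] by linarith
  have \<rho>B: "\<bar>\<rho> x\<bar> \<le> B ^ q" for x
  proof (cases "snd x \<in> Sites N (m + q)")
    case True
    then have "length (drop m (snd x)) = q" by (simp add: Sites_def)
    then show ?thesis using prod_list_bound[of w B "drop m (snd x)", OF w] True by (simp add: \<rho>_def)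
  qed (use B0 in \<open>simp add: \<rho>_def\<close>)
  have g2: "\<bar>g \<xi> - g \<eta>\<bar> \<le> 2" for \<xi> \<eta> using g1[of \<xi>] g1[of \<eta>] by linarith
  have prod2: "\<bar>\<rho> x * (g (add_mset x \<xi>) - g \<xi>)\<bar> \<le> B ^ q * 2" for x \<xi>
    unfolding abs_mult using \<rho>B g2 B0 by (intro mult_mono) auto
  have inner: "(\<integral>x. \<rho> x * (g (add_mset x \<xi>) - g \<xi>) \<partial>term_law N (m + q))
     = site_mean N m (\<lambda>is. site_mean N q (\<lambda>ks. prod_list (map w ks) *
            (tilted_moment N n k (tanh c) (is @ ks) (perturb c \<xi> W) - overlap_moment N n k (perturb c \<xi> W))))" for \<xi>
  proof -
    have "(\<integral>x. \<rho> x * (g (add_mset x \<xi>) - g \<xi>) \<partial>term_law N (m + q))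
        = site_mean N (m + q) (\<lambda>is. prod_list (map w (drop m is)) *
            (tilted_moment N n k (tanh c) is (perturb c \<xi> W) - overlap_moment N n k (perturb c \<xi> W)))"
      unfolding expectation_term_law[OF N]
    proof (rule site_mean_cong)
      fix "is" assume "is": "is \<in> Sites N (m + q)"
      then have sub: "set is \<subseteq> {1..N}" by (rule SitesD)
      show "(\<rho> (1, is) * (g (add_mset (1, is) \<xi>) - g \<xi>) + \<rho> (- 1, is) * (g (add_mset (- 1, is) \<xi>) - g \<xi>)) / 2
         = prod_list (map w (drop m is)) *
            (tilted_moment N n k (tanh c) is (perturb c \<xi> W) - overlap_moment N n k (perturb c \<xi> W))"
        using "is" unfolding g_def
        by (simp add: \<rho>_def overlap_moment_perturb_add_mset[OF sub] tilted_moment_def field_simps)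
    qed
    also have "\<dots> = site_mean N m (\<lambda>is. site_mean N q (\<lambda>ks. prod_list (map w ks) *
            (tilted_moment N n k (tanh c) (is @ ks) (perturb c \<xi> W) - overlap_moment N n k (perturb c \<xi> W))))"
      unfolding site_mean_append by (intro site_mean_cong) (simp add: Sites_def)
    finally show ?thesis .
  qed
  have "(\<integral>x. \<integral>\<xi>. \<rho> x * (g (add_mset x \<xi>) - g \<xi>) \<partial>?P \<partial>term_law N (m + q))
      = (\<integral>\<xi>. \<integral>x. \<rho> x * (g (add_mset x \<xi>) - g \<xi>) \<partial>term_law N (m + q) \<partial>?P)"
    by (rule pmf_expectation_swap[OF prod2])
  then show ?thesis
    using poisson_mset_insert_stable[OF \<mu>, of \<rho> "B ^ q" g "term_law N (m + q)", OF \<rho>B g1]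
    unfolding inner by simp
qed

text \<open>The mean change of the overlap moment caused by an m-spin term with random sites and
  random sign. The analytic goal is that its disorder average tends to zero at infinitely many
  strengths \<open>t\<close>.\<close>

definition displacement :: "nat \<Rightarrow> nat \<Rightarrow> nat \<Rightarrow> nat \<Rightarrow> real \<Rightarrow> ((nat \<Rightarrow> real) \<Rightarrow> real) \<Rightarrow> real" where
  "displacement N m n k t W = site_mean N m (\<lambda>is. tilted_moment N n k t is W) - overlap_moment N n k W"

lemma abs_tilted_moment_le_1:
  assumes "N \<ge> 1" "pos_weight N W" "\<bar>t\<bar> < 1" "set is \<subseteq> {1..N}"
  shows "\<bar>tilted_moment N n k t is W\<bar> \<le> 1"
proof -
  have "\<bar>overlap_moment N n k (tilt t is W)\<bar> \<le> 1" "\<bar>overlap_moment N n k (tilt (- t) is W)\<bar> \<le> 1"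
    using assms by (auto intro!: abs_overlap_moment_le_1 pos_weight_tilt)
  then show ?thesis unfolding tilted_moment_def by (simp add: abs_le_iff)
qed

lemma abs_displacement_le_2:
  assumes "N \<ge> 1" "pos_weight N W" "\<bar>t\<bar> < 1"
  shows "\<bar>displacement N m n k t W\<bar> \<le> 2"
proof -
  have "\<bar>site_mean N m (\<lambda>is. tilted_moment N n k t is W)\<bar> \<le> 1"
    using assms SitesD by (intro abs_site_mean_bound abs_tilted_moment_le_1) auto
  then show ?thesis
    using abs_overlap_moment_le_1[OF assms(1,2), of n k] unfolding displacement_def by linarith
qed

text \<open>By \<open>tilted_moment_frozen\<close>, dropping the biased sites \<open>ks\<close>
  costs the sum of their unfrozenness. The rest no longer depends on \<open>ks\<close>, so its
  product weight integrates to \<open>wb ^ q\<close>. In the error, one site carries the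
  unfrozenness and the other \<open>q - 1\<close> contribute \<open>wb\<close> each.\<close>

lemma frozen_displacement:
  assumes N: "N \<ge> 1" and W: "pos_weight N W" and t: "\<bar>t\<bar> < 1" and w: "\<And>x. 0 \<le> w x"
  defines "wb \<equiv> (\<Sum>x=1..N. w x) / real N"
  shows "\<bar>site_mean N m (\<lambda>is. site_mean N q (\<lambda>ks. prod_list (map w ks) *
            (tilted_moment N n k t (is @ ks) W - overlap_moment N n k W)))
         - wb ^ q * displacement N m n k t W\<bar>
      \<le> real k * (2 / (1 - \<bar>t\<bar>)) *
          (real q * (wb ^ (q - 1) * ((\<Sum>x=1..N. w x * (1 - (avg N W (\<lambda>\<sigma>. \<sigma> x))\<^sup>2)) / real N)))"
proof -
  define K where "K = real k * (2 / (1 - \<bar>t\<bar>))"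
  define h where "h = (\<lambda>x. 1 - (avg N W (\<lambda>\<sigma>. \<sigma> x))\<^sup>2)"
  have split: "wb ^ q * displacement N m n k t W
     = site_mean N m (\<lambda>is. site_mean N q (\<lambda>ks. prod_list (map w ks) *
         (tilted_moment N n k t is W - overlap_moment N n k W)))"
    unfolding displacement_def site_mean_cmult_right site_mean_prod_list wb_def
    using site_mean_const[OF N]
    by (simp add: site_mean_cmult site_mean_diff)
  have "\<bar>site_mean N m (\<lambda>is. site_mean N q (\<lambda>ks. prod_list (map w ks) *
            (tilted_moment N n k t (is @ ks) W - overlap_moment N n k W)))
         - wb ^ q * displacement N m n k t W\<bar>
     = \<bar>site_mean N m (\<lambda>is. site_mean N q (\<lambda>ks. prod_list (map w ks) *
            (tilted_moment N n k t (is @ ks) W - tilted_moment N n k t is W)))\<bar>"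
    unfolding split site_mean_diff[symmetric] by (simp add: algebra_simps)
  also have "\<dots> \<le> K * (real q * (wb ^ (q - 1) * ((\<Sum>x=1..N. w x * h x) / real N)))"
  proof (rule abs_site_mean_bound[OF N])
    fix "is" assume "is": "is \<in> Sites N m"
    have "\<bar>site_mean N q (\<lambda>ks. prod_list (map w ks) * (tilted_moment N n k t (is @ ks) W - tilted_moment N n k t is W))\<bar>
       \<le> site_mean N q (\<lambda>ks. \<bar>prod_list (map w ks) * (tilted_moment N n k t (is @ ks) W - tilted_moment N n k t is W)\<bar>)"
      by (rule abs_site_mean_le)
    also have "\<dots> \<le> site_mean N q (\<lambda>ks. K * (prod_list (map w ks) * sum_list (map h ks)))"
    proof (rule site_mean_mono)
      fix ks assume ks: "ks \<in> Sites N q"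
      have p0: "0 \<le> prod_list (map w ks)" using w by (induction ks) auto
      have "\<bar>tilted_moment N n k t (is @ ks) W - tilted_moment N n k t is W\<bar> \<le> K * sum_list (map h ks)"
        unfolding K_def h_def using SitesD[OF "is"] SitesD[OF ks] by (intro tilted_moment_frozen N W t)
      from mult_left_mono[OF this p0]
      show "\<bar>prod_list (map w ks) * (tilted_moment N n k t (is @ ks) W - tilted_moment N n k t is W)\<bar>
          \<le> K * (prod_list (map w ks) * sum_list (map h ks))"
        using p0 by (simp add: abs_mult mult_ac)
    qed
    also have "\<dots> = K * (real q * (wb ^ (q - 1) * ((\<Sum>x=1..N. w x * h x) / real N)))"
      unfolding site_mean_cmult site_mean_prod_list_sum_list wb_def ..
    finally show "\<bar>site_mean N q (\<lambda>ks. prod_list (map w ks) * (tilted_moment N n k t (is @ ks) W - tilted_moment N n k t is W))\<bar>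
      \<le> K * (real q * (wb ^ (q - 1) * ((\<Sum>x=1..N. w x * h x) / real N)))" .
  qed
  finally show ?thesis unfolding K_def h_def .
qed

section \<open>Fields acting on single sites\<close>

text \<open>The reciprocal of the Poisson probability of \<open>j\<close>, divided by
  \<open>L\<close>: under this weight a Poisson number of mean \<open>\<kappa>\<close> becomes
  uniform on the numbers below \<open>L\<close>.\<close>

definition field_weight :: "real \<Rightarrow> nat \<Rightarrow> nat \<Rightarrow> real" where
  "field_weight \<kappa> L j = (if j < L then fact j / \<kappa> ^ j * exp \<kappa> / real L else 0)"

text \<open>The summand 1 keeps the bound at least one, so that its powers increase.\<close>

definition field_bound :: "real \<Rightarrow> nat \<Rightarrow> real" where
  "field_bound \<kappa> L = 1 + (\<Sum>j<L. fact j / \<kappa> ^ j * exp \<kappa> / real L)"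

text \<open>Only the coupling +1 is counted, so that all counted fields push the spin the same way.
  With 2 \<kappa> N one-spin terms in mean and 2 N kinds of them, the count at a site has mean
  \<kappa>.\<close>

definition fields_at :: "nat \<Rightarrow> (int \<times> nat list) multiset \<Rightarrow> nat" where
  "fields_at x \<xi> = count \<xi> (1, [x])"

lemma field_weight_nonneg: "\<kappa> > 0 \<Longrightarrow> 0 \<le> field_weight \<kappa> L j"
  by (simp add: field_weight_def)

lemma field_bound_ge_1: "\<kappa> > 0 \<Longrightarrow> 1 \<le> field_bound \<kappa> L"
  by (simp add: field_bound_def sum_nonneg)

lemma field_weight_le_bound:
  assumes "\<kappa> > 0"
  shows "field_weight \<kappa> L j \<le> field_bound \<kappa> L"
proof (cases "j < L")
  case True
  have "fact j / \<kappa> ^ j * exp \<kappa> / real L \<le> (\<Sum>j<L. fact j / \<kappa> ^ j * exp \<kappa> / real L)"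
    using True assms by (intro member_le_sum) auto
  with True show ?thesis by (simp add: field_weight_def field_bound_def)
qed (use field_bound_ge_1[OF assms, of L] in \<open>simp add: field_weight_def\<close>)

lemma abs_field_weight_le_bound: "\<kappa> > 0 \<Longrightarrow> \<bar>field_weight \<kappa> L j\<bar> \<le> field_bound \<kappa> L"
  using field_weight_le_bound field_weight_nonneg by (simp add: abs_le_iff order_trans[OF _ field_weight_le_bound])

lemma pmf_term_law_field:
  assumes "x \<in> {1..N}"
  shows "pmf (term_law N 1) (1, [x]) = 1 / (2 * real N)"
proof -
  have "[x] \<in> Sites N 1" using assms by (simp add: Sites_def)
  then have "{-1, 1 :: int} \<times> Sites N 1 \<noteq> {}" "(1, [x]) \<in> {-1, 1 :: int} \<times> Sites N 1" by auto
  then show ?thesis unfolding term_law_def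
    by (subst pmf_of_set) (auto simp: card_cartesian_product)
qed

text \<open>The weight cancels the Poisson probabilities that \<open>poisson_mset_count_eq\<close>
  attaches to the multiplicities. What is left is a uniform number \<open>j\<close> of fields added
  to a sample without any at \<open>x\<close>; the factor \<open>exp \<kappa>\<close> compensates
  the probability of having none.\<close>

lemma expectation_field_weight:
  fixes g :: "(int \<times> nat list) multiset \<Rightarrow> real"
  assumes \<kappa>: "\<kappa> > 0" and x: "x \<in> {1..N}" and L: "L \<ge> 1" and g: "\<And>\<xi>. \<bar>g \<xi>\<bar> \<le> B"
  shows "(\<integral>\<xi>. field_weight \<kappa> L (fields_at x \<xi>) * g \<xi> \<partial>poisson_mset (2 * \<kappa> * real N) (term_law N 1))
    = exp \<kappa> / real L * (\<Sum>j<L. \<integral>\<xi>. of_bool (fields_at x \<xi> = 0) * g ((add_mset (1, [x]) ^^ j) \<xi>)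
        \<partial>poisson_mset (2 * \<kappa> * real N) (term_law N 1))"
proof -
  let ?P = "poisson_mset (2 * \<kappa> * real N) (term_law N 1)"
  have N: "N \<ge> 1" using x by auto
  have \<kappa>_eq: "2 * \<kappa> * real N * pmf (term_law N 1) (1, [x]) = \<kappa>"
    unfolding pmf_term_law_field[OF x] using N by simp
  have int: "integrable ?P (\<lambda>\<xi>. of_bool (fields_at x \<xi> = j) * g (h \<xi>))" for j h
    using g by (intro integrable_pmf_bounded[where B = "\<bar>B\<bar>"])
      (auto simp: abs_mult intro: order_trans[OF _ abs_ge_self])
  have normalize: "F / \<kappa> ^ j * exp \<kappa> / real L * I = exp \<kappa> / real L * I'"
    if "F * I = \<kappa> ^ j * I'" for F I I' j
  proof -
    have "F / \<kappa> ^ j * exp \<kappa> / real L * I = (F * I) / \<kappa> ^ j * (exp \<kappa> / real L)" by simp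
    then show ?thesis unfolding that using \<kappa> by simp
  qed
  have "(\<integral>\<xi>. field_weight \<kappa> L (fields_at x \<xi>) * g \<xi> \<partial>?P)
     = (\<integral>\<xi>. (\<Sum>j<L. (fact j / \<kappa> ^ j * exp \<kappa> / real L) * (of_bool (fields_at x \<xi> = j) * g \<xi>)) \<partial>?P)"
    by (intro Bochner_Integration.integral_cong refl)
       (simp add: field_weight_def of_bool_def if_distrib if_distribR sum.delta cong: if_cong)
  also have "\<dots> = (\<Sum>j<L. (fact j / \<kappa> ^ j * exp \<kappa> / real L) * (\<integral>\<xi>. of_bool (fields_at x \<xi> = j) * g \<xi> \<partial>?P))"
    using int[of _ "\<lambda>\<xi>. \<xi>"] by (subst Bochner_Integration.integral_sum) auto
  also have "(\<Sum>j<L. (fact j / \<kappa> ^ j * exp \<kappa> / real L) * (\<integral>\<xi>. of_bool (fields_at x \<xi> = j) * g \<xi> \<partial>?P))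
    = (\<Sum>j<L. exp \<kappa> / real L *
        (\<integral>\<xi>. of_bool (fields_at x \<xi> = 0) * g ((add_mset (1, [x]) ^^ j) \<xi>) \<partial>?P))"
  proof (rule sum.cong[OF refl])
    fix j
    have "fact j * (\<integral>\<xi>. of_bool (fields_at x \<xi> = j) * g \<xi> \<partial>?P)
        = \<kappa> ^ j * (\<integral>\<xi>. of_bool (fields_at x \<xi> = 0) * g ((add_mset (1, [x]) ^^ j) \<xi>) \<partial>?P)"
      unfolding fields_at_def using \<kappa> poisson_mset_count_eq[where \<mu> = "2 * \<kappa> * real N" and n = j and x = "(1, [x])" and q = "term_law N 1", OF _ g]
      by (simp only: \<kappa>_eq) simp
    then show "(fact j / \<kappa> ^ j * exp \<kappa> / real L) * (\<integral>\<xi>. of_bool (fields_at x \<xi> = j) * g \<xi> \<partial>?P)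
      = exp \<kappa> / real L * (\<integral>\<xi>. of_bool (fields_at x \<xi> = 0) * g ((add_mset (1, [x]) ^^ j) \<xi>) \<partial>?P)"
      by (rule normalize)
  qed
  finally show ?thesis by (simp add: sum_distrib_left)
qed

lemma fields_at_add_mset [simp]:
  "fields_at y ((add_mset (1, [x]) ^^ j) \<xi>) = fields_at y \<xi> + (if x = y then j else 0)"
  by (induction j) (auto simp: fields_at_def)

section \<open>Moments of the site weights\<close>

lemma no_fields_prob:
  assumes \<kappa>: "\<kappa> > 0" and X: "X \<subseteq> {1..N}" "finite X" and N: "N \<ge> 1"
  shows "(\<integral>\<xi>. of_bool (\<forall>x\<in>X. fields_at x \<xi> = 0) \<partial>poisson_mset (2 * \<kappa> * real N) (term_law N 1))
       = exp (- \<kappa> * real (card X))"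
proof -
  let ?A = "(\<lambda>x. (1 :: int, [x])) ` X"
  have "measure_pmf.prob (term_law N 1) ?A = (\<Sum>x\<in>X. pmf (term_law N 1) (1, [x]))"
    using X by (subst measure_measure_pmf_finite) (auto simp: sum.reindex inj_on_def)
  also have "\<dots> = (\<Sum>x\<in>X. 1 / (2 * real N))"
    using X by (intro sum.cong refl pmf_term_law_field) auto
  finally have prob: "measure_pmf.prob (term_law N 1) ?A = real (card X) / (2 * real N)" by simp
  have ev: "(\<forall>x\<in>X. fields_at x \<xi> = 0) \<longleftrightarrow> (\<forall>x\<in>#\<xi>. x \<notin> ?A)" for \<xi>
    by (auto simp: fields_at_def count_eq_zero_iff)
  show ?thesis
    using \<kappa> N unfolding ev by (subst poisson_mset_void, simp) (simp only: prob, simp)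
qed

lemma expectation_field_weight_eq_1:
  assumes \<kappa>: "\<kappa> > 0" and x: "x \<in> {1..N}" and L: "L \<ge> 1"
  shows "(\<integral>\<xi>. field_weight \<kappa> L (fields_at x \<xi>) \<partial>poisson_mset (2 * \<kappa> * real N) (term_law N 1)) = 1"
proof -
  have N: "N \<ge> 1" using x by auto
  show ?thesis
    using expectation_field_weight[OF \<kappa> x L, of "\<lambda>_. 1" 1] no_fields_prob[OF \<kappa>, of "{x}" N] x N L
    by (simp add: exp_minus)
qed

text \<open>Fields added at \<open>x\<close> do not change the count at \<open>y\<close>, so the two
  weights can be removed one after the other, and the void probability of the pair factorizes. The
  vanishing covariance is what concentrates \<open>mean_field_weight\<close>.\<close>

lemma expectation_field_weight_mult_eq_1:
  assumes \<kappa>: "\<kappa> > 0" and x: "x \<in> {1..N}" and y: "y \<in> {1..N}" and xy: "x \<noteq> y" and L: "L \<ge> 1"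
  shows "(\<integral>\<xi>. field_weight \<kappa> L (fields_at x \<xi>) * field_weight \<kappa> L (fields_at y \<xi>)
           \<partial>poisson_mset (2 * \<kappa> * real N) (term_law N 1)) = 1"
proof -
  let ?P = "poisson_mset (2 * \<kappa> * real N) (term_law N 1)"
  have N: "N \<ge> 1" using x by auto
  have "(\<integral>\<xi>. field_weight \<kappa> L (fields_at x \<xi>) * field_weight \<kappa> L (fields_at y \<xi>) \<partial>?P)
     = exp \<kappa> * (\<integral>\<xi>. field_weight \<kappa> L (fields_at y \<xi>) * of_bool (fields_at x \<xi> = 0) \<partial>?P)"
    using expectation_field_weight[OF \<kappa> x L, of "\<lambda>\<xi>. field_weight \<kappa> L (fields_at y \<xi>)" "field_bound \<kappa> L"]
      abs_field_weight_le_bound[OF \<kappa>, of L] xy L by (simp add: mult.commute)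
  also have "(\<integral>\<xi>. field_weight \<kappa> L (fields_at y \<xi>) * of_bool (fields_at x \<xi> = 0) \<partial>?P)
     = exp \<kappa> * (\<integral>\<xi>. of_bool (\<forall>z\<in>{x, y}. fields_at z \<xi> = 0) \<partial>?P)"
    using expectation_field_weight[OF \<kappa> y L, of "\<lambda>\<xi>. of_bool (fields_at x \<xi> = 0)" 1] xy L
    by (simp add: of_bool_conj mult.commute)
  also have "(\<integral>\<xi>. of_bool (\<forall>z\<in>{x, y}. fields_at z \<xi> = 0) \<partial>?P) = exp (- \<kappa> * real (card {x, y}))"
    using x y N by (intro no_fields_prob[OF \<kappa>]) auto
  finally show ?thesis using xy by (simp add: mult_exp_exp)
qed

definition mean_field_weight :: "nat \<Rightarrow> real \<Rightarrow> nat \<Rightarrow> (int \<times> nat list) multiset \<Rightarrow> real" where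
  "mean_field_weight N \<kappa> L \<xi> = (\<Sum>x=1..N. field_weight \<kappa> L (fields_at x \<xi>)) / real N"

lemma mean_field_weight_bounds:
  assumes \<kappa>: "\<kappa> > 0"
  shows "0 \<le> mean_field_weight N \<kappa> L \<xi>" "mean_field_weight N \<kappa> L \<xi> \<le> field_bound \<kappa> L"
proof -
  show "0 \<le> mean_field_weight N \<kappa> L \<xi>"
    using field_weight_nonneg[OF \<kappa>] by (simp add: mean_field_weight_def sum_nonneg)
  have "(\<Sum>x=1..N. field_weight \<kappa> L (fields_at x \<xi>)) \<le> (\<Sum>x=1..N. field_bound \<kappa> L)"
    by (intro sum_mono field_weight_le_bound \<kappa>)
  then show "mean_field_weight N \<kappa> L \<xi> \<le> field_bound \<kappa> L"
    using field_bound_ge_1[OF \<kappa>, of L]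
    by (cases "N = 0") (auto simp: mean_field_weight_def field_simps)
qed

lemma pmf_expectation_abs_le_sqrt:
  fixes f :: "'a \<Rightarrow> real"
  assumes "\<And>x. \<bar>f x\<bar> \<le> B"
  shows "(\<integral>x. \<bar>f x\<bar> \<partial>measure_pmf p) \<le> sqrt (\<integral>x. (f x)\<^sup>2 \<partial>measure_pmf p)"
proof (rule real_le_rsqrt)
  have B0: "0 \<le> B" using assms[of undefined] by linarith
  have int: "integrable p (\<lambda>x. \<bar>f x\<bar>)" "integrable p (\<lambda>x. \<bar>f x\<bar>\<^sup>2)"
  proof -
    show "integrable p (\<lambda>x. \<bar>f x\<bar>)"
      using assms by (intro integrable_pmf_bounded[where B = B]) simp
    have "\<bar>\<bar>f x\<bar>\<^sup>2\<bar> \<le> B\<^sup>2" for x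
      using assms[of x] B0 by (simp add: power2_le_iff_abs_le)
    then show "integrable p (\<lambda>x. \<bar>f x\<bar>\<^sup>2)" by (rule integrable_pmf_bounded)
  qed
  have "0 \<le> measure_pmf.variance p (\<lambda>x. \<bar>f x\<bar>)" by simp
  also have "\<dots> = (\<integral>x. (f x)\<^sup>2 \<partial>p) - (\<integral>x. \<bar>f x\<bar> \<partial>p)\<^sup>2"
    using int by (subst measure_pmf.variance_eq) auto
  finally show "(\<integral>x. \<bar>f x\<bar> \<partial>p)\<^sup>2 \<le> (\<integral>x. (f x)\<^sup>2 \<partial>p)" by simp
qed

text \<open>Weights at distinct sites are uncorrelated with mean one, so only the diagonal
  contributes to the variance, at most the squared bound over N. This allows the factor
  \<open>wb ^ q\<close> of \<open>frozen_displacement\<close> to be replaced by one.\<close>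

lemma mean_field_weight_concentrates:
  assumes \<kappa>: "\<kappa> > 0" and N: "N \<ge> 1" and L: "L \<ge> 1"
  shows "(\<integral>\<xi>. \<bar>mean_field_weight N \<kappa> L \<xi> - 1\<bar> \<partial>poisson_mset (2 * \<kappa> * real N) (term_law N 1))
       \<le> field_bound \<kappa> L / sqrt (real N)"
proof -
  let ?P = "poisson_mset (2 * \<kappa> * real N) (term_law N 1)" and ?B = "field_bound \<kappa> L"
  let ?w = "\<lambda>x \<xi>. field_weight \<kappa> L (fields_at x \<xi>)"
  have B: "1 \<le> ?B" by (rule field_bound_ge_1[OF \<kappa>])
  have wB: "\<bar>?w x \<xi>\<bar> \<le> ?B" for x \<xi> by (rule abs_field_weight_le_bound[OF \<kappa>])
  have wwB: "\<bar>?w x \<xi> * ?w y \<xi>\<bar> \<le> ?B * ?B" for x y \<xi>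
    unfolding abs_mult using wB B by (intro mult_mono) auto
  have int1: "integrable ?P (?w x)" and int2: "integrable ?P (\<lambda>\<xi>. ?w x \<xi> * ?w y \<xi>)" for x y
    by (rule integrable_pmf_bounded[OF wB], rule integrable_pmf_bounded[OF wwB])
  have EB: "(\<integral>\<xi>. ?w x \<xi> * ?w y \<xi> \<partial>?P) \<le> ?B * ?B" for x y
    by (rule order_trans[OF abs_ge_self abs_expectation_pmf_le[OF wwB]])
  have E1: "(\<integral>\<xi>. mean_field_weight N \<kappa> L \<xi> \<partial>?P) = 1"
    using N int1 expectation_field_weight_eq_1[OF \<kappa> _ L]
    by (simp add: mean_field_weight_def Bochner_Integration.integral_sum)
  have "(\<integral>\<xi>. (\<Sum>x=1..N. ?w x \<xi>)\<^sup>2 \<partial>?P) = (\<Sum>x=1..N. \<Sum>y=1..N. \<integral>\<xi>. ?w x \<xi> * ?w y \<xi> \<partial>?P)"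
    using int2 by (simp add: power2_eq_square sum_product Bochner_Integration.integral_sum Bochner_Integration.integrable_sum)
  also have "\<dots> \<le> (\<Sum>x=1..N. \<Sum>y=1..N. 1 + (if x = y then ?B * ?B else 0))"
  proof (intro sum_mono)
    fix x y assume "x \<in> {1..N}" "y \<in> {1..N}"
    then show "(\<integral>\<xi>. ?w x \<xi> * ?w y \<xi> \<partial>?P) \<le> 1 + (if x = y then ?B * ?B else 0)"
      using expectation_field_weight_mult_eq_1[OF \<kappa> _ _ _ L, of x N y]
        EB[of x y] by (cases "x = y") auto
  qed
  also have "\<dots> = (real N)\<^sup>2 + real N * (?B * ?B)"
    by (simp add: sum.distrib power2_eq_square algebra_simps)
  finally have E2: "(\<integral>\<xi>. (mean_field_weight N \<kappa> L \<xi>)\<^sup>2 \<partial>?P) \<le> 1 + ?B\<^sup>2 / real N"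
    using N by (simp add: mean_field_weight_def power_divide field_simps power2_eq_square)
  let ?m = "mean_field_weight N \<kappa> L"
  have mB: "\<bar>?m \<xi>\<bar> \<le> ?B" and m1B: "\<bar>?m \<xi> - 1\<bar> \<le> ?B" for \<xi>
    using mean_field_weight_bounds[OF \<kappa>, of N L \<xi>] B by auto
  have m2B: "\<bar>(?m \<xi>)\<^sup>2\<bar> \<le> ?B\<^sup>2" for \<xi>
    using mB[of \<xi>] B by (simp add: power2_le_iff_abs_le)
  have intm: "integrable ?P ?m" "integrable ?P (\<lambda>\<xi>. (?m \<xi>)\<^sup>2)"
    using integrable_pmf_bounded[OF mB] integrable_pmf_bounded[OF m2B] by auto
  have "(\<integral>\<xi>. (?m \<xi> - 1)\<^sup>2 \<partial>?P) = (\<integral>\<xi>. (?m \<xi>)\<^sup>2 + 1 - 2 * ?m \<xi> \<partial>?P)"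
    by (simp add: power2_diff)
  also have "\<dots> = (\<integral>\<xi>. (?m \<xi>)\<^sup>2 \<partial>?P) + 1 - 2 * 1"
    using intm E1 by (simp add: measure_pmf.prob_space[simplified])
  also have "\<dots> \<le> ?B\<^sup>2 / real N" using E2 by simp
  finally have var: "(\<integral>\<xi>. (?m \<xi> - 1)\<^sup>2 \<partial>?P) \<le> ?B\<^sup>2 / real N" .
  have "(\<integral>\<xi>. \<bar>?m \<xi> - 1\<bar> \<partial>?P) \<le> sqrt (\<integral>\<xi>. (?m \<xi> - 1)\<^sup>2 \<partial>?P)"
    by (rule pmf_expectation_abs_le_sqrt[OF m1B])
  also have "\<dots> \<le> sqrt (?B\<^sup>2 / real N)" using var by (rule real_sqrt_le_mono)
  also have "\<dots> = ?B / sqrt (real N)" using B by (simp add: real_sqrt_divide)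
  finally show ?thesis .
qed

text \<open>Each further field moves the magnetization \<open>v\<close> by at least \<open>\<bar>tanh c\<bar> (1 - v\<^sup>2) / 2\<close> in a
  fixed direction, so however strong the other interactions are, at most boundedly many field
  strengths leave the spin unfrozen.\<close>

lemma sum_unfrozen_le:
  assumes W: "pos_weight N W" and x: "x \<in> {1..N}" and c: "c \<noteq> 0"
  shows "(\<Sum>j<L. 1 - (avg N (perturb c ((add_mset (1, [x]) ^^ j) \<xi>) W) (\<lambda>\<sigma>. \<sigma> x))\<^sup>2) \<le> 4 / \<bar>tanh c\<bar>"
proof -
  define v where "v = (\<lambda>j. avg N (perturb c ((add_mset (1, [x]) ^^ j) \<xi>) W) (\<lambda>\<sigma>. \<sigma> x))"
  define T where "T = tanh c"
  have T: "T \<noteq> 0" "\<bar>T\<bar> < 1" using c abs_tanh_less_1[of c] by (auto simp: T_def)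
  have pos: "pos_weight N (perturb c \<xi> W)" for \<xi> by (rule pos_weight_perturb[OF W])
  have v1: "\<bar>v j\<bar> \<le> 1" for j
    unfolding v_def using abs_avg_spin_le_1[OF pos, of "[x]"] x by simp
  have step: "1 - (v j)\<^sup>2 \<le> 2 * ((v (Suc j) - v j) / T)" for j
  proof -
    let ?V = "perturb c ((add_mset (1, [x]) ^^ j) \<xi>) W"
    have sq: "avg N ?V (\<lambda>\<sigma>. spin \<sigma> [x] * \<sigma> x) = 1"
    proof -
      have "avg N ?V (\<lambda>\<sigma>. spin \<sigma> [x] * \<sigma> x) = avg N ?V (\<lambda>_. 1)"
        using configs_cases[OF _ x] by (intro avg_cong) (force, fastforce)
      then show ?thesis by (simp add: avg_const[OF pos])
    qed
    \<comment> \<open>Since the square of a spin is one, a further field acts on the magnetization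
      by the addition formula of the hyperbolic tangent.\<close>
    have "v (Suc j) = avg N (tilt (T * real_of_int 1) [x] ?V) (\<lambda>\<sigma>. \<sigma> x)"
      unfolding v_def T_def funpow.simps comp_def using x by (intro avg_perturb_add_mset) auto
    also have "\<dots> = (v j + T) / (1 + T * v j)"
      unfolding avg_tilt[OF pos] sq by (simp add: v_def)
    finally have vS: "v (Suc j) = (v j + T) / (1 + T * v j)" .
    have den: "0 < 1 + T * v j" by (rule one_plus_pos) (use T v1 in auto)
    have "T * v j \<le> 1" using mult_mono[of "\<bar>T\<bar>" 1 "\<bar>v j\<bar>" 1] T v1[of j]
      by (simp add: abs_mult[symmetric])
    have "(v (Suc j) - v j) / T = (1 - (v j)\<^sup>2) / (1 + T * v j)"
    proof -
      have "(v j + T) / (1 + T * v j) - v j = ((v j + T) - v j * (1 + T * v j)) / (1 + T * v j)"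
        using den by (simp add: diff_divide_distrib)
      also have "(v j + T) - v j * (1 + T * v j) = T * (1 - (v j)\<^sup>2)"
        by (simp add: algebra_simps power2_eq_square)
      finally show ?thesis unfolding vS using T by simp
    qed
    \<comment> \<open>The denominator is at most two, so each step moves \<open>v\<close> by a
      definite multiple of \<open>1 - (v j)\<^sup>2\<close>, always in the direction of
      \<open>T\<close>; the increments telescope in an interval of length two.\<close>
    moreover have "(1 - (v j)\<^sup>2) / 2 \<le> (1 - (v j)\<^sup>2) / (1 + T * v j)"
      using den \<open>T * v j \<le> 1\<close> v1[of j] by (intro divide_left_mono) (auto simp: abs_square_le_1)
    then have "1 - (v j)\<^sup>2 \<le> 2 * ((1 - (v j)\<^sup>2) / (1 + T * v j))"
      by (simp only: pos_divide_le_eq[of 2] mult.commute[of 2])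
    ultimately show ?thesis by (simp only:)
  qed
  have "(\<Sum>j<L. 1 - (v j)\<^sup>2) \<le> (\<Sum>j<L. 2 * ((v (Suc j) - v j) / T))"
    by (intro sum_mono step)
  also have "\<dots> = 2 * ((v L - v 0) / T)"
    unfolding sum_distrib_left[symmetric] sum_divide_distrib[symmetric] sum_lessThan_telescope ..
  also have "\<dots> \<le> 2 * (2 / \<bar>T\<bar>)"
  proof -
    have "\<bar>v L - v 0\<bar> \<le> 2" using v1[of L] v1[of 0] by linarith
    then have "\<bar>(v L - v 0) / T\<bar> \<le> 2 / \<bar>T\<bar>" by (simp add: divide_right_mono)
    from order_trans[OF abs_ge_self this] show ?thesis by (rule mult_left_mono) simp
  qed
  finally show ?thesis by (simp add: v_def T_def)
qed

text \<open>The bias makes the number of fields uniform over \<open>L\<close> values, while the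
  unfrozenness summed over all of them is bounded independently of \<open>L\<close>. Hence the mean
  decays like 1 / L, uniformly in the weight \<open>W\<close> that stands for all other
  interactions.\<close>

lemma expectation_unfrozen_le:
  assumes W: "pos_weight N W" and x: "x \<in> {1..N}" and c: "c \<noteq> 0" and \<kappa>: "\<kappa> > 0" and L: "L \<ge> 1"
  shows "(\<integral>\<xi>. field_weight \<kappa> L (fields_at x \<xi>) * (1 - (avg N (perturb c \<xi> W) (\<lambda>\<sigma>. \<sigma> x))\<^sup>2)
           \<partial>poisson_mset (2 * \<kappa> * real N) (term_law N 1))
       \<le> 4 * exp \<kappa> / (\<bar>tanh c\<bar> * real L)"
proof -
  let ?P = "poisson_mset (2 * \<kappa> * real N) (term_law N 1)"
  define h where "h = (\<lambda>\<xi>. 1 - (avg N (perturb c \<xi> W) (\<lambda>\<sigma>. \<sigma> x))\<^sup>2)"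
  have h: "0 \<le> h \<xi>" "h \<xi> \<le> 1" for \<xi>
    using abs_avg_spin_le_1[OF pos_weight_perturb[OF W], of "[x]" c \<xi>] x
    by (auto simp: h_def abs_square_le_1)
  then have habs: "\<bar>h \<xi>\<bar> \<le> 1" for \<xi> by (simp add: abs_le_iff order_trans[OF _ h(1)])
  have int: "integrable ?P (\<lambda>\<xi>. of_bool (fields_at x \<xi> = 0) * h (f \<xi>))" for f
    using habs by (intro integrable_pmf_bounded[where B = 1]) (auto simp: of_bool_def)
  have "(\<Sum>j<L. \<integral>\<xi>. of_bool (fields_at x \<xi> = 0) * h ((add_mset (1, [x]) ^^ j) \<xi>) \<partial>?P)
     = (\<integral>\<xi>. (\<Sum>j<L. of_bool (fields_at x \<xi> = 0) * h ((add_mset (1, [x]) ^^ j) \<xi>)) \<partial>?P)"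
    using int by (subst Bochner_Integration.integral_sum) auto
  also have "\<dots> \<le> 4 / \<bar>tanh c\<bar>"
  proof (rule measure_pmf.integral_le_const)
    show "integrable ?P (\<lambda>\<xi>. \<Sum>j<L. of_bool (fields_at x \<xi> = 0) * h ((add_mset (1, [x]) ^^ j) \<xi>))"
      using int by (intro Bochner_Integration.integrable_sum)
    have "(\<Sum>j<L. of_bool (fields_at x \<xi> = 0) * h ((add_mset (1, [x]) ^^ j) \<xi>)) \<le> 4 / \<bar>tanh c\<bar>" for \<xi>
      using sum_unfrozen_le[OF W x c, where L = L and \<xi> = \<xi>] c
      by (auto simp: of_bool_def h_def)
    then show "AE \<xi> in ?P. (\<Sum>j<L. of_bool (fields_at x \<xi> = 0) * h ((add_mset (1, [x]) ^^ j) \<xi>)) \<le> 4 / \<bar>tanh c\<bar>"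
      by simp
  qed
  finally have bound: "(\<Sum>j<L. \<integral>\<xi>. of_bool (fields_at x \<xi> = 0) * h ((add_mset (1, [x]) ^^ j) \<xi>) \<partial>?P)
      \<le> 4 / \<bar>tanh c\<bar>" .
  have "(\<integral>\<xi>. field_weight \<kappa> L (fields_at x \<xi>) * h \<xi> \<partial>?P)
     = exp \<kappa> / real L * (\<Sum>j<L. \<integral>\<xi>. of_bool (fields_at x \<xi> = 0) * h ((add_mset (1, [x]) ^^ j) \<xi>) \<partial>?P)"
    by (rule expectation_field_weight[OF \<kappa> x L habs])
  also have "\<dots> \<le> exp \<kappa> / real L * (4 / \<bar>tanh c\<bar>)"
    by (intro mult_left_mono bound) simp
  finally show ?thesis unfolding h_def by (simp add: mult.commute)
qed

section \<open>The quantitative bound on the displacement\<close>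

lemma abs_power_minus_one_le:
  fixes a B :: real
  assumes "0 \<le> a" "a \<le> B" "1 \<le> B"
  shows "\<bar>a ^ j - 1\<bar> \<le> real j * B ^ j * \<bar>a - 1\<bar>"
proof (induction j)
  case (Suc j)
  have Bj: "1 \<le> B ^ j" using assms by (simp add: one_le_power)
  have "a ^ Suc j - 1 = a * (a ^ j - 1) + (a - 1)" by (simp add: algebra_simps)
  also have "\<bar>\<dots>\<bar> \<le> B * (real j * B ^ j * \<bar>a - 1\<bar>) + B ^ Suc j * \<bar>a - 1\<bar>"
  proof (intro order_trans[OF abs_triangle_ineq] add_mono)
    show "\<bar>a * (a ^ j - 1)\<bar> \<le> B * (real j * B ^ j * \<bar>a - 1\<bar>)"
      unfolding abs_mult[of a] using assms Suc.IH by (intro mult_mono) auto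
    show "\<bar>a - 1\<bar> \<le> B ^ Suc j * \<bar>a - 1\<bar>"
      using mult_right_mono[OF one_le_power[OF assms(3), of "Suc j"], of "\<bar>a - 1\<bar>"] by simp
  qed
  finally show ?case by (simp add: algebra_simps)
qed simp

text \<open>The coefficient of 1 / sqrt N. Its summands stem from replacing b ^ q by one, from the
  insertion into the (m + q)-spin sample, and from replacing b ^ (q - 1) by one in the freezing
  error, where b is the mean site weight. It may grow with \<open>L\<close>, which is held fixed
  while N grows.\<close>

definition displacement_const :: "real \<Rightarrow> nat \<Rightarrow> nat \<Rightarrow> real \<Rightarrow> nat \<Rightarrow> real" where
  "displacement_const \<alpha> q k t L =
     (let B = field_bound (\<alpha> / 2) L in
        2 * (real q * B ^ q * B) + B ^ q / sqrt \<alpha> + real k * (2 / (1 - \<bar>t\<bar>)) * real q * (B * (real q * B ^ q * B)))"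

text \<open>The two samples are treated separately. With the one-spin sample \<open>\<xi>\<close>
  fixed, the bias is a fixed function of the site and the insertion into \<open>\<eta>\<close> is
  stable; with \<open>\<eta>\<close> fixed and absorbed in the weight, the mean over
  \<open>\<xi>\<close> freezes the biased sites. The bound is uniform in \<open>W\<close>, which
  holds all other interactions.\<close>

theorem displacement_bound:
  assumes N: "N \<ge> 1" and \<alpha>: "\<alpha> > 0" and W: "pos_weight N W" and c: "c \<noteq> 0" and L: "L \<ge> 1"
  shows "\<bar>\<integral>\<xi>. \<integral>\<eta>. displacement N m n k (tanh d) (perturb d \<eta> (perturb c \<xi> W))
            \<partial>poisson_mset (\<alpha> * real N) (term_law N (m + q)) \<partial>poisson_mset (\<alpha> * real N) (term_law N 1)\<bar>
      \<le> displacement_const \<alpha> q k (tanh d) L / sqrt (real N)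
        + real k * (2 / (1 - \<bar>tanh d\<bar>)) * real q * (4 * exp (\<alpha> / 2) / (\<bar>tanh c\<bar> * real L))"
proof -
  \<comment> \<open>Half of the one-spin terms carry the coupling +1, so each site has
    \<open>\<alpha> / 2\<close> counted fields in mean.\<close>
  define \<kappa> where "\<kappa> = \<alpha> / 2"
  have \<kappa>: "\<kappa> > 0" and \<alpha>\<kappa>: "\<alpha> = 2 * \<kappa>" using \<alpha> by (simp_all add: \<kappa>_def)
  define t where "t = tanh d"
  have t: "\<bar>t\<bar> < 1" unfolding t_def by (rule abs_tanh_less_1)
  define B where "B = field_bound \<kappa> L"
  define K where "K = real k * (2 / (1 - \<bar>t\<bar>))"
  have B: "1 \<le> B" unfolding B_def by (rule field_bound_ge_1[OF \<kappa>])
  have K: "0 \<le> K" using t by (simp add: K_def)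
  let ?P = "poisson_mset (2 * \<kappa> * real N) (term_law N 1)"
  let ?Q = "poisson_mset (2 * \<kappa> * real N) (term_law N (m + q))"
  define V where "V = (\<lambda>\<xi> \<eta>. perturb d \<eta> (perturb c \<xi> W))"
  define D where "D = (\<lambda>\<xi> \<eta>. displacement N m n k t (V \<xi> \<eta>))"
  define b where "b = mean_field_weight N \<kappa> L"
  define e where "e = (\<lambda>\<xi> \<eta>. (\<Sum>x=1..N. field_weight \<kappa> L (fields_at x \<xi>)
      * (1 - (avg N (V \<xi> \<eta>) (\<lambda>\<sigma>. \<sigma> x))\<^sup>2)) / real N)"
  have V: "pos_weight N (V \<xi> \<eta>)" for \<xi> \<eta> unfolding V_def by (intro pos_weight_perturb W)
  have D2: "\<bar>D \<xi> \<eta>\<bar> \<le> 2" for \<xi> \<eta> unfolding D_def by (intro abs_displacement_le_2 N V t)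
  have b: "0 \<le> b \<xi>" "b \<xi> \<le> B" for \<xi>
    unfolding b_def B_def by (rule mean_field_weight_bounds[OF \<kappa>])+
  have bj: "0 \<le> b \<xi> ^ j" "b \<xi> ^ j \<le> B ^ j" for \<xi> j using b by (auto intro: power_mono)
  have h01: "0 \<le> 1 - (avg N (V \<xi> \<eta>) (\<lambda>\<sigma>. \<sigma> x))\<^sup>2" "1 - (avg N (V \<xi> \<eta>) (\<lambda>\<sigma>. \<sigma> x))\<^sup>2 \<le> 1"
    if "x \<in> {1..N}" for x \<xi> \<eta>
    using abs_avg_spin_le_1[OF V, of "[x]" \<xi> \<eta>] that by (auto simp: abs_square_le_1)
  have e: "0 \<le> e \<xi> \<eta>" "e \<xi> \<eta> \<le> b \<xi>" for \<xi> \<eta>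
  proof -
    show "0 \<le> e \<xi> \<eta>"
      unfolding e_def using h01 field_weight_nonneg[OF \<kappa>] by (intro divide_nonneg_nonneg sum_nonneg mult_nonneg_nonneg) auto
    show "e \<xi> \<eta> \<le> b \<xi>"
      unfolding e_def b_def mean_field_weight_def
      using h01 field_weight_nonneg[OF \<kappa>] by (intro divide_right_mono sum_mono mult_left_le) auto
  qed
  have eB: "\<bar>e \<xi> \<eta>\<bar> \<le> B" for \<xi> \<eta> using e[of \<xi> \<eta>] b[of \<xi>] by linarith
  have B0: "0 \<le> B ^ q" using B by simp
  have conc: "(\<integral>\<xi>. \<bar>b \<xi> ^ j - 1\<bar> \<partial>?P) \<le> real j * B ^ j * (B / sqrt (real N))" for j
  proof -
    have b1: "\<bar>b \<xi> - 1\<bar> \<le> B" for \<xi> using b[of \<xi>] B by linarith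
    have "(\<integral>\<xi>. \<bar>b \<xi> ^ j - 1\<bar> \<partial>?P) \<le> (\<integral>\<xi>. real j * B ^ j * \<bar>b \<xi> - 1\<bar> \<partial>?P)"
    proof (rule integral_mono)
      have "\<bar>b \<xi> ^ j - 1\<bar> \<le> B ^ j" for \<xi>
        using bj[of \<xi> j] one_le_power[OF B, of j] by linarith
      then show "integrable ?P (\<lambda>\<xi>. \<bar>b \<xi> ^ j - 1\<bar>)"
        by (intro integrable_pmf_bounded[where B = "B ^ j"]) simp
      show "integrable ?P (\<lambda>\<xi>. real j * B ^ j * \<bar>b \<xi> - 1\<bar>)"
        by (intro integrable_mult_right integrable_pmf_bounded[where B = B]) (simp add: b1)
    qed (rule abs_power_minus_one_le[OF b B])
    also have "\<dots> \<le> real j * B ^ j * (B / sqrt (real N))"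
      using mean_field_weight_concentrates[OF \<kappa> N L] B unfolding b_def B_def
      by (simp only: integral_mult_right_zero) (intro mult_left_mono, auto)
    finally show ?thesis .
  qed
  have Ee: "(\<integral>\<xi>. e \<xi> \<eta> \<partial>?P) \<le> 4 * exp \<kappa> / (\<bar>tanh c\<bar> * real L)" for \<eta>
  proof -
    let ?h = "\<lambda>x \<xi>. field_weight \<kappa> L (fields_at x \<xi>) * (1 - (avg N (V \<xi> \<eta>) (\<lambda>\<sigma>. \<sigma> x))\<^sup>2)"
    have int: "integrable ?P (?h x)" if x: "x \<in> {1..N}" for x
    proof (rule integrable_pmf_bounded)
      fix \<xi>
      have "\<bar>?h x \<xi>\<bar> \<le> B * 1"
        unfolding abs_mult B_def using h01[OF x, of \<xi> \<eta>] abs_field_weight_le_bound[OF \<kappa>] B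
        by (intro mult_mono) (auto simp: B_def)
      then show "\<bar>?h x \<xi>\<bar> \<le> B" by simp
    qed
    have "(\<integral>\<xi>. e \<xi> \<eta> \<partial>?P) = (\<Sum>x=1..N. \<integral>\<xi>. ?h x \<xi> \<partial>?P) / real N"
      unfolding e_def using int by (simp add: Bochner_Integration.integral_sum)
    \<comment> \<open>For fixed \<open>\<eta>\<close> its perturbation is moved inside and becomes
      part of the arbitrary weight of \<open>expectation_unfrozen_le\<close>.\<close>
    also have "\<dots> \<le> (\<Sum>x=1..N. 4 * exp \<kappa> / (\<bar>tanh c\<bar> * real L)) / real N"
      unfolding V_def perturb_commute[of d]
      by (intro divide_right_mono sum_mono expectation_unfrozen_le pos_weight_perturb W c \<kappa> L) auto
    also have "\<dots> = 4 * exp \<kappa> / (\<bar>tanh c\<bar> * real L)" using N by simp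
    finally show ?thesis .
  qed
  \<comment> \<open>Insertion bounds the weighted effect \<open>F\<close> of the (m + q)-spin term,
    and freezing identifies \<open>F\<close> with \<open>b \<xi> ^ q\<close> times the m-spin
    displacement up to \<open>R\<close>.\<close>
  have fixed: "\<bar>b \<xi> ^ q * (\<integral>\<eta>. D \<xi> \<eta> \<partial>?Q)\<bar> \<le> B ^ q / sqrt (2 * \<kappa> * real N)
      + K * (real q * (b \<xi> ^ (q - 1) * (\<integral>\<eta>. e \<xi> \<eta> \<partial>?Q)))" for \<xi>
  proof -
    define w where "w = (\<lambda>x. field_weight \<kappa> L (fields_at x \<xi>))"
    define F where "F = (\<lambda>\<eta>. site_mean N m (\<lambda>is. site_mean N q (\<lambda>ks. prod_list (map w ks) *
            (tilted_moment N n k t (is @ ks) (V \<xi> \<eta>) - overlap_moment N n k (V \<xi> \<eta>)))))"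
    define R where "R = (\<lambda>\<eta>. K * (real q * (b \<xi> ^ (q - 1) * e \<xi> \<eta>)))"
    have w: "\<bar>w x\<bar> \<le> B" "0 \<le> w x" for x
      unfolding w_def B_def by (rule abs_field_weight_le_bound[OF \<kappa>], rule field_weight_nonneg[OF \<kappa>])
    have F: "\<bar>\<integral>\<eta>. F \<eta> \<partial>?Q\<bar> \<le> B ^ q / sqrt (2 * \<kappa> * real N)"
      unfolding F_def V_def t_def using \<kappa> N w by (intro insert_term_stable pos_weight_perturb W) auto
    have b_eq: "b \<xi> = (\<Sum>x=1..N. w x) / real N" by (simp add: b_def mean_field_weight_def w_def)
    have pw: "\<bar>F \<eta> - b \<xi> ^ q * D \<xi> \<eta>\<bar> \<le> R \<eta>" for \<eta>
      using frozen_displacement[OF N V[of \<xi> \<eta>] t w(2), where m = m and q = q and n = n and k = k]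
      unfolding F_def D_def R_def K_def e_def b_eq by (simp add: w_def)
    have intD: "integrable ?Q (D \<xi>)" using D2 by (rule integrable_pmf_bounded)
    have intR: "integrable ?Q R"
      unfolding R_def by (intro integrable_mult_right integrable_pmf_bounded[OF eB])
    have RB: "\<bar>R \<eta>\<bar> \<le> K * (real q * (b \<xi> ^ (q - 1) * B))" for \<eta>
      unfolding R_def abs_mult using K bj[of \<xi> "q - 1"] eB[of \<xi> \<eta>]
      by (intro mult_mono) auto
    have bD: "\<bar>b \<xi> ^ q * D \<xi> \<eta>\<bar> \<le> B ^ q * 2" for \<eta>
      unfolding abs_mult using bj[of \<xi> q] D2 B0 by (intro mult_mono) auto
    have intF: "integrable ?Q F"
    proof (rule integrable_pmf_bounded)
      show "\<bar>F \<eta>\<bar> \<le> K * (real q * (b \<xi> ^ (q - 1) * B)) + B ^ q * 2" for \<eta>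
        using pw[of \<eta>] RB[of \<eta>] bD[of \<eta>] by linarith
    qed
    have "b \<xi> ^ q * (\<integral>\<eta>. D \<xi> \<eta> \<partial>?Q) = (\<integral>\<eta>. F \<eta> \<partial>?Q) - (\<integral>\<eta>. F \<eta> - b \<xi> ^ q * D \<xi> \<eta> \<partial>?Q)"
      using intF intD by simp
    also have "\<bar>\<dots>\<bar> \<le> B ^ q / sqrt (2 * \<kappa> * real N) + (\<integral>\<eta>. R \<eta> \<partial>?Q)"
    proof -
      have "\<bar>\<integral>\<eta>. F \<eta> - b \<xi> ^ q * D \<xi> \<eta> \<partial>?Q\<bar> \<le> (\<integral>\<eta>. \<bar>F \<eta> - b \<xi> ^ q * D \<xi> \<eta>\<bar> \<partial>?Q)"
        by (rule integral_abs_bound)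
      also have "\<dots> \<le> (\<integral>\<eta>. R \<eta> \<partial>?Q)"
        using intF intD intR pw by (intro integral_mono) auto
      finally show ?thesis using F by linarith
    qed
    finally show ?thesis by (simp add: R_def)
  qed
  have DI2: "\<bar>\<integral>\<eta>. D \<xi> \<eta> \<partial>?Q\<bar> \<le> 2" for \<xi> by (rule abs_expectation_pmf_le[OF D2])
  have eI: "\<bar>\<integral>\<eta>. e \<xi> \<eta> \<partial>?Q\<bar> \<le> B" for \<xi> by (rule abs_expectation_pmf_le[OF eB])
  \<comment> \<open>Both powers of \<open>b \<xi>\<close> are replaced by one, using the trivial
    bounds 2 on the displacement and \<open>B\<close> on the freezing error. The mean over
    \<open>\<xi>\<close> of every remaining term is under control.\<close>
  have point: "\<bar>\<integral>\<eta>. D \<xi> \<eta> \<partial>?Q\<bar> \<le> 2 * \<bar>b \<xi> ^ q - 1\<bar> + B ^ q / sqrt (2 * \<kappa> * real N)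
      + K * real q * (B * \<bar>b \<xi> ^ (q - 1) - 1\<bar> + (\<integral>\<eta>. e \<xi> \<eta> \<partial>?Q))" for \<xi>
  proof -
    define X E where "X = (\<integral>\<eta>. D \<xi> \<eta> \<partial>?Q)" and "E = (\<integral>\<eta>. e \<xi> \<eta> \<partial>?Q)"
    have "X = b \<xi> ^ q * X - (b \<xi> ^ q - 1) * X" by (simp add: algebra_simps)
    also have "\<bar>\<dots>\<bar> \<le> \<bar>b \<xi> ^ q * X\<bar> + \<bar>b \<xi> ^ q - 1\<bar> * \<bar>X\<bar>"
      unfolding abs_mult[of "b \<xi> ^ q - 1", symmetric] by (rule abs_triangle_ineq4)
    also have "\<bar>b \<xi> ^ q - 1\<bar> * \<bar>X\<bar> \<le> \<bar>b \<xi> ^ q - 1\<bar> * 2"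
      using DI2 unfolding X_def by (intro mult_left_mono) auto
    also have "\<bar>b \<xi> ^ q * X\<bar> \<le> B ^ q / sqrt (2 * \<kappa> * real N) + K * (real q * (b \<xi> ^ (q - 1) * E))"
      unfolding X_def E_def by (rule fixed)
    also have "K * (real q * (b \<xi> ^ (q - 1) * E)) \<le> K * (real q * (B * \<bar>b \<xi> ^ (q - 1) - 1\<bar> + E))"
    proof -
      have "(b \<xi> ^ (q - 1) - 1) * E \<le> \<bar>b \<xi> ^ (q - 1) - 1\<bar> * \<bar>E\<bar>"
        using abs_ge_self[of "(b \<xi> ^ (q - 1) - 1) * E"] by (simp add: abs_mult)
      also have "\<dots> \<le> \<bar>b \<xi> ^ (q - 1) - 1\<bar> * B"
        unfolding E_def using eI by (intro mult_left_mono) auto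
      finally have "b \<xi> ^ (q - 1) * E \<le> B * \<bar>b \<xi> ^ (q - 1) - 1\<bar> + E" by (simp add: algebra_simps)
      then show ?thesis using K by (intro mult_left_mono) auto
    qed
    finally show ?thesis by (simp add: X_def E_def mult.assoc)
  qed
  have bound_b: "\<bar>\<bar>b \<xi> ^ j - 1\<bar>\<bar> \<le> B ^ j" for \<xi> j
    using bj[of \<xi> j] one_le_power[OF B, of j] by linarith
  note ints = integrable_pmf_bounded[OF bound_b, of ?P] integrable_pmf_bounded[OF eI, of ?P]
  have "\<bar>\<integral>\<xi>. \<integral>\<eta>. D \<xi> \<eta> \<partial>?Q \<partial>?P\<bar> \<le> (\<integral>\<xi>. \<bar>\<integral>\<eta>. D \<xi> \<eta> \<partial>?Q\<bar> \<partial>?P)"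
    by (rule integral_abs_bound)
  also have "\<dots> \<le> (\<integral>\<xi>. 2 * \<bar>b \<xi> ^ q - 1\<bar> + B ^ q / sqrt (2 * \<kappa> * real N)
      + K * real q * (B * \<bar>b \<xi> ^ (q - 1) - 1\<bar> + (\<integral>\<eta>. e \<xi> \<eta> \<partial>?Q)) \<partial>?P)"
  proof (rule integral_mono)
    show "integrable ?P (\<lambda>\<xi>. \<bar>\<integral>\<eta>. D \<xi> \<eta> \<partial>?Q\<bar>)"
      by (intro integrable_abs integrable_pmf_bounded[OF DI2])
    show "integrable ?P (\<lambda>\<xi>. 2 * \<bar>b \<xi> ^ q - 1\<bar> + B ^ q / sqrt (2 * \<kappa> * real N)
      + K * real q * (B * \<bar>b \<xi> ^ (q - 1) - 1\<bar> + (\<integral>\<eta>. e \<xi> \<eta> \<partial>?Q)))"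
      using ints by simp
  qed (rule point)
  also have "\<dots> = 2 * (\<integral>\<xi>. \<bar>b \<xi> ^ q - 1\<bar> \<partial>?P) + B ^ q / sqrt (2 * \<kappa> * real N)
      + K * real q * (B * (\<integral>\<xi>. \<bar>b \<xi> ^ (q - 1) - 1\<bar> \<partial>?P) + (\<integral>\<xi>. \<integral>\<eta>. e \<xi> \<eta> \<partial>?Q \<partial>?P))"
    using ints by (simp add: measure_pmf.prob_space[simplified])
  \<comment> \<open>The estimate \<open>Ee\<close> is a mean over \<open>\<xi>\<close> at fixed
    \<open>\<eta>\<close>, hence the exchange.\<close>
  also have "(\<integral>\<xi>. \<integral>\<eta>. e \<xi> \<eta> \<partial>?Q \<partial>?P) = (\<integral>\<eta>. \<integral>\<xi>. e \<xi> \<eta> \<partial>?P \<partial>?Q)"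
    by (rule pmf_expectation_swap[OF eB])
  also have "\<dots> \<le> 4 * exp \<kappa> / (\<bar>tanh c\<bar> * real L)"
    by (intro measure_pmf.integral_le_const integrable_pmf_bounded[OF abs_expectation_pmf_le[OF eB]])
       (rule AE_I2, rule Ee)
  also have "(\<integral>\<xi>. \<bar>b \<xi> ^ q - 1\<bar> \<partial>?P) \<le> real q * B ^ q * (B / sqrt (real N))"
    by (rule conc)
  also have "(\<integral>\<xi>. \<bar>b \<xi> ^ (q - 1) - 1\<bar> \<partial>?P) \<le> real q * B ^ q * (B / sqrt (real N))"
  proof -
    have "real (q - 1) * B ^ (q - 1) \<le> real q * B ^ q"
      using B by (intro mult_mono power_increasing) auto
    then show ?thesis
      using B by (intro order_trans[OF conc] mult_right_mono) auto
  qed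
  finally have "\<bar>\<integral>\<xi>. \<integral>\<eta>. D \<xi> \<eta> \<partial>?Q \<partial>?P\<bar> \<le> 2 * (real q * B ^ q * (B / sqrt (real N))) + B ^ q / sqrt (2 * \<kappa> * real N)
      + K * real q * (B * (real q * B ^ q * (B / sqrt (real N))) + 4 * exp \<kappa> / (\<bar>tanh c\<bar> * real L))"
    using K B by (simp add: mult_left_mono)
  also have "\<dots> = displacement_const \<alpha> q k t L / sqrt (real N) + K * real q * (4 * exp \<kappa> / (\<bar>tanh c\<bar> * real L))"
    unfolding displacement_const_def Let_def \<kappa>_def[symmetric] B_def[symmetric] K_def \<alpha>\<kappa>[symmetric]
    by (simp add: add_divide_distrib distrib_left real_sqrt_mult mult_ac)
  finally show ?thesis
    unfolding D_def V_def K_def t_def \<alpha>\<kappa> by simp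
qed

section \<open>Expansion in the coupling strength\<close>

text \<open>The coefficient of t^k in ((y + t z) / (1 + t x))^n. With x, y, z the Gibbs means of A,
  B and A B, this ratio is the n-th power of the mean of B under the weight tilted by 1 + t
  A.\<close>

definition ratio_coeff :: "nat \<Rightarrow> nat \<Rightarrow> real \<Rightarrow> real \<Rightarrow> real \<Rightarrow> real" where
  "ratio_coeff n k x y z = (\<Sum>c\<le>min n k. real (n choose c) * real ((n + k - c - 1) choose (k - c))
      * (- 1) ^ (k - c) * (x ^ (k - c) * y ^ (n - c) * z ^ c))"

text \<open>The generalized binomial series at exponent -n, with the negative upper index turned
  into an ordinary binomial coefficient.\<close>

lemma negative_binomial_sums:
  fixes u :: real
  assumes "n \<ge> 1" "\<bar>u\<bar> < 1"
  shows "(\<lambda>j. real ((n + j - 1) choose j) * (- 1) ^ j * u ^ j) sums (1 / (1 + u) ^ n)"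
proof -
  have "((- real n) gchoose j) = (- 1) ^ j * real ((n + j - 1) choose j)" for j
  proof -
    have "real j - (- real n) - 1 = real (n + j - 1)" using assms by (simp add: of_nat_diff)
    then show ?thesis by (subst gbinomial_negated_upper) (simp add: binomial_gbinomial)
  qed
  then have "(\<lambda>j. real ((n + j - 1) choose j) * (- 1) ^ j * u ^ j) sums ((1 + u) powr (- real n))"
    using gen_binomial_real[OF assms(2), of "- real n"] by (simp add: mult_ac)
  moreover have "(1 + u) powr (- real n) = 1 / (1 + u) ^ n"
    using assms by (simp add: powr_minus powr_realpow inverse_eq_divide)
  ultimately show ?thesis by simp
qed

text \<open>The product of the binomial expansion of the numerator with the negative binomial series
  of the denominator; \<open>f c\<close> is that series times the numerator term of degree
  \<open>c\<close>, with its index shifted by \<open>c\<close>.\<close>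

lemma ratio_coeff_sums:
  fixes t :: real
  assumes n: "n \<ge> 1" and tx: "\<bar>t * x\<bar> < 1"
  shows "(\<lambda>k. ratio_coeff n k x y z * t ^ k) sums (((y + t * z) / (1 + t * x)) ^ n)"
proof -
  define b where "b = (\<lambda>j. real ((n + j - 1) choose j) * (- 1) ^ j * (t * x) ^ j)"
  define f where "f = (\<lambda>c k. if c \<le> k then real (n choose c) * (t * z) ^ c * y ^ (n - c) * b (k - c) else 0)"
  have b: "b sums (1 / (1 + t * x) ^ n)"
    unfolding b_def by (rule negative_binomial_sums[OF n tx])
  have f: "f c sums (real (n choose c) * (t * z) ^ c * y ^ (n - c) * (1 / (1 + t * x) ^ n))" for c
  proof -
    have "(\<lambda>k. f c (k + c)) sums (real (n choose c) * (t * z) ^ c * y ^ (n - c) * (1 / (1 + t * x) ^ n))"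
      using sums_mult[OF b, of "real (n choose c) * (t * z) ^ c * y ^ (n - c)"] by (simp add: f_def)
    then show ?thesis
      by (subst (asm) sums_iff_shift) (simp add: f_def)
  qed
  have "(\<lambda>k. \<Sum>c\<le>n. f c k) sums (\<Sum>c\<le>n. real (n choose c) * (t * z) ^ c * y ^ (n - c) * (1 / (1 + t * x) ^ n))"
    by (intro sums_sum f)
  also have "(\<Sum>c\<le>n. real (n choose c) * (t * z) ^ c * y ^ (n - c) * (1 / (1 + t * x) ^ n)) = ((y + t * z) / (1 + t * x)) ^ n"
    by (subst add.commute[of y]) (simp add: binomial_ring power_divide sum_divide_distrib)
  also have "(\<lambda>k. \<Sum>c\<le>n. f c k) = (\<lambda>k. ratio_coeff n k x y z * t ^ k)"
  proof
    fix k
    have "(\<Sum>c\<le>n. f c k) = (\<Sum>c\<le>min n k. f c k)"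
      by (intro sum.mono_neutral_right) (auto simp: f_def)
    also have "\<dots> = ratio_coeff n k x y z * t ^ k"
      unfolding ratio_coeff_def sum_distrib_right
    proof (rule sum.cong[OF refl])
      fix c assume "c \<in> {..min n k}"
      then have c: "c \<le> k" "c \<le> n" by auto
      have tk: "t ^ k = t ^ c * t ^ (k - c)" using c by (simp flip: power_add)
      have "n + k - c - 1 = n + (k - c) - 1" using c by simp
      then show "f c k = real (n choose c) * real ((n + k - c - 1) choose (k - c))
      * (- 1) ^ (k - c) * (x ^ (k - c) * y ^ (n - c) * z ^ c) * t ^ k"
        using c unfolding f_def b_def tk by (simp add: power_mult_distrib mult_ac)
    qed
    finally show "(\<Sum>c\<le>n. f c k) = ratio_coeff n k x y z * t ^ k" .
  qed
  finally show ?thesis .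
qed

text \<open>At x = -1 and y = z = 1 the signs cancel and all summands become nonnegative, which
  gives a majorant with generating function ((1 + t) / (1 - t))^n.\<close>

lemma abs_ratio_coeff_le:
  assumes "\<bar>x\<bar> \<le> 1" "\<bar>y\<bar> \<le> 1" "\<bar>z\<bar> \<le> 1"
  shows "\<bar>ratio_coeff n k x y z\<bar> \<le> ratio_coeff n k (- 1) 1 1"
  unfolding ratio_coeff_def
proof (rule order_trans[OF sum_abs sum_mono])
  fix c
  have "\<bar>x ^ (k - c) * y ^ (n - c) * z ^ c\<bar> \<le> 1 * 1 * 1"
    unfolding abs_mult power_abs using assms
    by (intro mult_mono power_le_one) auto
  moreover have "(- 1 :: real) ^ (k - c) * (- 1) ^ (k - c) = 1"
    by (simp flip: power_mult_distrib)
  ultimately show "\<bar>real (n choose c) * real (n + k - c - 1 choose (k - c)) * (- 1) ^ (k - c) * (x ^ (k - c) * y ^ (n - c) * z ^ c)\<bar>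
    \<le> real (n choose c) * real (n + k - c - 1 choose (k - c)) * (- 1) ^ (k - c) * ((- 1) ^ (k - c) * 1 ^ (n - c) * 1 ^ c)"
    using mult_left_mono[of "\<bar>x ^ (k - c) * y ^ (n - c) * z ^ c\<bar>" 1
        "real (n choose c) * real (n + k - c - 1 choose (k - c))"]
    by (simp add: abs_mult power_abs mult.assoc)
qed

text \<open>Averaging over \<open>t\<close> and \<open>- t\<close> removes the odd powers. The
  majorant series at 1 / 2 sums to 3 ^ n, and passing from 1 / 2 to \<open>t\<close> gains a factor
  2 |t| per degree, hence the remainder from degree 2 R on.\<close>

lemma ratio_even_part_expansion:
  fixes t :: real
  assumes n: "n \<ge> 1" and t: "\<bar>t\<bar> \<le> 1 / 2" and xyz: "\<bar>x\<bar> \<le> 1" "\<bar>y\<bar> \<le> 1" "\<bar>z\<bar> \<le> 1"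
  shows "\<bar>(((y + t * z) / (1 + t * x)) ^ n + ((y + (- t) * z) / (1 + (- t) * x)) ^ n) / 2
          - (\<Sum>r<R. ratio_coeff n (2 * r) x y z * t ^ (2 * r))\<bar> \<le> 3 ^ n * (2 * \<bar>t\<bar>) ^ (2 * R)"
proof -
  define e where "e = (\<lambda>k. ratio_coeff n k x y z)"
  define E where "E = (\<lambda>k. ratio_coeff n k (- 1) 1 1 * (1 / 2) ^ k)"
  have eE: "\<bar>e k\<bar> * (1 / 2) ^ k \<le> E k" for k
    unfolding e_def E_def by (intro mult_right_mono abs_ratio_coeff_le xyz) auto
  have E: "E sums (3 ^ n)"
    using ratio_coeff_sums[OF n, of "1 / 2" "- 1" 1 1] by (simp add: E_def)
  have E0: "0 \<le> E k" for k by (rule order_trans[OF _ eE[of k]]) simp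
  have ux: "\<bar>u * x\<bar> < 1" if u: "\<bar>u\<bar> = \<bar>t\<bar>" for u
  proof -
    have "\<bar>u * x\<bar> \<le> \<bar>t\<bar> * 1" unfolding abs_mult u using xyz by (intro mult_left_mono) auto
    then show ?thesis using t by linarith
  qed
  have s: "(\<lambda>k. e k * u ^ k) sums (((y + u * z) / (1 + u * x)) ^ n)" if "\<bar>u\<bar> = \<bar>t\<bar>" for u
    unfolding e_def by (rule ratio_coeff_sums[OF n ux[OF that]])
  define F where "F = (((y + t * z) / (1 + t * x)) ^ n + ((y + (- t) * z) / (1 + (- t) * x)) ^ n) / 2"
  define g where "g = (\<lambda>k. (e k * t ^ k + e k * (- t) ^ k) / 2)"
  have g: "g sums F"
    unfolding g_def F_def by (intro sums_divide sums_add s) auto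
  have head: "(\<Sum>k<2 * R. g k) = (\<Sum>r<R. e (2 * r) * t ^ (2 * r))"
    by (induction R) (simp_all add: g_def)
  have gE: "\<bar>g (k + 2 * R)\<bar> \<le> (2 * \<bar>t\<bar>) ^ (2 * R) * E (k + 2 * R)" for k
  proof -
    have "\<bar>g (k + 2 * R)\<bar> \<le> \<bar>e (k + 2 * R)\<bar> * \<bar>t\<bar> ^ (k + 2 * R)"
    proof -
      have "\<bar>e (k + 2 * R) * t ^ (k + 2 * R) + e (k + 2 * R) * (- t) ^ (k + 2 * R)\<bar>
         \<le> \<bar>e (k + 2 * R)\<bar> * \<bar>t\<bar> ^ (k + 2 * R) + \<bar>e (k + 2 * R)\<bar> * \<bar>t\<bar> ^ (k + 2 * R)"
        by (intro order_trans[OF abs_triangle_ineq] add_mono) (simp_all only: abs_mult power_abs abs_minus_cancel order_refl)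
      then show ?thesis unfolding g_def by simp
    qed
    also have "\<bar>t\<bar> ^ (k + 2 * R) = (2 * \<bar>t\<bar>) ^ k * (2 * \<bar>t\<bar>) ^ (2 * R) * (1 / 2) ^ (k + 2 * R)"
      by (simp only: power_mult_distrib[symmetric] power_add[symmetric]) simp
    also have "\<bar>e (k + 2 * R)\<bar> * \<dots> = (2 * \<bar>t\<bar>) ^ k * ((2 * \<bar>t\<bar>) ^ (2 * R) * (\<bar>e (k + 2 * R)\<bar> * (1 / 2) ^ (k + 2 * R)))"
      by (simp only: mult_ac)
    also have "\<dots> \<le> 1 * ((2 * \<bar>t\<bar>) ^ (2 * R) * E (k + 2 * R))"
      using t eE by (intro mult_mono power_le_one mult_left_mono) auto
    finally show ?thesis by simp
  qed
  have tail: "(\<lambda>k. g (k + 2 * R)) sums (F - (\<Sum>k<2 * R. g k))"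
    using g by (subst sums_iff_shift) simp
  have Etail: "(\<lambda>k. E (k + 2 * R)) sums (3 ^ n - (\<Sum>k<2 * R. E k))"
    using E by (subst sums_iff_shift) simp
  have "\<bar>F - (\<Sum>k<2 * R. g k)\<bar> \<le> (2 * \<bar>t\<bar>) ^ (2 * R) * (3 ^ n - (\<Sum>k<2 * R. E k))"
    using norm_sums_le[OF tail sums_mult[OF Etail]] gE by simp
  also have "\<dots> \<le> (2 * \<bar>t\<bar>) ^ (2 * R) * 3 ^ n"
    using E0 by (intro mult_left_mono) (auto simp: sum_nonneg)
  finally show ?thesis unfolding head F_def e_def by (simp only: mult.commute)
qed

lemma ratio_coeff_0: "ratio_coeff n 0 x y z = y ^ n"
  by (simp add: ratio_coeff_def)

text \<open>The binomial coefficients combine to the factorials of the identities; the prefactor is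
  \<open>fact n / fact (n - 1)\<close>.\<close>

lemma ratio_coeff_fact:
  assumes "n \<ge> 1"
  shows "ratio_coeff n k x y z = real n * (\<Sum>c=0..min k n. (- 1) ^ (k - c) *
     (fact (k + n - c - 1) / (fact c * fact (k - c) * fact (n - c))) * (x ^ (k - c) * y ^ (n - c) * z ^ c))"
  unfolding ratio_coeff_def sum_distrib_left
proof (rule sum.cong)
  fix c assume "c \<in> {0..min k n}"
  then have c: "c \<le> k" "c \<le> n" by auto
  have h1: "real (n choose c) = fact n / (fact c * fact (n - c))"
    using c by (simp add: binomial_fact)
  have h2: "real ((n + k - c - 1) choose (k - c)) = fact (n + k - c - 1) / (fact (k - c) * fact (n - 1))"
  proof -
    have "n + k - c - 1 - (k - c) = n - 1" "k - c \<le> n + k - c - 1" using c assms by auto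
    then show ?thesis by (simp add: binomial_fact)
  qed
  have h3: "(fact n :: real) = real n * fact (n - 1)" using assms by (simp add: fact_reduce)
  show "real (n choose c) * real (n + k - c - 1 choose (k - c)) * (- 1) ^ (k - c) * (x ^ (k - c) * y ^ (n - c) * z ^ c)
     = real n * ((- 1) ^ (k - c) * (fact (k + n - c - 1) / (fact c * fact (k - c) * fact (n - c))) * (x ^ (k - c) * y ^ (n - c) * z ^ c))"
    unfolding h1 h2 h3 by (simp add: add.commute mult_ac)
qed auto

section \<open>Expansion of the displacement and recovery of its coefficients\<close>

text \<open>The coefficient of t^(2 r) in the expansion of \<open>displacement\<close>.\<close>

definition coeff_moment :: "nat \<Rightarrow> nat \<Rightarrow> nat \<Rightarrow> nat \<Rightarrow> nat \<Rightarrow> ((nat \<Rightarrow> real) \<Rightarrow> real) \<Rightarrow> real" where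
  "coeff_moment N m n k r W = site_mean N m (\<lambda>is. site_mean N n (\<lambda>js.
     ratio_coeff k (2 * r) (avg N W (\<lambda>\<sigma>. spin \<sigma> is)) (avg N W (\<lambda>\<sigma>. spin \<sigma> js))
       (avg N W (\<lambda>\<sigma>. spin \<sigma> is * spin \<sigma> js))))"

lemma site_mean_sum: "site_mean N m (\<lambda>is. \<Sum>r\<in>A. f r is) = (\<Sum>r\<in>A. site_mean N m (f r))"
  unfolding site_mean_def by (subst sum.swap) (simp add: sum_divide_distrib)

lemma displacement_expansion:
  assumes N: "N \<ge> 1" and W: "pos_weight N W" and k: "k \<ge> 1" and t: "\<bar>t\<bar> \<le> 1 / 2" and R: "R \<ge> 1"
  shows "\<bar>displacement N m n k t W - (\<Sum>r=1..<R. t ^ (2 * r) * coeff_moment N m n k r W)\<bar>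
       \<le> 3 ^ k * (2 * \<bar>t\<bar>) ^ (2 * R)"
proof -
  define x where "x = (\<lambda>is. avg N W (\<lambda>\<sigma>. spin \<sigma> is))"
  define z where "z = (\<lambda>is js. avg N W (\<lambda>\<sigma>. spin \<sigma> is * spin \<sigma> js))"
  define F where "F = (\<lambda>is js. (((x js + t * z is js) / (1 + t * x is)) ^ k
      + ((x js + (- t) * z is js) / (1 + (- t) * x is)) ^ k) / 2)"
  define S where "S = (\<lambda>is js. \<Sum>r<R. ratio_coeff k (2 * r) (x is) (x js) (z is js) * t ^ (2 * r))"
  have disp: "displacement N m n k t W = site_mean N m (\<lambda>is. site_mean N n (\<lambda>js. F is js - x js ^ k))"
  proof -
    have "tilted_moment N n k t is W = site_mean N n (F is)" for "is"
      by (simp add: tilted_moment_def overlap_moment_def F_def site_mean_add[symmetric] avg_tilt[OF W] x_def z_def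
          site_mean_cmult_right[of _ _ _ "1 / 2", simplified])
    then show ?thesis
      unfolding displacement_def overlap_moment_def site_mean_diff
      by (simp add: site_mean_const[OF N] x_def)
  qed
  have sum_eq: "(\<Sum>r=1..<R. t ^ (2 * r) * coeff_moment N m n k r W)
      = site_mean N m (\<lambda>is. site_mean N n (\<lambda>js. S is js - x js ^ k))"
  proof -
    \<comment> \<open>The constant term of the series is \<open>x js ^ k\<close>, the moment
      subtracted in \<open>displacement\<close>, so the expansion starts at
      \<open>r = 1\<close>.\<close>
    have "S is js - x js ^ k = (\<Sum>r=1..<R. t ^ (2 * r) * ratio_coeff k (2 * r) (x is) (x js) (z is js))" for "is" js
    proof -
      have "{..<R} = insert 0 {1..<R}" using R by auto
      then show ?thesis by (simp add: S_def ratio_coeff_0 mult.commute)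
    qed
    then show ?thesis
      by (simp add: site_mean_sum site_mean_cmult coeff_moment_def x_def z_def)
  qed
  have "\<bar>site_mean N m (\<lambda>is. site_mean N n (\<lambda>js. F is js - S is js))\<bar> \<le> 3 ^ k * (2 * \<bar>t\<bar>) ^ (2 * R)"
  proof (intro abs_site_mean_bound[OF N])
    fix "is" js assume "is": "is \<in> Sites N m" and js: "js \<in> Sites N n"
    have x1: "\<bar>x is\<bar> \<le> 1" "\<bar>x js\<bar> \<le> 1"
      unfolding x_def using "is" js by (auto intro!: abs_avg_spin_le_1[OF W] dest: SitesD)
    have z1: "\<bar>z is js\<bar> \<le> 1"
      unfolding z_def spin_append[symmetric] using "is" js SitesD by (intro abs_avg_spin_le_1[OF W]) auto
    show "\<bar>F is js - S is js\<bar> \<le> 3 ^ k * (2 * \<bar>t\<bar>) ^ (2 * R)"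
      unfolding F_def S_def by (rule ratio_even_part_expansion[OF k t x1 z1])
  qed
  then show ?thesis
    unfolding disp sum_eq site_mean_diff[symmetric] by simp
qed

text \<open>At a fixed small strength u = t p, the expansion divided by u^(2 r) isolates
  \<open>D r\<close>: the displacement and, by induction, the lower coefficients vanish as N grows,
  and the remainder is of order u^2. The strength is chosen before N, so convergence at each single
  p suffices.\<close>

lemma coefficients_tendsto_0:
  fixes d :: "nat \<Rightarrow> real \<Rightarrow> real" and D :: "nat \<Rightarrow> nat \<Rightarrow> real" and t :: "nat \<Rightarrow> real"
  assumes t: "t \<longlonglongrightarrow> 0" "\<And>p. p > m \<Longrightarrow> t p \<noteq> 0"
    and d: "\<And>p. p > m \<Longrightarrow> (\<lambda>N. d N (t p)) \<longlonglongrightarrow> 0"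
    and expansion: "\<And>N R u. N \<ge> 1 \<Longrightarrow> R \<ge> 1 \<Longrightarrow> \<bar>u\<bar> \<le> 1 / 2 \<Longrightarrow>
      \<bar>d N u - (\<Sum>r=1..<R. u ^ (2 * r) * D r N)\<bar> \<le> C * (2 * \<bar>u\<bar>) ^ (2 * R)"
    and r: "r \<ge> 1"
  shows "D r \<longlonglongrightarrow> 0"
  using r
proof (induction r rule: less_induct)
  case (less r)
  have IH: "D j \<longlonglongrightarrow> 0" if "j \<in> {1..<r}" for j using less.IH[of j] that by auto
  define K where "K = \<bar>C\<bar> * 2 ^ (2 * Suc r)"
  have bound: "\<bar>D r N\<bar> \<le> (\<bar>d N u\<bar> + \<bar>\<Sum>j=1..<r. u ^ (2 * j) * D j N\<bar>) / u ^ (2 * r) + K * u\<^sup>2"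
    if N: "N \<ge> 1" and u: "\<bar>u\<bar> \<le> 1 / 2" "u \<noteq> 0" for N u
  proof -
    have up: "0 < u ^ (2 * r)" using u by (simp add: power_mult)
    have split: "{1..<Suc r} = insert r {1..<r}" using less.prems by auto
    have "C * (2 * \<bar>u\<bar>) ^ (2 * Suc r) \<le> \<bar>C\<bar> * (2 * \<bar>u\<bar>) ^ (2 * Suc r)"
      by (intro mult_right_mono) auto
    also have "\<dots> = K * u\<^sup>2 * u ^ (2 * r)"
      unfolding K_def power_mult_distrib by (simp add: power_mult power2_eq_square)
    finally have "u ^ (2 * r) * \<bar>D r N\<bar> \<le> \<bar>d N u\<bar> + \<bar>\<Sum>j=1..<r. u ^ (2 * j) * D j N\<bar> + K * u\<^sup>2 * u ^ (2 * r)"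
      using expansion[OF N, of "Suc r" u] u up unfolding split
      by (simp add: abs_mult[of "u ^ (2 * r)", symmetric] abs_le_iff) (simp add: abs_if split: if_splits)
    then have "\<bar>D r N\<bar> \<le> (\<bar>d N u\<bar> + \<bar>\<Sum>j=1..<r. u ^ (2 * j) * D j N\<bar> + K * u\<^sup>2 * u ^ (2 * r)) / u ^ (2 * r)"
      using up by (simp add: field_simps)
    then show ?thesis using up u by (simp add: add_divide_distrib)
  qed
  show "D r \<longlonglongrightarrow> 0"
  proof (rule LIMSEQ_I)
    fix \<epsilon> :: real assume \<epsilon>: "\<epsilon> > 0"
    have "(\<lambda>p. K * (t p)\<^sup>2) \<longlonglongrightarrow> K * 0\<^sup>2" by (intro tendsto_intros t)
    then have "\<forall>\<^sub>F p in sequentially. K * (t p)\<^sup>2 < \<epsilon> / 2"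
      using \<epsilon> by (intro order_tendstoD) auto
    moreover have "\<forall>\<^sub>F p in sequentially. \<bar>t p\<bar> < 1 / 2"
      using tendsto_rabs[OF t(1)] by (intro order_tendstoD) auto
    ultimately have "\<forall>\<^sub>F p in sequentially. K * (t p)\<^sup>2 < \<epsilon> / 2 \<and> \<bar>t p\<bar> < 1 / 2 \<and> p > m"
      using eventually_gt_at_top[of m] by eventually_elim auto
    then obtain p where p: "K * (t p)\<^sup>2 < \<epsilon> / 2" "\<bar>t p\<bar> < 1 / 2" "p > m"
      using eventually_happens'[OF sequentially_bot] by blast
    have tp: "t p \<noteq> 0" by (rule t(2)[OF p(3)])
    have "(\<lambda>N. (\<bar>d N (t p)\<bar> + \<bar>\<Sum>j=1..<r. t p ^ (2 * j) * D j N\<bar>) / t p ^ (2 * r))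
        \<longlonglongrightarrow> (\<bar>0\<bar> + \<bar>\<Sum>j=1..<r. t p ^ (2 * j) * 0\<bar>) / t p ^ (2 * r)"
      using tp by (intro tendsto_intros d p IH) auto
    then have "\<forall>\<^sub>F N in sequentially. (\<bar>d N (t p)\<bar> + \<bar>\<Sum>j=1..<r. t p ^ (2 * j) * D j N\<bar>) / t p ^ (2 * r) < \<epsilon> / 2"
      using \<epsilon> by (intro order_tendstoD) auto
    then have "\<forall>\<^sub>F N in sequentially. \<bar>D r N\<bar> < \<epsilon>"
      using eventually_ge_at_top[of 1]
    proof eventually_elim
      case (elim N)
      then show ?case using bound[of N "t p"] p tp by linarith
    qed
    then show "\<exists>no. \<forall>N\<ge>no. norm (D r N - 0) < \<epsilon>"
      by (simp add: eventually_sequentially)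
  qed
qed

section \<open>Replicas\<close>

text \<open>The power of a site average is an average over independent sites, and the product over
  replicas commutes with the product over sites.\<close>

lemma overlap_power_eq_site_mean:
  "overlap N R s ^ m = site_mean N m (\<lambda>is. \<Prod>l\<in>R. spin (s l) is)"
proof -
  have "prod_list (map (\<lambda>x. \<Prod>l\<in>R. s l x) is) = (\<Prod>l\<in>R. spin (s l) is)" for "is"
    by (induction "is") (simp_all add: prod.distrib)
  then show ?thesis
    using site_mean_prod_list[of N m "\<lambda>x. \<Prod>l\<in>R. s l x"] by (simp add: overlap_def)
qed

lemma sum_replicas_eq_prod_avg:
  fixes H :: "(nat \<Rightarrow> real) \<Rightarrow> real" and k :: nat
  assumes W: "W = (\<lambda>\<sigma>. exp (- \<beta> * H \<sigma>))"
  shows "(\<Sum>s\<in>{1..k} \<rightarrow>\<^sub>E configs N. (\<Prod>l=1..k. gibbs N \<beta> H (s l)) * (\<Prod>l=1..k. h l (s l)))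
       = (\<Prod>l=1..k. avg N W (h l))"
proof -
  have "avg N W (h l) = (\<Sum>\<sigma>\<in>configs N. gibbs N \<beta> H \<sigma> * h l \<sigma>)" for l
    by (simp add: avg_def gibbs_def W sum_divide_distrib)
  then have "(\<Prod>l=1..k. avg N W (h l)) = (\<Prod>l=1..k. \<Sum>\<sigma>\<in>configs N. gibbs N \<beta> H \<sigma> * h l \<sigma>)"
    by simp
  also have "\<dots> = (\<Sum>s\<in>{1..k} \<rightarrow>\<^sub>E configs N. \<Prod>l=1..k. gibbs N \<beta> H (s l) * h l (s l))"
    by (rule prod_sum_PiE) simp_all
  finally show ?thesis by (simp add: prod.distrib)
qed

text \<open>By independence of the replicas the average factorizes. The first \<open>c\<close>
  replicas carry both spin products, the next \<open>u - c\<close> only that of \<open>is\<close>,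
  and the last \<open>v - c\<close> only that of \<open>js\<close>.\<close>

lemma replica_avg_shared_overlap:
  fixes H :: "(nat \<Rightarrow> real) \<Rightarrow> real" and \<beta> :: real
  assumes c: "c \<le> u" "c \<le> v"
  defines "W \<equiv> (\<lambda>\<sigma>. exp (- \<beta> * H \<sigma>))"
  shows "replica_avg N \<beta> H (u + v - c)
      (\<lambda>s. overlap N {1..u} s ^ m * overlap N ({1..c} \<union> {u + 1..u + v - c}) s ^ n)
    = site_mean N m (\<lambda>is. site_mean N n (\<lambda>js.
        avg N W (\<lambda>\<sigma>. spin \<sigma> is) ^ (u - c) * avg N W (\<lambda>\<sigma>. spin \<sigma> js) ^ (v - c)
        * avg N W (\<lambda>\<sigma>. spin \<sigma> is * spin \<sigma> js) ^ c))"
proof -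
  define R where "R = {1..c} \<union> {u + 1..u + v - c}"
  define k where "k = u + v - c"
  define h where "h = (\<lambda>is js l \<sigma>. (if l \<in> {1..u} then spin \<sigma> is else 1) * (if l \<in> R then spin \<sigma> js else 1))"
  have sub: "{1..u} \<subseteq> {1..k}" "R \<subseteq> {1..k}" using c by (auto simp: k_def R_def)
  have prod_h: "(\<Prod>l\<in>{1..u}. spin (s l) is) * (\<Prod>l\<in>R. spin (s l) js) = (\<Prod>l=1..k. h is js l (s l))" for s "is" js
  proof -
    have "(\<Prod>l\<in>{1..u}. spin (s l) is) = (\<Prod>l=1..k. if l \<in> {1..u} then spin (s l) is else 1)"
      using sub(1) by (intro prod.mono_neutral_cong_left) auto
    moreover have "(\<Prod>l\<in>R. spin (s l) js) = (\<Prod>l=1..k. if l \<in> R then spin (s l) js else 1)"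
      using sub(2) by (intro prod.mono_neutral_cong_left) auto
    ultimately show ?thesis by (simp add: h_def prod.distrib)
  qed
  have avg_h: "(\<Prod>l=1..k. avg N W (h is js l)) = avg N W (\<lambda>\<sigma>. spin \<sigma> is) ^ (u - c)
        * avg N W (\<lambda>\<sigma>. spin \<sigma> js) ^ (v - c) * avg N W (\<lambda>\<sigma>. spin \<sigma> is * spin \<sigma> js) ^ c" for "is" js
  proof -
    have split: "{1..k} = {1..c} \<union> ({c + 1..u} \<union> {u + 1..k})" using c by (auto simp: k_def)
    have "(\<Prod>l=1..k. avg N W (h is js l)) = (\<Prod>l=1..c. avg N W (h is js l))
        * ((\<Prod>l=c + 1..u. avg N W (h is js l)) * (\<Prod>l=u + 1..k. avg N W (h is js l)))"
      unfolding split using c by (subst prod.union_disjoint; (subst prod.union_disjoint)?) auto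
    also have "(\<Prod>l=1..c. avg N W (h is js l)) = (\<Prod>l=1..c. avg N W (\<lambda>\<sigma>. spin \<sigma> is * spin \<sigma> js))"
      using c by (intro prod.cong refl) (auto simp: h_def R_def)
    also have "(\<Prod>l=c + 1..u. avg N W (h is js l)) = (\<Prod>l=c + 1..u. avg N W (\<lambda>\<sigma>. spin \<sigma> is))"
      using c by (intro prod.cong refl) (auto simp: h_def R_def)
    also have "(\<Prod>l=u + 1..k. avg N W (h is js l)) = (\<Prod>l=u + 1..k. avg N W (\<lambda>\<sigma>. spin \<sigma> js))"
      using c by (intro prod.cong refl) (auto simp: h_def R_def k_def)
    finally show ?thesis using c by (simp add: k_def mult_ac)
  qed
  have "replica_avg N \<beta> H k (\<lambda>s. overlap N {1..u} s ^ m * overlap N R s ^ n)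
     = (\<Sum>s\<in>{1..k} \<rightarrow>\<^sub>E configs N. site_mean N m (\<lambda>is. site_mean N n (\<lambda>js.
         (\<Prod>l=1..k. gibbs N \<beta> H (s l)) * (\<Prod>l=1..k. h is js l (s l)))))"
    unfolding replica_avg_def overlap_power_eq_site_mean prod_h[symmetric]
    by (simp only: site_mean_cmult site_mean_cmult_right)
  also have "\<dots> = site_mean N m (\<lambda>is. site_mean N n (\<lambda>js. \<Prod>l=1..k. avg N W (h is js l)))"
    unfolding site_mean_sum[symmetric]
    by (simp only: sum_replicas_eq_prod_avg[OF meta_eq_to_obj_eq[OF W_def]])
  finally show ?thesis
    unfolding avg_h unfolding k_def R_def .
qed

section \<open>Random series\<close>

text \<open>Partial sums frozen once they leave the interval of radius \<open>\<epsilon>\<close>.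
  Whether \<open>y k\<close> is added depends on earlier entries only.\<close>

fun stopped_sum :: "real \<Rightarrow> (nat \<Rightarrow> real) \<Rightarrow> nat \<Rightarrow> real" where
  "stopped_sum \<epsilon> y 0 = 0"
| "stopped_sum \<epsilon> y (Suc k) = stopped_sum \<epsilon> y k + (if \<bar>stopped_sum \<epsilon> y k\<bar> < \<epsilon> then y k else 0)"

text \<open>A stopped sum never moves again, so being inside at time \<open>n\<close> excludes any
  earlier stop.\<close>

lemma stopped_sum_unstopped:
  assumes "\<bar>stopped_sum \<epsilon> y n\<bar> < \<epsilon>" "k \<le> n"
  shows "stopped_sum \<epsilon> y k = (\<Sum>j<k. y j)"
proof -
  have not_stopped: "\<bar>stopped_sum \<epsilon> y k\<bar> < \<epsilon>" if "k \<le> n" for k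
    using that
  proof (induction rule: inc_induct)
    case (step k)
    then show ?case by (auto split: if_splits)
  qed (rule assms(1))
  show ?thesis using assms(2)
  proof (induction k)
    case (Suc k)
    then show ?case using not_stopped[of k] by simp
  qed simp
qed

lemma stopped_sum_cong: "(\<And>j. j < k \<Longrightarrow> y j = y' j) \<Longrightarrow> stopped_sum \<epsilon> y k = stopped_sum \<epsilon> y' k"
  by (induction k) auto

context prob_space begin

text \<open>If some partial sum reaches \<open>\<epsilon>\<close>, the stopped sum is still at least
  \<open>\<epsilon>\<close> at time \<open>n\<close>, so Chebyshev's inequality for the stopped sum
  is enough. Its second moment is at most the sum of the variances, since the cross terms with the
  independent centred increments vanish.\<close>

lemma kolmogorov_maximal_inequality:
  fixes Y :: "nat \<Rightarrow> 'a \<Rightarrow> real"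
  assumes indep: "indep_vars (\<lambda>_. borel) Y UNIV"
    and int: "\<And>n. integrable M (Y n)" "\<And>n. integrable M (\<lambda>w. (Y n w)\<^sup>2)"
    and mean: "\<And>n. expectation (Y n) = 0" and \<epsilon>: "\<epsilon> > 0"
  shows "prob {w \<in> space M. \<exists>k\<le>n. \<epsilon> \<le> \<bar>\<Sum>j<k. Y j w\<bar>} \<le> (\<Sum>j<n. expectation (\<lambda>w. (Y j w)\<^sup>2)) / \<epsilon>\<^sup>2"
proof -
  have [measurable]: "Y j \<in> borel_measurable M" for j
    using int(1) by (rule borel_measurable_integrable)
  define Z where "Z = (\<lambda>k w. stopped_sum \<epsilon> (\<lambda>j. Y j w) k)"
  have Z_meas [measurable]: "Z k \<in> borel_measurable M" for k
    unfolding Z_def by (induction k) simp_all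
  have second_moment: "integrable M (\<lambda>w. (Z k w)\<^sup>2) \<and> expectation (\<lambda>w. (Z k w)\<^sup>2) \<le> (\<Sum>j<k. expectation (\<lambda>w. (Y j w)\<^sup>2))" for k
  proof (induction k)
    case 0
    show ?case by (simp add: Z_def)
  next
    case (Suc k)
    define u where "u = (\<lambda>w. if \<bar>Z k w\<bar> < \<epsilon> then Z k w else 0)"
    define v where "v = (\<lambda>w. if \<bar>Z k w\<bar> < \<epsilon> then (Y k w)\<^sup>2 else 0)"
    have [measurable]: "u \<in> borel_measurable M" "v \<in> borel_measurable M" unfolding u_def v_def by measurable
    have u_bound: "\<bar>u w\<bar> \<le> \<epsilon>" for w using \<epsilon> by (simp add: u_def)
    have int_u: "integrable M u"
      using u_bound by (intro integrable_const_bound[where B = \<epsilon>]) auto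
    have int_v: "integrable M v"
      by (rule Bochner_Integration.integrable_bound[OF int(2)[of k]]) (auto simp: v_def)
    \<comment> \<open>The stopping rule at step \<open>k\<close> reads only the first
      \<open>k\<close> variables, so \<open>u\<close> is a function of these.\<close>
    have "indep_var borel u borel (Y k)"
    proof -
      define h where "h = (\<lambda>y. let z = stopped_sum \<epsilon> y k in if \<bar>z\<bar> < \<epsilon> then z else (0 :: real))"
      have stop_meas: "(\<lambda>y. stopped_sum \<epsilon> y i) \<in> borel_measurable (Pi\<^sub>M {..<k} (\<lambda>_. borel))" if "i \<le> k" for i
        using that
      proof (induction i)
        case (Suc i)
        then have [measurable]: "(\<lambda>y. stopped_sum \<epsilon> y i) \<in> borel_measurable (Pi\<^sub>M {..<k} (\<lambda>_. borel))"
          "(\<lambda>y. y i) \<in> borel_measurable (Pi\<^sub>M {..<k} (\<lambda>_. borel))"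
          by (auto intro: measurable_component_singleton)
        show ?case by simp
      qed simp
      have h_meas: "h \<in> borel_measurable (Pi\<^sub>M {..<k} (\<lambda>_. borel))"
        using stop_meas[OF order_refl] unfolding h_def Let_def by measurable
      have "indep_var (Pi\<^sub>M {..<k} (\<lambda>_. borel)) (\<lambda>w. \<lambda>j\<in>{..<k}. Y j w) (Pi\<^sub>M {k} (\<lambda>_. borel)) (\<lambda>w. \<lambda>j\<in>{k}. Y j w)"
        by (rule indep_var_restrict[OF indep]) auto
      from indep_var_compose[OF this h_meas, of "\<lambda>y. y k" borel]
      have "indep_var borel (h \<circ> (\<lambda>w. \<lambda>j\<in>{..<k}. Y j w)) borel ((\<lambda>y. y k) \<circ> (\<lambda>w. \<lambda>j\<in>{k}. Y j w))"
        by simp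
      moreover have "h \<circ> (\<lambda>w. \<lambda>j\<in>{..<k}. Y j w) = u"
      proof
        fix w
        have "stopped_sum \<epsilon> (\<lambda>j\<in>{..<k}. Y j w) k = Z k w"
          unfolding Z_def by (rule stopped_sum_cong) simp
        then show "(h \<circ> (\<lambda>w. \<lambda>j\<in>{..<k}. Y j w)) w = u w" by (simp add: h_def u_def)
      qed
      moreover have "(\<lambda>y. y k) \<circ> (\<lambda>w. \<lambda>j\<in>{k}. Y j w) = Y k" by (simp add: fun_eq_iff)
      ultimately show ?thesis by simp
    qed
    then have uY: "expectation (\<lambda>w. u w * Y k w) = 0" "integrable M (\<lambda>w. u w * Y k w)"
      using indep_var_lebesgue_integral[of u "Y k"] indep_var_integrable[of u "Y k"] int_u int(1)[of k] mean
      by auto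
    have eq: "(Z (Suc k) w)\<^sup>2 = (Z k w)\<^sup>2 + 2 * (u w * Y k w) + v w" for w
      by (simp add: Z_def u_def v_def power2_eq_square algebra_simps)
    have "expectation v \<le> expectation (\<lambda>w. (Y k w)\<^sup>2)"
      using int_v int(2) by (intro integral_mono) (auto simp: v_def)
    then show ?case using Suc.IH uY int_v unfolding eq by simp
  qed
  have "prob {w \<in> space M. \<exists>k\<le>n. \<epsilon> \<le> \<bar>\<Sum>j<k. Y j w\<bar>} \<le> prob {w \<in> space M. \<epsilon>\<^sup>2 \<le> (Z n w)\<^sup>2}"
  proof (rule finite_measure_mono)
    show "{w \<in> space M. \<exists>k\<le>n. \<epsilon> \<le> \<bar>\<Sum>j<k. Y j w\<bar>} \<subseteq> {w \<in> space M. \<epsilon>\<^sup>2 \<le> (Z n w)\<^sup>2}"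
    proof safe
      fix w k assume k: "k \<le> n" "\<epsilon> \<le> \<bar>\<Sum>j<k. Y j w\<bar>"
      have "\<not> \<bar>Z n w\<bar> < \<epsilon>"
      proof
        assume lt: "\<bar>Z n w\<bar> < \<epsilon>"
        have "stopped_sum \<epsilon> (\<lambda>j. Y j w) k = (\<Sum>j<k. Y j w)"
          using stopped_sum_unstopped[OF _ k(1)] lt unfolding Z_def by blast
        moreover have "\<bar>stopped_sum \<epsilon> (\<lambda>j. Y j w) k\<bar> < \<epsilon>"
          using k(1) lt unfolding Z_def
        proof (induction rule: inc_induct)
          case (step k)
          then show ?case by (auto split: if_splits)
        qed
        ultimately show False using k(2) by simp
      qed
      then show "\<epsilon>\<^sup>2 \<le> (Z n w)\<^sup>2" using \<epsilon> by (simp add: abs_le_square_iff[symmetric])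
    qed
  qed measurable
  also have "\<dots> \<le> expectation (\<lambda>w. (Z n w)\<^sup>2) / \<epsilon>\<^sup>2"
    using second_moment \<epsilon> by (intro integral_Markov_inequality_measure[where A = "{}"]) auto
  also have "\<dots> \<le> (\<Sum>j<n. expectation (\<lambda>w. (Y j w)\<^sup>2)) / \<epsilon>\<^sup>2"
    using second_moment by (intro divide_right_mono) auto
  finally show ?thesis .
qed

text \<open>The maximal inequality for the tail from \<open>m\<close> on bounds the probability that
  one of its partial sums reaches \<open>\<epsilon>\<close> by a remainder of the variance series.
  Hence almost surely, for every \<open>\<epsilon>\<close>, some tail has all partial sums below it,
  which is the Cauchy property.\<close>

theorem AE_summable_indep:
  fixes Y :: "nat \<Rightarrow> 'a \<Rightarrow> real"
  assumes indep: "indep_vars (\<lambda>_. borel) Y UNIV"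
    and int: "\<And>n. integrable M (Y n)" "\<And>n. integrable M (\<lambda>w. (Y n w)\<^sup>2)"
    and mean: "\<And>n. expectation (Y n) = 0" and var: "summable (\<lambda>n. expectation (\<lambda>w. (Y n w)\<^sup>2))"
  shows "AE w in M. summable (\<lambda>n. Y n w)"
proof -
  have [measurable]: "Y j \<in> borel_measurable M" for j
    using int(1) by (rule borel_measurable_integrable)
  define V where "V = (\<lambda>n. expectation (\<lambda>w. (Y n w)\<^sup>2))"
  define T where "T = (\<lambda>m. \<Sum>j. V (j + m))"
  have V0: "0 \<le> V n" for n by (simp add: V_def)
  have T: "T \<longlonglongrightarrow> 0" unfolding T_def using var by (intro suminf_exist_split2) (simp add: V_def)
  define Bad where "Bad = (\<lambda>\<epsilon> m n. {w \<in> space M. \<exists>k\<le>n. \<epsilon> \<le> \<bar>\<Sum>j<k. Y (j + m) w\<bar>})"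
  have Bad_meas [measurable]: "Bad \<epsilon> m n \<in> events" for \<epsilon> m n unfolding Bad_def by measurable
  have bad: "prob (\<Union>n. Bad \<epsilon> m n) \<le> T m / \<epsilon>\<^sup>2" if \<epsilon>: "\<epsilon> > 0" for \<epsilon> m
  proof -
    have shifted: "indep_vars (\<lambda>_. borel) (\<lambda>j. Y (j + m)) UNIV"
      using indep_vars_compose2[OF indep_vars_restrict[OF indep, of UNIV "\<lambda>j. {j + m}"],
          of "\<lambda>j y. y (j + m)" "\<lambda>_. borel"]
      by (simp add: disjoint_family_on_def)
    have "prob (Bad \<epsilon> m n) \<le> T m / \<epsilon>\<^sup>2" for n
    proof -
      have "prob (Bad \<epsilon> m n) \<le> (\<Sum>j<n. V (j + m)) / \<epsilon>\<^sup>2"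
        unfolding Bad_def V_def
        by (rule kolmogorov_maximal_inequality[OF shifted]) (use int mean \<epsilon> in auto)
      also have "\<dots> \<le> T m / \<epsilon>\<^sup>2"
        unfolding T_def using V0 var
        by (intro divide_right_mono sum_le_suminf summable_ignore_initial_segment) (auto simp: V_def)
      finally show ?thesis .
    qed
    moreover have "(\<lambda>n. prob (Bad \<epsilon> m n)) \<longlonglongrightarrow> prob (\<Union>n. Bad \<epsilon> m n)"
      by (intro finite_Lim_measure_incseq) (auto simp: incseq_def Bad_def intro: order_trans)
    ultimately show ?thesis by (intro LIMSEQ_le_const2) auto
  qed
  have null: "(\<Inter>m. \<Union>n. Bad \<epsilon> m n) \<in> null_sets M" if \<epsilon>: "\<epsilon> > 0" for \<epsilon>
  proof -
    have "prob (\<Inter>m. \<Union>n. Bad \<epsilon> m n) \<le> 0 / \<epsilon>\<^sup>2"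
    proof (rule LIMSEQ_le_const)
      show "(\<lambda>m. T m / \<epsilon>\<^sup>2) \<longlonglongrightarrow> 0 / \<epsilon>\<^sup>2" using \<epsilon> by (intro tendsto_divide T tendsto_const) simp
      have "prob (\<Inter>m. \<Union>n. Bad \<epsilon> m n) \<le> T m / \<epsilon>\<^sup>2" for m
        by (rule order_trans[OF finite_measure_mono bad[OF \<epsilon>, of m]]) auto
      then show "\<exists>K. \<forall>m\<ge>K. prob (\<Inter>m. \<Union>n. Bad \<epsilon> m n) \<le> T m / \<epsilon>\<^sup>2" by blast
    qed
    then have "prob (\<Inter>m. \<Union>n. Bad \<epsilon> m n) = 0" by (intro antisym) auto
    then show ?thesis by (intro null_setsI) (auto simp: emeasure_eq_measure)
  qed
  have "AE w in M. \<forall>q. w \<notin> (\<Inter>m. \<Union>n. Bad (inverse (real (Suc q))) m n)"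
    unfolding AE_all_countable by (intro allI AE_not_in null) simp
  with AE_space show ?thesis
  proof eventually_elim
    case (elim w)
    show "summable (\<lambda>n. Y n w)"
      unfolding summable_Cauchy
    proof (intro allI impI)
      fix e :: real assume "e > 0"
      \<comment> \<open>A block from \<open>m'\<close> to \<open>n\<close> is the difference of two
        blocks that start at \<open>m\<close>, hence half of \<open>e\<close> for each.\<close>
      then obtain q where q: "inverse (real (Suc q)) < e / 2"
        using reals_Archimedean[of "e / 2"] by auto
      obtain m where m: "\<And>n. w \<notin> Bad (inverse (real (Suc q))) m n" using elim(2) by blast
      have small: "\<bar>\<Sum>j<k. Y (j + m) w\<bar> < e / 2" for k
        using m[of k] elim(1) q unfolding Bad_def by (force simp: not_le)
      have shift: "(\<Sum>j<k. Y (j + m) w) = (\<Sum>j = m..<m + k. Y j w)" for k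
        using sum.shift_bounds_nat_ivl[of "\<lambda>j. Y j w" 0 m k] by (simp add: atLeast0LessThan add.commute)
      show "\<exists>K. \<forall>m'\<ge>K. \<forall>n. norm (\<Sum>j = m'..<n. Y j w) < e"
      proof (intro exI[of _ m] allI impI)
        fix m' n assume m': "m \<le> m'"
        show "norm (\<Sum>j = m'..<n. Y j w) < e"
        proof (cases "m' \<le> n")
          case True
          have "(\<Sum>j = m..<m'. Y j w) + (\<Sum>j = m'..<n. Y j w) = (\<Sum>j = m..<n. Y j w)"
            using True m' by (intro sum.atLeastLessThan_concat)
          then have "(\<Sum>j = m'..<n. Y j w) = (\<Sum>j<n - m. Y (j + m) w) - (\<Sum>j<m' - m. Y (j + m) w)"
            unfolding shift using True m' by simp
          then show ?thesis using small[of "n - m"] small[of "m' - m"]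
            unfolding real_norm_def by linarith
        qed (use \<open>e > 0\<close> in simp)
      qed
    qed
  qed
qed

end

section \<open>Independence and resampling\<close>

instance multiset :: (countable) countable
proof (rule countable_classI[of "\<lambda>m. to_nat (SOME xs. mset xs = m)"])
  fix m m' :: "'a multiset"
  assume "to_nat (SOME xs. mset xs = m) = to_nat (SOME xs. mset xs = m')"
  then have "(SOME xs. mset xs = m) = (SOME xs. mset xs = m')" by simp
  then show "m = m'" by (metis (mono_tags) ex_mset someI_ex)
qed

lemma bind_pmf_of_set_bij:
  assumes A: "finite A" "A \<noteq> {}" and B: "finite B" "B \<noteq> {}"
    and bij: "bij_betw (\<lambda>(x, y). f x y) (A \<times> B) C"
  shows "bind_pmf (pmf_of_set A) (\<lambda>x. map_pmf (f x) (pmf_of_set B)) = pmf_of_set C"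
proof -
  have pair: "pair_pmf (pmf_of_set A) (pmf_of_set B) = pmf_of_set (A \<times> B)"
    using A B by (intro pmf_eqI)
      (auto simp: pmf_pair indicator_def card_cartesian_product pmf_of_set[OF A(2,1)] pmf_of_set[OF B(2,1)])
  have "bind_pmf (pmf_of_set A) (\<lambda>x. map_pmf (f x) (pmf_of_set B))
      = map_pmf (\<lambda>(x, y). f x y) (pair_pmf (pmf_of_set A) (pmf_of_set B))"
    by (simp add: pair_pmf_def map_bind_pmf map_pmf_def bind_return_pmf bind_assoc_pmf)
  also have "\<dots> = pmf_of_set C"
    unfolding pair using A B by (intro map_pmf_of_set_bij_betw bij) auto
  finally show ?thesis .
qed

lemma pmf_of_set_Sites_Suc:
  assumes "N \<ge> 1"
  shows "bind_pmf (pmf_of_set {1..N}) (\<lambda>x. map_pmf (\<lambda>is. is @ [x]) (pmf_of_set (Sites N m))) = pmf_of_set (Sites N (Suc m))"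
proof (rule bind_pmf_of_set_bij)
  show "bij_betw (\<lambda>(x, is). is @ [x]) ({1..N} \<times> Sites N m) (Sites N (Suc m))"
  proof (rule bij_betwI[where g = "\<lambda>is. (last is, butlast is)"])
    show "(\<lambda>is. (last is, butlast is)) \<in> Sites N (Suc m) \<rightarrow> {1..N} \<times> Sites N m"
      by (force simp: Sites_def dest: in_set_butlastD intro: last_in_set)
    fix "is" assume "is \<in> Sites N (Suc m)"
    then have "is \<noteq> []" by (auto simp: Sites_def)
    then show "(case (last is, butlast is) of (x, is) \<Rightarrow> is @ [x]) = is" by simp
  qed (auto simp: Sites_def)
  show "Sites N m \<noteq> {}" using card_Sites[of N m] assms by (auto simp del: card_Sites)
qed (use assms in auto)

lemma set_pmf_iid_mset: "\<xi> \<in> set_pmf (iid_mset k q) \<Longrightarrow> set_mset \<xi> \<subseteq> set_pmf q"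
  by (induction k arbitrary: \<xi>) (simp, fastforce)

lemma set_pmf_poisson_mset: "\<xi> \<in> set_pmf (poisson_mset \<mu> q) \<Longrightarrow> set_mset \<xi> \<subseteq> set_pmf q"
  using set_pmf_iid_mset by (fastforce simp: poisson_mset_def)

lemma set_pmf_term_law:
  assumes "N \<ge> 1"
  shows "set_pmf (term_law N p) = {-1, 1} \<times> Sites N p"
proof -
  have "Sites N p \<noteq> {}" using card_Sites[of N p] assms by (auto simp del: card_Sites)
  then show ?thesis unfolding term_law_def by (subst set_pmf_of_set) auto
qed

text \<open>Symmetric couplings make the mean vanish, and each term has square at most one. The
  variance bound is uniform in \<open>p\<close>, which is why square-summable coefficients suffice
  for convergence.\<close>

lemma energy_moments:
  fixes \<mu> :: real and p :: nat
  assumes N: "N \<ge> 1" and \<mu>: "\<mu> \<ge> 0" and \<sigma>: "\<sigma> \<in> configs N"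
  defines "Q \<equiv> poisson_mset \<mu> (term_law N p)"
  shows "integrable Q (\<lambda>\<xi>. energy \<xi> \<sigma>)" "(\<integral>\<xi>. energy \<xi> \<sigma> \<partial>Q) = 0"
    "integrable Q (\<lambda>\<xi>. (energy \<xi> \<sigma>)\<^sup>2)" "(\<integral>\<xi>. (energy \<xi> \<sigma>)\<^sup>2 \<partial>Q) \<le> \<mu>"
proof -
  \<comment> \<open>Cutting off outside the support gives the uniform bound required by the moment
    formulas and changes the energy only on a null set.\<close>
  define \<rho> where "\<rho> = (\<lambda>x. if x \<in> {-1, 1} \<times> Sites N p then real_of_int (fst x) * spin \<sigma> (snd x) else 0)"
  have \<rho>1: "\<bar>\<rho> x\<bar> \<le> 1" for x
    using abs_spin_le_1[OF \<sigma>, of "snd x"] by (auto simp: \<rho>_def Sites_def)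
  have eq: "AE \<xi> in Q. energy \<xi> \<sigma> = (\<Sum>x\<in>#\<xi>. \<rho> x)"
    unfolding Q_def AE_measure_pmf_iff
  proof
    fix \<xi> assume "\<xi> \<in> set_pmf (poisson_mset \<mu> (term_law N p))"
    then have "set_mset \<xi> \<subseteq> {-1, 1} \<times> Sites N p"
      using set_pmf_poisson_mset set_pmf_term_law[OF N] by blast
    then show "energy \<xi> \<sigma> = (\<Sum>x\<in>#\<xi>. \<rho> x)"
      unfolding energy_def \<rho>_def by (intro arg_cong[where f = sum_mset] image_mset_cong) auto
  qed
  have mean: "(\<integral>x. \<rho> x \<partial>term_law N p) = 0"
    unfolding expectation_term_law[OF N] by (simp add: \<rho>_def site_mean_def cong: sum.cong)
  have sq: "(\<integral>x. (\<rho> x)\<^sup>2 \<partial>term_law N p) \<le> 1"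
    using \<rho>1 by (intro measure_pmf.integral_le_const measure_pmf.integrable_const_bound[where B = 1])
      (auto simp: abs_square_le_1)
  note mom = poisson_mset_linear_moments[OF \<mu>, where \<rho> = \<rho> and q = "term_law N p", OF \<rho>1, folded Q_def]
  have sq_eq: "AE \<xi> in Q. (energy \<xi> \<sigma>)\<^sup>2 = (\<Sum>x\<in>#\<xi>. \<rho> x)\<^sup>2" using eq by eventually_elim simp
  show "integrable Q (\<lambda>\<xi>. energy \<xi> \<sigma>)"
    using mom(1) eq by (subst integrable_cong_AE[where g = "\<lambda>\<xi>. \<Sum>x\<in>#\<xi>. \<rho> x"]) (auto simp: Q_def)
  show "(\<integral>\<xi>. energy \<xi> \<sigma> \<partial>Q) = 0"
    using mom(2) eq mean by (subst integral_cong_AE[where g = "\<lambda>\<xi>. \<Sum>x\<in>#\<xi>. \<rho> x"]) (auto simp: Q_def)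
  show "integrable Q (\<lambda>\<xi>. (energy \<xi> \<sigma>)\<^sup>2)"
    using mom(3) sq_eq by (subst integrable_cong_AE[where g = "\<lambda>\<xi>. (\<Sum>x\<in>#\<xi>. \<rho> x)\<^sup>2"]) (auto simp: Q_def)
  have "(\<integral>\<xi>. (energy \<xi> \<sigma>)\<^sup>2 \<partial>Q) = (\<integral>\<xi>. (\<Sum>x\<in>#\<xi>. \<rho> x)\<^sup>2 \<partial>Q)"
    using sq_eq by (intro integral_cong_AE) (auto simp: Q_def)
  then show "(\<integral>\<xi>. (energy \<xi> \<sigma>)\<^sup>2 \<partial>Q) \<le> \<mu>"
    using mom(4) mean mult_left_mono[OF sq \<mu>] by simp
qed

section \<open>Mixtures and resampling of independent variables\<close>

context prob_space begin

lemma indep_var_joint_law: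
  assumes indep: "indep_var S X T Y" and f: "f \<in> measurable S S'"
  shows "distr M (S' \<Otimes>\<^sub>M T) (\<lambda>w. (f (X w), Y w)) = distr M S' (\<lambda>w. f (X w)) \<Otimes>\<^sub>M distr M T Y"
proof -
  have rv: "X \<in> measurable M S" "Y \<in> measurable M T"
    using indep_var_rv1[OF indep] indep_var_rv2[OF indep] .
  interpret DY: prob_space "distr M T Y" by (rule prob_space_distr[OF rv(2)])
  have id: "distr (distr M T Y) T (\<lambda>y. y) = distr M T Y"
    using rv by (subst distr_distr) (auto simp: comp_def)
  have "distr M (S' \<Otimes>\<^sub>M T) (\<lambda>w. (f (X w), Y w))
      = distr (distr M (S \<Otimes>\<^sub>M T) (\<lambda>w. (X w, Y w))) (S' \<Otimes>\<^sub>M T) (\<lambda>(x, y). (f x, y))"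
    using rv f by (subst distr_distr) (auto simp: comp_def)
  also have "distr M (S \<Otimes>\<^sub>M T) (\<lambda>w. (X w, Y w)) = distr M S X \<Otimes>\<^sub>M distr M T Y"
    using indep unfolding indep_var_distribution_eq by simp
  also have "distr (distr M S X \<Otimes>\<^sub>M distr M T Y) (S' \<Otimes>\<^sub>M T) (\<lambda>(x, y). (f x, y))
      = distr (distr M S X) S' f \<Otimes>\<^sub>M distr (distr M T Y) T (\<lambda>y. y)"
  proof (rule pair_measure_distr[symmetric])
    show "sigma_finite_measure (distr (distr M T Y) T (\<lambda>y. y))"
      unfolding id by (rule DY.sigma_finite_measure_axioms)
  qed (use f in auto)
  also have "\<dots> = distr M S' (\<lambda>w. f (X w)) \<Otimes>\<^sub>M distr M T Y"
    unfolding id using rv f by (subst distr_distr) (auto simp: comp_def)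
  finally show ?thesis .
qed

text \<open>Given the discrete value x, independence leaves the law \<open>r x\<close> of
  \<open>F x (Y w)\<close>. Countability of the values of \<open>X\<close> makes measurability of
  each \<open>F x\<close> enough for joint measurability.\<close>

lemma distr_indep_mixture:
  fixes X :: "'a \<Rightarrow> 'b :: countable"
  assumes rv: "X \<in> measurable M (count_space UNIV)" "Y \<in> measurable M T"
    and indep: "distr M (count_space UNIV \<Otimes>\<^sub>M T) (\<lambda>w. (X w, Y w)) = distr M (count_space UNIV) X \<Otimes>\<^sub>M distr M T Y"
    and X: "distr M (count_space UNIV) X = measure_pmf p"
    and F: "\<And>x. F x \<in> measurable T (count_space UNIV)"
    and FY: "\<And>x. distr M (count_space UNIV) (\<lambda>w. F x (Y w)) = measure_pmf (r x)"
  shows "distr M (count_space UNIV) (\<lambda>w. F (X w) (Y w)) = measure_pmf (bind_pmf p r)"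
proof (rule measure_eqI)
  interpret DY: prob_space "distr M T Y" by (rule prob_space_distr[OF rv(2)])
  have G: "(\<lambda>(x, y). F x y) \<in> measurable (count_space UNIV \<Otimes>\<^sub>M T) (count_space UNIV)"
    unfolding case_prod_beta
    by (rule measurable_compose_countable[where g = fst and f = "\<lambda>x z. F x (snd z)"])
       (auto intro: measurable_compose[OF measurable_snd F])
  fix A assume "A \<in> sets (distr M (count_space UNIV) (\<lambda>w. F (X w) (Y w)))"
  let ?B = "(\<lambda>(x, y). F x y) -` A \<inter> space (count_space UNIV \<Otimes>\<^sub>M T)"
  have B: "?B \<in> sets (count_space UNIV \<Otimes>\<^sub>M T)" using measurable_sets[OF G, of A] by simp
  have pair: "(\<lambda>w. (X w, Y w)) \<in> measurable M (count_space UNIV \<Otimes>\<^sub>M T)" using rv by simp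
  have comp: "(\<lambda>w. F (X w) (Y w)) \<in> measurable M (count_space UNIV)"
    using measurable_compose[OF pair G] by simp
  have "emeasure (distr M (count_space UNIV) (\<lambda>w. F (X w) (Y w))) A
      = emeasure (distr M (count_space UNIV \<Otimes>\<^sub>M T) (\<lambda>w. (X w, Y w))) ?B"
    using comp pair B measurable_space[OF rv(2)]
    by (subst (1 2) emeasure_distr) (auto simp: space_pair_measure intro!: arg_cong2[where f = emeasure])
  also have "\<dots> = emeasure (distr M (count_space UNIV) X \<Otimes>\<^sub>M distr M T Y) ?B"
    by (simp only: indep)
  also have "\<dots> = (\<integral>\<^sup>+x. emeasure (distr M T Y) (Pair x -` ?B) \<partial>distr M (count_space UNIV) X)"
    using B sets_pair_measure_cong[of "distr M (count_space UNIV) X" "count_space UNIV" "distr M T Y" T]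
    by (intro DY.emeasure_pair_measure_alt) simp
  also have "\<dots> = (\<integral>\<^sup>+x. emeasure (measure_pmf (r x)) A \<partial>p)"
    unfolding X
  proof (rule nn_integral_cong)
    fix x
    have "Pair x -` ?B = F x -` A \<inter> space T" by (auto simp: space_pair_measure)
    then have "emeasure (distr M T Y) (Pair x -` ?B) = emeasure (distr M (count_space UNIV) (\<lambda>w. F x (Y w))) A"
      using rv F[of x] measurable_space[OF rv(2)] measurable_compose[OF rv(2) F[of x]]
      by (subst (1 2) emeasure_distr) (auto intro!: arg_cong2[where f = emeasure] simp: measurable_sets)
    then show "emeasure (distr M T Y) (Pair x -` ?B) = emeasure (measure_pmf (r x)) A" by (simp add: FY)
  qed
  finally show "emeasure (distr M (count_space UNIV) (\<lambda>w. F (X w) (Y w))) A = emeasure (measure_pmf (bind_pmf p r)) A"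
    by simp
qed simp

text \<open>By Fubini on the joint law, the coordinate \<open>g\<close> can be integrated out first
  with all others fixed. The second conclusion allows a further coordinate of the resulting function
  to be resampled.\<close>

lemma expectation_resample:
  fixes X :: "'i \<Rightarrow> 'a \<Rightarrow> 'b :: countable" and F :: "('i \<Rightarrow> 'b) \<Rightarrow> real"
  assumes indep: "indep_vars (\<lambda>_. count_space UNIV) X I" and g: "g \<in> I"
    and law: "distr M (count_space UNIV) (X g) = measure_pmf q"
    and F: "F \<in> borel_measurable (Pi\<^sub>M I (\<lambda>_. count_space UNIV))" and B: "\<And>y. \<bar>F y\<bar> \<le> B"
  shows "expectation (\<lambda>w. F (\<lambda>i\<in>I. X i w)) = expectation (\<lambda>w. \<integral>\<xi>. F ((\<lambda>i\<in>I. X i w)(g := \<xi>)) \<partial>q)"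
    and "(\<lambda>y. \<integral>\<xi>. F (y(g := \<xi>)) \<partial>q) \<in> borel_measurable (Pi\<^sub>M I (\<lambda>_. count_space UNIV))"
proof -
  let ?C = "count_space UNIV :: 'b measure"
  let ?R = "Pi\<^sub>M (I - {g}) (\<lambda>_. ?C)"
  define Y where "Y = (\<lambda>w. \<lambda>i\<in>I - {g}. X i w)"
  have I: "I = (I - {g}) \<union> {g}" "I \<union> {g} = I" using g by auto
  have upd: "(\<lambda>z. (fst z)(g := snd z)) \<in> measurable (Pi\<^sub>M J (\<lambda>_. ?C) \<Otimes>\<^sub>M ?C) (Pi\<^sub>M I (\<lambda>_. ?C))"
    if "I = J \<union> {g}" for J
    using that by (intro measurable_fun_upd[where J = J]) auto
  have meas_upd: "(\<lambda>z. F ((fst z)(g := snd z))) \<in> borel_measurable (Pi\<^sub>M J (\<lambda>_. ?C) \<Otimes>\<^sub>M measure_pmf q)"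
    if "I = J \<union> {g}" for J
    using measurable_compose[OF upd[OF that] F]
    by (simp cong: measurable_cong_sets sets_pair_measure_cong)
  show "(\<lambda>y. \<integral>\<xi>. F (y(g := \<xi>)) \<partial>q) \<in> borel_measurable (Pi\<^sub>M I (\<lambda>_. ?C))"
    using meas_upd[of I] I by (intro measure_pmf.borel_measurable_lebesgue_integral) (simp add: case_prod_beta)
  have iv: "indep_var (Pi\<^sub>M {g} (\<lambda>_. ?C)) (\<lambda>w. \<lambda>i\<in>{g}. X i w) ?R Y"
    unfolding Y_def by (rule indep_var_restrict[OF indep]) (use g in auto)
  have joint: "distr M (?C \<Otimes>\<^sub>M ?R) (\<lambda>w. (X g w, Y w)) = distr M ?C (X g) \<Otimes>\<^sub>M distr M ?R Y"
    using indep_var_joint_law[OF iv, of "\<lambda>y. y g" ?C] by simp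
  have rv: "Y \<in> measurable M ?R" "X g \<in> measurable M ?C"
    using indep_var_rv2[OF iv] indep g by (auto simp: indep_vars_def)
  interpret DY: prob_space "distr M ?R Y" by (rule prob_space_distr[OF rv(1)])
  interpret PP: pair_prob_space "measure_pmf q" "distr M ?R Y" ..
  define G where "G = (\<lambda>z. F ((snd z)(g := fst z)))"
  have upd': "(\<lambda>z. (snd z)(g := fst z)) \<in> measurable (?C \<Otimes>\<^sub>M ?R) (Pi\<^sub>M I (\<lambda>_. ?C))"
    using I(1) by (intro measurable_fun_upd[where J = "I - {g}"]) auto
  have G_meas: "G \<in> borel_measurable (?C \<Otimes>\<^sub>M ?R)"
    unfolding G_def using measurable_compose[OF upd' F] by simp
  have G_meas': "G \<in> borel_measurable (measure_pmf q \<Otimes>\<^sub>M distr M ?R Y)"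
    using G_meas by (simp cong: measurable_cong_sets sets_pair_measure_cong)
  have int: "integrable (measure_pmf q \<Otimes>\<^sub>M distr M ?R Y) G"
    using G_meas' B by (intro PP.integrable_const_bound[where B = B]) (auto simp: G_def)
  have Xrep: "(\<lambda>i\<in>I. X i w) = (Y w)(g := X g w)" for w
    using g by (auto simp: Y_def fun_eq_iff)
  have Xupd: "(\<lambda>i\<in>I. X i w)(g := \<xi>) = (Y w)(g := \<xi>)" for w \<xi>
    by (auto simp: Y_def fun_eq_iff)
  have "expectation (\<lambda>w. F (\<lambda>i\<in>I. X i w)) = expectation (\<lambda>w. G (X g w, Y w))"
    by (simp add: G_def Xrep)
  also have "\<dots> = (\<integral>z. G z \<partial>distr M (?C \<Otimes>\<^sub>M ?R) (\<lambda>w. (X g w, Y w)))"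
    using rv G_meas by (subst integral_distr) auto
  also have "\<dots> = (\<integral>z. G z \<partial>(measure_pmf q \<Otimes>\<^sub>M distr M ?R Y))"
    by (simp only: joint law)
  also have "\<dots> = (\<integral>y. \<integral>\<xi>. G (\<xi>, y) \<partial>q \<partial>distr M ?R Y)"
    using PP.integral_snd[of "\<lambda>\<xi> y. G (\<xi>, y)"] int by simp
  also have "\<dots> = expectation (\<lambda>w. \<integral>\<xi>. G (\<xi>, Y w) \<partial>q)"
  proof (rule integral_distr[OF rv(1)])
    show "(\<lambda>y. \<integral>\<xi>. G (\<xi>, y) \<partial>q) \<in> borel_measurable ?R"
      using meas_upd[of "I - {g}"] I(1)
      by (intro measure_pmf.borel_measurable_lebesgue_integral) (simp add: G_def case_prod_beta)
  qed
  finally show "expectation (\<lambda>w. F (\<lambda>i\<in>I. X i w)) = expectation (\<lambda>w. \<integral>\<xi>. F ((\<lambda>i\<in>I. X i w)(g := \<xi>)) \<partial>q)"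
    by (simp add: G_def Xupd)
qed

end

section \<open>The disorder as independent Poisson samples\<close>

text \<open>\<open>True\<close> selects the bulk variables and \<open>False\<close> the primed ones,
  so that both kinds are treated at once.\<close>

definition num_label :: "bool \<Rightarrow> nat \<Rightarrow> label" where
  "num_label b p = (if b then NumP p else NumP' p)"

definition coup_label :: "bool \<Rightarrow> nat \<Rightarrow> nat \<Rightarrow> label" where
  "coup_label b p \<nu> = (if b then CoupJ p \<nu> else CoupJ' p \<nu>)"

definition site_label :: "bool \<Rightarrow> nat \<Rightarrow> nat \<Rightarrow> nat \<Rightarrow> label" where
  "site_label b p \<nu> k = (if b then IndI p k \<nu> else IndJ p k \<nu>)"

definition term_labels :: "bool \<Rightarrow> nat \<Rightarrow> nat \<Rightarrow> label set" where
  "term_labels b p \<nu> = insert (coup_label b p \<nu>) (site_label b p \<nu> ` {1..p})"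

text \<open>All potential terms are included, not only those below the random number: the block is
  then deterministic, and blocks of different groups are disjoint.\<close>

definition group_labels :: "bool \<times> nat \<Rightarrow> label set" where
  "group_labels g = insert (num_label (fst g) (snd g)) (\<Union>\<nu>\<in>{1..}. term_labels (fst g) (snd g) \<nu>)"

text \<open>The number \<open>m\<close> of sites read is separate from \<open>p\<close>, so that
  \<open>law_sites\<close> can add one site at a time.\<close>

definition dec_sites :: "bool \<Rightarrow> nat \<Rightarrow> nat \<Rightarrow> nat \<Rightarrow> (label \<Rightarrow> int) \<Rightarrow> nat list" where
  "dec_sites b p \<nu> m x = map (\<lambda>k. nat (x (site_label b p \<nu> k))) [1..<Suc m]"

definition dec_term :: "bool \<Rightarrow> nat \<Rightarrow> nat \<Rightarrow> (label \<Rightarrow> int) \<Rightarrow> int \<times> nat list" where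
  "dec_term b p \<nu> x = (x (coup_label b p \<nu>), dec_sites b p \<nu> p x)"

definition dec_terms :: "bool \<Rightarrow> nat \<Rightarrow> nat \<Rightarrow> (label \<Rightarrow> int) \<Rightarrow> (int \<times> nat list) multiset" where
  "dec_terms b p n x = mset (map (\<lambda>\<nu>. dec_term b p \<nu> x) [1..<Suc n])"

definition dec_group :: "bool \<times> nat \<Rightarrow> (label \<Rightarrow> int) \<Rightarrow> (int \<times> nat list) multiset" where
  "dec_group g x = dec_terms (fst g) (snd g) (nat (x (num_label (fst g) (snd g)))) x"

lemmas label_defs = num_label_def coup_label_def site_label_def

text \<open>Independence of blocks concerns restrictions of the label family; this and the next
  lemmas let a decoder pass between a restriction and the full family.\<close>

lemma dec_sites_restrict:
  "site_label b p \<nu> ` {1..m} \<subseteq> A \<Longrightarrow> dec_sites b p \<nu> m (restrict x A) = dec_sites b p \<nu> m x"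
  unfolding dec_sites_def by (rule map_cong[OF refl]) (auto simp: image_subset_iff)

lemma dec_term_restrict: "term_labels b p \<nu> \<subseteq> A \<Longrightarrow> dec_term b p \<nu> (restrict x A) = dec_term b p \<nu> x"
  unfolding dec_term_def term_labels_def by (simp add: dec_sites_restrict)

lemma dec_terms_restrict:
  "(\<And>\<nu>. \<nu> \<ge> 1 \<Longrightarrow> \<nu> \<le> n \<Longrightarrow> term_labels b p \<nu> \<subseteq> A) \<Longrightarrow> dec_terms b p n (restrict x A) = dec_terms b p n x"
  unfolding dec_terms_def
  by (intro arg_cong[where f = mset] map_cong refl dec_term_restrict)
     (auto simp: less_Suc_eq_le simp del: upt_Suc)

lemma dec_group_restrict: "group_labels g \<subseteq> A \<Longrightarrow> dec_group g (restrict x A) = dec_group g x"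
  unfolding dec_group_def group_labels_def by (subst dec_terms_restrict) auto

lemma group_labels_subset: "snd g \<ge> 1 \<Longrightarrow> group_labels g \<subseteq> labels"
  by (auto simp: group_labels_def term_labels_def label_defs labels_def)

lemma disjoint_group_labels: "disjoint_family_on group_labels G"
  by (auto simp: disjoint_family_on_def group_labels_def term_labels_def label_defs split: if_splits)

abbreviation "int_family A \<equiv> Pi\<^sub>M A (\<lambda>_. count_space (UNIV :: int set))"

lemma measurable_map_countable:
  fixes f :: "'b \<Rightarrow> 'a \<Rightarrow> 'c :: countable"
  assumes "\<And>y. y \<in> set ys \<Longrightarrow> f y \<in> measurable S (count_space UNIV)"
  shows "(\<lambda>x. map (\<lambda>y. f y x) ys) \<in> measurable S (count_space UNIV)"
  using assms
proof (induction ys)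
  case (Cons y ys)
  have tl: "(\<lambda>x. map (\<lambda>y. f y x) ys) \<in> measurable S (count_space UNIV)" using Cons by simp
  have hd: "f y \<in> measurable S (count_space UNIV)" using Cons.prems by simp
  have "(\<lambda>x. a # map (\<lambda>y. f y x) ys) \<in> measurable S (count_space UNIV)" for a
    by (rule measurable_compose[OF tl]) simp
  from measurable_compose_countable[where f = "\<lambda>a x. a # map (\<lambda>y. f y x) ys", OF this hd]
  show ?case by simp
qed simp

lemma measurable_label: "l \<in> A \<Longrightarrow> (\<lambda>x. x l) \<in> measurable (int_family A) (count_space UNIV)"
  by (rule measurable_component_singleton)

lemma measurable_dec_sites:
  assumes "site_label b p \<nu> ` {1..m} \<subseteq> A"
  shows "dec_sites b p \<nu> m \<in> measurable (int_family A) (count_space UNIV)"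
  unfolding dec_sites_def[abs_def]
proof (rule measurable_map_countable)
  fix k assume "k \<in> set [1..<Suc m]"
  then have "site_label b p \<nu> k \<in> A" using assms by auto
  then show "(\<lambda>x. nat (x (site_label b p \<nu> k))) \<in> measurable (int_family A) (count_space UNIV)"
    by (intro measurable_compose[OF measurable_label]) auto
qed

lemma measurable_dec_term:
  assumes "term_labels b p \<nu> \<subseteq> A"
  shows "dec_term b p \<nu> \<in> measurable (int_family A) (count_space UNIV)"
proof -
  have c: "(\<lambda>x. x (coup_label b p \<nu>)) \<in> measurable (int_family A) (count_space UNIV)"
    using assms by (intro measurable_label) (auto simp: term_labels_def)
  have s: "dec_sites b p \<nu> p \<in> measurable (int_family A) (count_space UNIV)"
    using assms by (intro measurable_dec_sites) (auto simp: term_labels_def)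
  have "(\<lambda>x. (a, dec_sites b p \<nu> p x)) \<in> measurable (int_family A) (count_space UNIV)" for a :: int
    by (rule measurable_compose[OF s]) simp
  from measurable_compose_countable[where f = "\<lambda>a x. (a, dec_sites b p \<nu> p x)", OF this c]
  show ?thesis unfolding dec_term_def[abs_def] .
qed

lemma measurable_dec_terms:
  assumes "\<And>\<nu>. \<nu> \<ge> 1 \<Longrightarrow> \<nu> \<le> n \<Longrightarrow> term_labels b p \<nu> \<subseteq> A"
  shows "dec_terms b p n \<in> measurable (int_family A) (count_space UNIV)"
  unfolding dec_terms_def[abs_def]
  using assms by (intro measurable_compose[OF measurable_map_countable] measurable_dec_term)
    (auto simp: less_Suc_eq_le simp del: upt_Suc)

lemma measurable_dec_group:
  assumes "group_labels g \<subseteq> A"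
  shows "dec_group g \<in> measurable (int_family A) (count_space UNIV)"
proof -
  have n: "(\<lambda>x. x (num_label (fst g) (snd g))) \<in> measurable (int_family A) (count_space UNIV)"
    using assms by (intro measurable_label) (auto simp: group_labels_def)
  have "dec_terms (fst g) (snd g) (nat k) \<in> measurable (int_family A) (count_space UNIV)" for k :: int
    using assms by (intro measurable_dec_terms) (auto simp: group_labels_def)
  from measurable_compose_countable[where f = "\<lambda>k. dec_terms (fst g) (snd g) (nat k)", OF this n]
  show ?thesis unfolding dec_group_def[abs_def] .
qed

lemma energy_dec_terms:
  "energy (dec_terms b p n x) \<sigma>
     = pspin_sum p n (\<lambda>\<nu>. x (coup_label b p \<nu>)) (\<lambda>k \<nu>. nat (x (site_label b p \<nu> k))) \<sigma>"
proof -
  have "spin \<sigma> (dec_sites b p \<nu> p x) = (\<Prod>k=1..p. \<sigma> (nat (x (site_label b p \<nu> k))))" for \<nu>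
    unfolding spin_def dec_sites_def
    by (simp add: prod.distinct_set_conv_list[symmetric] comp_def atLeastLessThanSuc_atLeastAtMost del: upt_Suc)
  then have "energy (dec_terms b p n x) \<sigma>
      = sum_mset (mset (map (\<lambda>\<nu>. real_of_int (x (coup_label b p \<nu>)) * (\<Prod>k=1..p. \<sigma> (nat (x (site_label b p \<nu> k))))) [1..<Suc n]))"
    by (simp add: energy_def dec_terms_def dec_term_def comp_def multiset.map_comp del: upt_Suc)
  then show ?thesis
    unfolding sum_mset_sum_list interv_sum_list_conv_sum_set_nat pspin_sum_def
    by (simp add: atLeastLessThanSuc_atLeastAtMost del: upt_Suc)
qed

section \<open>Laws of the decoded samples\<close>

context quenched_disorder begin

definition lab :: "'w \<Rightarrow> label \<Rightarrow> int" where
  "lab w l = label_family P P' J J' i j l w"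

definition terms_of :: "bool \<times> nat \<Rightarrow> 'w \<Rightarrow> (int \<times> nat list) multiset" where
  "terms_of g w = dec_group g (lab w)"

definition rate :: "bool \<times> nat \<Rightarrow> real" where
  "rate g = (if fst g then \<alpha> * real N else \<alpha>')"

lemma lab_simps:
  "lab w (num_label b p) = int (if b then P p w else P' p w)"
  "lab w (coup_label b p \<nu>) = (if b then J p \<nu> w else J' p \<nu> w)"
  "lab w (site_label b p \<nu> k) = int (if b then i p k \<nu> w else j p k \<nu> w)"
  by (simp_all add: lab_def label_defs)

lemma energy_terms_of:
  "energy (terms_of (True, p) w) \<sigma> = pspin_sum p (P p w) (\<lambda>\<nu>. J p \<nu> w) (\<lambda>k \<nu>. i p k \<nu> w) \<sigma>"
  "energy (terms_of (False, p) w) \<sigma> = pspin_sum p (P' p w) (\<lambda>\<nu>. J' p \<nu> w) (\<lambda>k \<nu>. j p k \<nu> w) \<sigma>"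
  by (simp_all add: terms_of_def dec_group_def energy_dec_terms lab_simps)

lemma indep_lab: "indep_vars (\<lambda>_. count_space UNIV) (\<lambda>l w. lab w l) labels"
  using mutually_indep by (simp add: lab_def[abs_def])

lemma measurable_lab: "l \<in> labels \<Longrightarrow> (\<lambda>w. lab w l) \<in> measurable M (count_space UNIV)"
  using indep_lab by (simp add: indep_vars_def)

lemma measurable_restrict_lab:
  "A \<subseteq> labels \<Longrightarrow> (\<lambda>w. restrict (lab w) A) \<in> measurable M (int_family A)"
  by (intro measurable_restrict measurable_lab) auto

text \<open>Disjoint blocks of labels are independent, so what is read from \<open>A\<close> may be
  fixed while the law of the part read from \<open>B\<close> is determined. The disorder is
  assembled this way: site by site, coupling with sites, term by term, and number with
  terms.\<close>

lemma law_mixture: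
  fixes f :: "(label \<Rightarrow> int) \<Rightarrow> 'b :: countable" and F :: "'b \<Rightarrow> (label \<Rightarrow> int) \<Rightarrow> 'c"
  assumes AB: "A \<inter> B = {}" "A \<subseteq> labels" "B \<subseteq> labels"
    and f: "f \<in> measurable (int_family A) (count_space UNIV)" "\<And>x. f (restrict x A) = f x"
    and F: "\<And>y. F y \<in> measurable (int_family B) (count_space UNIV)" "\<And>y x. F y (restrict x B) = F y x"
    and p: "distr M (count_space UNIV) (\<lambda>w. f (lab w)) = measure_pmf p"
    and r: "\<And>y. distr M (count_space UNIV) (\<lambda>w. F y (lab w)) = measure_pmf (r y)"
  shows "distr M (count_space UNIV) (\<lambda>w. F (f (lab w)) (lab w)) = measure_pmf (bind_pmf p r)"
proof -
  have iv: "indep_var (int_family A) (\<lambda>w. restrict (lab w) A) (int_family B) (\<lambda>w. restrict (lab w) B)"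
    by (rule indep_var_restrict[OF indep_lab AB])
  show ?thesis
    using distr_indep_mixture[where X = "\<lambda>w. f (restrict (lab w) A)" and Y = "\<lambda>w. restrict (lab w) B" and F = F,
        OF measurable_compose[OF indep_var_rv1[OF iv] f(1)] indep_var_rv2[OF iv] indep_var_joint_law[OF iv f(1)], of p r]
      p r F(1) by (simp add: f(2) F(2))
qed

lemma law_num:
  assumes "p \<ge> 1"
  shows "distr M (count_space UNIV) (\<lambda>w. lab w (num_label b p)) = measure_pmf (map_pmf int (poisson_law (rate (b, p))))"
proof -
  define Q where "Q = (if b then P p else P' p)"
  have Q: "distr M (count_space UNIV) Q = measure_pmf (poisson_law (rate (b, p)))"
    using distr_P[OF assms] distr_P'[OF assms] by (simp add: Q_def rate_def)
  have "(\<lambda>w. nat (lab w (num_label b p))) \<in> measurable M (count_space UNIV)"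
    using assms by (intro measurable_compose[OF measurable_lab]) (auto simp: labels_def label_defs)
  then have Qm: "Q \<in> measurable M (count_space UNIV)" by (cases b) (simp_all add: lab_simps Q_def)
  have "distr M (count_space UNIV) (\<lambda>w. lab w (num_label b p)) = distr (distr M (count_space UNIV) Q) (count_space UNIV) int"
    using Qm by (subst distr_distr) (cases b; simp add: comp_def lab_simps Q_def)+
  then show ?thesis by (simp add: Q map_pmf_rep_eq)
qed

lemma law_coup:
  assumes "p \<ge> 1" "\<nu> \<ge> 1"
  shows "distr M (count_space UNIV) (\<lambda>w. lab w (coup_label b p \<nu>)) = measure_pmf (pmf_of_set {-1, 1})"
  using distr_J[OF assms] distr_J'[OF assms] by (cases b) (simp_all add: lab_simps)

lemma law_site:
  assumes "1 \<le> k" "k \<le> p" "\<nu> \<ge> 1"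
  shows "distr M (count_space UNIV) (\<lambda>w. nat (lab w (site_label b p \<nu> k))) = measure_pmf (pmf_of_set {1..N})"
  using distr_i[OF assms] distr_j[OF assms] by (cases b) (simp_all add: lab_simps)

lemma law_sites:
  assumes N: "N \<ge> 1" and \<nu>: "\<nu> \<ge> 1" and m: "m \<le> p"
  shows "distr M (count_space UNIV) (\<lambda>w. dec_sites b p \<nu> m (lab w)) = measure_pmf (pmf_of_set (Sites N m))"
  using m
proof (induction m)
  case 0
  have "pmf_of_set {[] :: nat list} = return_pmf []" by (rule pmf_of_set_singleton)
  moreover have "distr M (count_space UNIV) (\<lambda>w. [] :: nat list) = return (count_space UNIV) []"
    by (rule distr_const) simp
  ultimately show ?case by (simp add: dec_sites_def return_pmf.rep_eq)
next
  case (Suc m)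
  let ?A = "{site_label b p \<nu> (Suc m)}" and ?B = "site_label b p \<nu> ` {1..m}"
  have Sm: "dec_sites b p \<nu> (Suc m) x = dec_sites b p \<nu> m x @ [nat (x (site_label b p \<nu> (Suc m)))]" for x
    by (simp add: dec_sites_def)
  have B: "?B \<subseteq> labels" using Suc.prems \<nu> by (auto simp: labels_def label_defs)
  have d: "dec_sites b p \<nu> m \<in> measurable (int_family ?B) (count_space UNIV)" by (rule measurable_dec_sites) simp
  have "distr M (count_space UNIV) (\<lambda>w. (\<lambda>x y. dec_sites b p \<nu> m y @ [x]) (nat (lab w (site_label b p \<nu> (Suc m)))) (lab w))
    = measure_pmf (bind_pmf (pmf_of_set {1..N}) (\<lambda>x. map_pmf (\<lambda>is. is @ [x]) (pmf_of_set (Sites N m))))"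
  proof (rule law_mixture[where A = ?A and B = ?B and f = "\<lambda>x. nat (x (site_label b p \<nu> (Suc m)))"
        and F = "\<lambda>x y. dec_sites b p \<nu> m y @ [x]"])
    show "?A \<inter> ?B = {}" by (auto simp: label_defs)
    show "?A \<subseteq> labels" using Suc.prems \<nu> by (auto simp: labels_def label_defs)
    show "(\<lambda>x. nat (x (site_label b p \<nu> (Suc m)))) \<in> measurable (int_family ?A) (count_space UNIV)"
      by (intro measurable_compose[OF measurable_label]) auto
    show "(\<lambda>y. dec_sites b p \<nu> m y @ [x]) \<in> measurable (int_family ?B) (count_space UNIV)" for x
      by (rule measurable_compose[OF d]) simp
    show "distr M (count_space UNIV) (\<lambda>w. nat (lab w (site_label b p \<nu> (Suc m)))) = measure_pmf (pmf_of_set {1..N})"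
      using Suc.prems \<nu> by (intro law_site) auto
    fix x
    have "(\<lambda>w. dec_sites b p \<nu> m (lab w)) \<in> measurable M (count_space UNIV)"
      using measurable_compose[OF measurable_restrict_lab[OF B] d] by (simp add: dec_sites_restrict)
    then have "distr M (count_space UNIV) (\<lambda>w. dec_sites b p \<nu> m (lab w) @ [x])
      = distr (distr M (count_space UNIV) (\<lambda>w. dec_sites b p \<nu> m (lab w))) (count_space UNIV) (\<lambda>is. is @ [x])"
      by (subst distr_distr) (auto simp: comp_def)
    then show "distr M (count_space UNIV) (\<lambda>w. dec_sites b p \<nu> m (lab w) @ [x])
      = measure_pmf (map_pmf (\<lambda>is. is @ [x]) (pmf_of_set (Sites N m)))"
      using Suc by (simp add: map_pmf_rep_eq)
  qed (use B in \<open>simp_all add: dec_sites_restrict\<close>)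
  then show ?case unfolding Sm pmf_of_set_Sites_Suc[OF N] .
qed

lemma distr_map:
  assumes "distr M (count_space UNIV) Z = measure_pmf q" "Z \<in> measurable M (count_space UNIV)"
  shows "distr M (count_space UNIV) (\<lambda>w. h (Z w)) = measure_pmf (map_pmf h q)"
proof -
  have "distr M (count_space UNIV) (\<lambda>w. h (Z w)) = distr (distr M (count_space UNIV) Z) (count_space UNIV) h"
    using assms by (subst distr_distr) (auto simp: comp_def)
  then show ?thesis by (simp add: assms map_pmf_rep_eq)
qed

lemma law_term:
  assumes N: "N \<ge> 1" and p: "p \<ge> 1" and \<nu>: "\<nu> \<ge> 1"
  shows "distr M (count_space UNIV) (\<lambda>w. dec_term b p \<nu> (lab w)) = measure_pmf (term_law N p)"
proof -
  let ?A = "{coup_label b p \<nu>}" and ?B = "site_label b p \<nu> ` {1..p}"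
  have B: "?B \<subseteq> labels" using \<nu> by (auto simp: labels_def label_defs)
  have d: "dec_sites b p \<nu> p \<in> measurable (int_family ?B) (count_space UNIV)" by (rule measurable_dec_sites) simp
  have ne: "Sites N p \<noteq> {}" using card_Sites[of N p] N by (auto simp del: card_Sites)
  have "distr M (count_space UNIV) (\<lambda>w. (\<lambda>x y. (x, dec_sites b p \<nu> p y)) (lab w (coup_label b p \<nu>)) (lab w))
    = measure_pmf (bind_pmf (pmf_of_set {-1, 1}) (\<lambda>x. map_pmf (Pair x) (pmf_of_set (Sites N p))))"
  proof (rule law_mixture[where A = ?A and B = ?B and f = "\<lambda>x. x (coup_label b p \<nu>)"
        and F = "\<lambda>x y. (x, dec_sites b p \<nu> p y)"])
    show "?A \<inter> ?B = {}" by (auto simp: label_defs)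
    show "?A \<subseteq> labels" using p \<nu> by (auto simp: labels_def label_defs)
    show "(\<lambda>y. (x, dec_sites b p \<nu> p y)) \<in> measurable (int_family ?B) (count_space UNIV)" for x :: int
      by (rule measurable_compose[OF d]) simp
    have "(\<lambda>w. dec_sites b p \<nu> p (lab w)) \<in> measurable M (count_space UNIV)"
      using measurable_compose[OF measurable_restrict_lab[OF B] d] by (simp add: dec_sites_restrict)
    then show "distr M (count_space UNIV) (\<lambda>w. (x, dec_sites b p \<nu> p (lab w)))
      = measure_pmf (map_pmf (Pair x) (pmf_of_set (Sites N p)))" for x :: int
      by (intro distr_map law_sites N \<nu> order_refl)
  qed (use B p \<nu> in \<open>simp_all add: dec_sites_restrict law_coup measurable_label\<close>)
  also have "bind_pmf (pmf_of_set {-1, 1}) (\<lambda>x. map_pmf (Pair x) (pmf_of_set (Sites N p))) = term_law N p"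
    unfolding term_law_def using ne by (intro bind_pmf_of_set_bij) (auto simp: bij_betw_def)
  finally show ?thesis by (simp add: dec_term_def)
qed

lemma measurable_dec_term_lab:
  assumes "p \<ge> 1" "\<nu> \<ge> 1"
  shows "(\<lambda>w. dec_term b p \<nu> (lab w)) \<in> measurable M (count_space UNIV)"
proof -
  have sub: "term_labels b p \<nu> \<subseteq> labels" using assms by (auto simp: term_labels_def labels_def label_defs)
  show ?thesis
    using measurable_compose[OF measurable_restrict_lab[OF sub] measurable_dec_term[OF order_refl]]
    by (simp add: dec_term_restrict)
qed

lemma measurable_dec_terms_lab:
  assumes "p \<ge> 1"
  shows "(\<lambda>w. dec_terms b p n (lab w)) \<in> measurable M (count_space UNIV)"
  unfolding dec_terms_def
  using assms by (intro measurable_compose[OF measurable_map_countable] measurable_dec_term_lab) auto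

lemma law_terms:
  assumes N: "N \<ge> 1" and p: "p \<ge> 1"
  shows "distr M (count_space UNIV) (\<lambda>w. dec_terms b p n (lab w)) = measure_pmf (iid_mset n (term_law N p))"
proof (induction n)
  case 0
  have "distr M (count_space UNIV) (\<lambda>w. {#} :: (int \<times> nat list) multiset) = return (count_space UNIV) {#}"
    by (rule distr_const) simp
  then show ?case by (simp add: dec_terms_def return_pmf.rep_eq)
next
  case (Suc n)
  let ?A = "term_labels b p (Suc n)" and ?B = "\<Union>\<nu>\<in>{1..n}. term_labels b p \<nu>"
  have Sn: "dec_terms b p (Suc n) x = add_mset (dec_term b p (Suc n) x) (dec_terms b p n x)" for x
    by (simp add: dec_terms_def)
  have d: "dec_terms b p n \<in> measurable (int_family ?B) (count_space UNIV)"
    by (rule measurable_dec_terms) auto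
  have rB: "dec_terms b p n (restrict x ?B) = dec_terms b p n x" for x
    by (rule dec_terms_restrict) auto
  have "distr M (count_space UNIV) (\<lambda>w. (\<lambda>x y. add_mset x (dec_terms b p n y)) (dec_term b p (Suc n) (lab w)) (lab w))
    = measure_pmf (bind_pmf (term_law N p) (\<lambda>x. map_pmf (add_mset x) (iid_mset n (term_law N p))))"
  proof (rule law_mixture[where A = ?A and B = ?B and f = "dec_term b p (Suc n)"
        and F = "\<lambda>x y. add_mset x (dec_terms b p n y)"])
    show "?A \<inter> ?B = {}" by (auto simp: term_labels_def label_defs)
    show "?A \<subseteq> labels" "?B \<subseteq> labels" using p by (auto simp: term_labels_def labels_def label_defs)
    show "dec_term b p (Suc n) \<in> measurable (int_family ?A) (count_space UNIV)"
      by (rule measurable_dec_term) simp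
    show "(\<lambda>y. add_mset x (dec_terms b p n y)) \<in> measurable (int_family ?B) (count_space UNIV)" for x
      by (rule measurable_compose[OF d]) simp
    show "distr M (count_space UNIV) (\<lambda>w. dec_term b p (Suc n) (lab w)) = measure_pmf (term_law N p)"
      using N p by (intro law_term) auto
    show "distr M (count_space UNIV) (\<lambda>w. add_mset x (dec_terms b p n (lab w)))
      = measure_pmf (map_pmf (add_mset x) (iid_mset n (term_law N p)))" for x
      by (intro distr_map Suc.IH measurable_dec_terms_lab p)
  qed (simp_all only: rB dec_term_restrict order_refl)
  then show ?case by (simp add: Sn)
qed

text \<open>The number of terms is independent of the infinite list of potential terms, so mixing
  iid samples over the Poisson number gives the Poisson sample.\<close>

lemma law_terms_of:
  assumes N: "N \<ge> 1" and p: "snd g \<ge> 1"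
  shows "distr M (count_space UNIV) (terms_of g) = measure_pmf (poisson_mset (rate g) (term_law N (snd g)))"
proof -
  obtain b q where g: "g = (b, q)" by (cases g)
  have q: "q \<ge> 1" using p g by simp
  let ?A = "{num_label b q}" and ?B = "\<Union>\<nu>\<in>{1..}. term_labels b q \<nu>"
  have "distr M (count_space UNIV) (\<lambda>w. (\<lambda>k. dec_terms b q (nat k)) (lab w (num_label b q)) (lab w))
    = measure_pmf (bind_pmf (map_pmf int (poisson_law (rate (b, q)))) (\<lambda>k. iid_mset (nat k) (term_law N q)))"
  proof (rule law_mixture[where A = ?A and B = ?B and f = "\<lambda>x. x (num_label b q)"
        and F = "\<lambda>k. dec_terms b q (nat k)"])
    show "?A \<inter> ?B = {}" by (auto simp: term_labels_def label_defs)
    show "?A \<subseteq> labels" "?B \<subseteq> labels" using q by (auto simp: term_labels_def labels_def label_defs)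
    show "dec_terms b q (nat k) \<in> measurable (int_family ?B) (count_space UNIV)" for k
      by (rule measurable_dec_terms) auto
    show "dec_terms b q (nat k) (restrict x ?B) = dec_terms b q (nat k) x" for k x
      by (rule dec_terms_restrict) auto
  qed (use N q in \<open>simp_all add: law_num law_terms measurable_label\<close>)
  then show ?thesis
    by (simp add: g terms_of_def[abs_def] dec_group_def poisson_mset_def bind_map_pmf)
qed

definition groups :: "(bool \<times> nat) set" where
  "groups = UNIV \<times> {1..}"

lemma indep_terms_of: "indep_vars (\<lambda>_. count_space UNIV) terms_of groups"
proof -
  have "indep_vars (\<lambda>g. int_family (group_labels g)) (\<lambda>g w. restrict (lab w) (group_labels g)) groups"
    by (rule indep_vars_restrict[OF indep_lab _ disjoint_group_labels])
       (rule group_labels_subset, auto simp: groups_def)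
  from indep_vars_compose2[OF this, of dec_group "\<lambda>_. count_space UNIV"]
  show ?thesis
    by (simp add: measurable_dec_group dec_group_restrict terms_of_def[abs_def])
qed

end

section \<open>Gibbs weights of the model\<close>

definition series_term ::
  "(nat \<Rightarrow> real) \<Rightarrow> (nat \<Rightarrow> real) \<Rightarrow> (bool \<times> nat \<Rightarrow> (int \<times> nat list) multiset) \<Rightarrow> (nat \<Rightarrow> real) \<Rightarrow> nat \<Rightarrow> real" where
  "series_term a d y \<sigma> t = a (Suc t) * energy (y (True, Suc t)) \<sigma> + d (Suc t) * energy (y (False, Suc t)) \<sigma>"

text \<open>A function of the whole family of samples, so that single groups can be exchanged. The
  sign of the Hamiltonian cancels the one in the Gibbs exponent, and \<open>d\<close> stands for the
  products of \<open>b\<close> with the perturbing parameters.\<close>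

definition boltzmann ::
  "real \<Rightarrow> (nat \<Rightarrow> real) \<Rightarrow> (nat \<Rightarrow> real) \<Rightarrow> (bool \<times> nat \<Rightarrow> (int \<times> nat list) multiset) \<Rightarrow> (nat \<Rightarrow> real) \<Rightarrow> real" where
  "boltzmann \<beta> a d y \<sigma> = exp (\<beta> * (\<Sum>t. series_term a d y \<sigma> t))"

lemma pos_weight_boltzmann [simp]: "pos_weight N (boltzmann \<beta> a d y)"
  by (simp add: pos_weight_def boltzmann_def)

lemma displacement_cong:
  assumes "\<And>\<sigma>. \<sigma> \<in> configs N \<Longrightarrow> W \<sigma> = W' \<sigma>"
  shows "displacement N m n k t W = displacement N m n k t W'"
  unfolding displacement_def tilted_moment_def tilt_def
  using assms by (intro arg_cong2[where f = minus] site_mean_cong arg_cong2[where f = divide]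
      arg_cong2[where f = plus] overlap_moment_cong refl) auto

lemma energy_empty [simp]: "energy {#} \<sigma> = 0"
  by (simp add: energy_def)

lemma suminf_finite_change:
  fixes f g :: "nat \<Rightarrow> real"
  assumes f: "summable f" and A: "finite A" "\<And>t. t \<notin> A \<Longrightarrow> g t = f t"
  shows "summable g" "suminf g = suminf f + (\<Sum>t\<in>A. g t - f t)"
proof -
  have d: "(\<lambda>t. g t - f t) sums (\<Sum>t\<in>A. g t - f t)"
    using A by (intro sums_finite) auto
  have "g sums (suminf f + (\<Sum>t\<in>A. g t - f t))"
    using sums_add[OF summable_sums[OF f] d] by simp
  then show "summable g" "suminf g = suminf f + (\<Sum>t\<in>A. g t - f t)"
    by (auto simp: sums_iff)
qed

text \<open>Two groups affect two summands of the series only. Convergence is inherited by the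
  changed series, and the two summands become factors of the weight.\<close>

lemma boltzmann_update:
  assumes sm: "summable (series_term a d y \<sigma>)" and p: "p \<ge> 2"
  shows "boltzmann \<beta> a d (y((True, 1) := \<xi>, (True, p) := \<eta>)) \<sigma>
     = perturb (\<beta> * a p) \<eta> (perturb (\<beta> * a 1) \<xi> (boltzmann \<beta> a d (y((True, 1) := {#}, (True, p) := {#})))) \<sigma>"
proof -
  let ?y0 = "y((True, 1) := {#}, (True, p) := {#})"
  let ?y1 = "y((True, 1) := \<xi>, (True, p) := \<eta>)"
  \<comment> \<open>The series is indexed from zero, so the p-spin terms stand at index
    \<open>p - 1\<close>.\<close>
  let ?A = "{0, p - 1}"
  have eq: "series_term a d ?y0 \<sigma> t = series_term a d y \<sigma> t"
    "series_term a d ?y1 \<sigma> t = series_term a d ?y0 \<sigma> t" if "t \<notin> ?A" for t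
    using that by (auto simp: series_term_def)
  have sm0: "summable (series_term a d ?y0 \<sigma>)"
    by (rule suminf_finite_change(1)[OF sm, of ?A]) (use eq in auto)
  have "suminf (series_term a d ?y1 \<sigma>) = suminf (series_term a d ?y0 \<sigma>)
      + (\<Sum>t\<in>?A. series_term a d ?y1 \<sigma> t - series_term a d ?y0 \<sigma> t)"
    by (rule suminf_finite_change(2)[OF sm0]) (use eq in auto)
  also have "(\<Sum>t\<in>?A. series_term a d ?y1 \<sigma> t - series_term a d ?y0 \<sigma> t) = a 1 * energy \<xi> \<sigma> + a p * energy \<eta> \<sigma>"
    using p by (subst sum.insert) (auto simp: series_term_def)
  finally have eq: "suminf (series_term a d ?y1 \<sigma>)
      = suminf (series_term a d ?y0 \<sigma>) + (a 1 * energy \<xi> \<sigma> + a p * energy \<eta> \<sigma>)" .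
  show ?thesis
    unfolding boltzmann_def perturb_def eq mult_exp_exp
    by (rule arg_cong[where f = exp]) (simp only: algebra_simps)
qed

lemma abs_coeff_moment_le:
  assumes "N \<ge> 1" "pos_weight N W"
  shows "\<bar>coeff_moment N m n k r W\<bar> \<le> ratio_coeff k (2 * r) (- 1) 1 1"
  unfolding coeff_moment_def
proof (intro abs_site_mean_bound[OF assms(1)] abs_ratio_coeff_le)
  fix "is" js assume "is": "is \<in> Sites N m" and js: "js \<in> Sites N n"
  then show "\<bar>avg N W (\<lambda>\<sigma>. spin \<sigma> is)\<bar> \<le> 1" "\<bar>avg N W (\<lambda>\<sigma>. spin \<sigma> js)\<bar> \<le> 1"
    using assms by (auto intro!: abs_avg_spin_le_1 dest: SitesD)
  show "\<bar>avg N W (\<lambda>\<sigma>. spin \<sigma> is * spin \<sigma> js)\<bar> \<le> 1"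
    unfolding spin_append[symmetric] using "is" js SitesD assms by (intro abs_avg_spin_le_1) auto
qed

text \<open>The replica average of \<open>replica_avg_shared_overlap\<close>, for overlaps of
  \<open>u\<close> and \<open>v\<close> replicas of which \<open>c\<close> are shared.\<close>

definition shared_moment :: "nat \<Rightarrow> nat \<Rightarrow> nat \<Rightarrow> nat \<Rightarrow> nat \<Rightarrow> nat \<Rightarrow> ((nat \<Rightarrow> real) \<Rightarrow> real) \<Rightarrow> real" where
  "shared_moment N m n u v c W = site_mean N m (\<lambda>is. site_mean N n (\<lambda>js.
        avg N W (\<lambda>\<sigma>. spin \<sigma> is) ^ (u - c) * avg N W (\<lambda>\<sigma>. spin \<sigma> js) ^ (v - c)
        * avg N W (\<lambda>\<sigma>. spin \<sigma> is * spin \<sigma> js) ^ c))"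

lemma abs_shared_moment_le_1:
  assumes "N \<ge> 1" "pos_weight N W"
  shows "\<bar>shared_moment N m n u v c W\<bar> \<le> 1"
  unfolding shared_moment_def
proof (intro abs_site_mean_bound[OF assms(1)])
  fix "is" js assume "is": "is \<in> Sites N m" and js: "js \<in> Sites N n"
  then have "\<bar>avg N W (\<lambda>\<sigma>. spin \<sigma> is)\<bar> \<le> 1" "\<bar>avg N W (\<lambda>\<sigma>. spin \<sigma> js)\<bar> \<le> 1"
    using assms by (auto intro!: abs_avg_spin_le_1 dest: SitesD)
  moreover have "\<bar>avg N W (\<lambda>\<sigma>. spin \<sigma> is * spin \<sigma> js)\<bar> \<le> 1"
    unfolding spin_append[symmetric] using "is" js SitesD assms by (intro abs_avg_spin_le_1) auto
  ultimately have "\<bar>avg N W (\<lambda>\<sigma>. spin \<sigma> is)\<bar> ^ (u - c) * \<bar>avg N W (\<lambda>\<sigma>. spin \<sigma> js)\<bar> ^ (v - c)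
      * \<bar>avg N W (\<lambda>\<sigma>. spin \<sigma> is * spin \<sigma> js)\<bar> ^ c \<le> 1 * 1 * 1"
    by (intro mult_mono power_le_one) auto
  then show "\<bar>avg N W (\<lambda>\<sigma>. spin \<sigma> is) ^ (u - c) * avg N W (\<lambda>\<sigma>. spin \<sigma> js) ^ (v - c)
        * avg N W (\<lambda>\<sigma>. spin \<sigma> is * spin \<sigma> js) ^ c\<bar> \<le> 1"
    by (simp add: abs_mult power_abs)
qed

lemma coeff_moment_eq_sum_shared:
  assumes "k \<ge> 1"
  shows "coeff_moment N m n k r W = real k * (\<Sum>c=0..min (2 * r) k. (- 1) ^ (2 * r - c) *
     (fact (2 * r + k - c - 1) / (fact c * fact (2 * r - c) * fact (k - c))) * shared_moment N m n (2 * r) k c W)"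
  unfolding coeff_moment_def shared_moment_def ratio_coeff_fact[OF assms]
  by (simp only: site_mean_cmult site_mean_sum)

abbreviation "term_family G \<equiv> Pi\<^sub>M G (\<lambda>_. count_space (UNIV :: (int \<times> nat list) multiset set))"

lemma measurable_boltzmann [measurable]:
  assumes "UNIV \<times> {1..} \<subseteq> G"
  shows "(\<lambda>y. boltzmann \<beta> a d y \<sigma>) \<in> borel_measurable (term_family G)"
proof -
  have [measurable]: "(\<lambda>y. energy (y (b, Suc t)) \<sigma>) \<in> borel_measurable (term_family G)" for b t
    using assms by (intro measurable_compose[OF measurable_component_singleton]) auto
  show ?thesis unfolding boltzmann_def series_term_def by measurable
qed

context
  fixes S :: "'s measure" and V :: "'s \<Rightarrow> (nat \<Rightarrow> real) \<Rightarrow> real" and N :: nat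
  assumes V [measurable]: "\<And>\<sigma>. (\<lambda>w. V w \<sigma>) \<in> borel_measurable S"
begin

lemma measurable_overlap_moment: "(\<lambda>w. overlap_moment N n k (V w)) \<in> borel_measurable S"
  unfolding overlap_moment_def site_mean_def avg_def by measurable

lemma measurable_tilted_moment: "(\<lambda>w. overlap_moment N n k (tilt t is (V w))) \<in> borel_measurable S"
  unfolding overlap_moment_def site_mean_def avg_def tilt_def by measurable

lemma measurable_displacement: "(\<lambda>w. displacement N m n k t (V w)) \<in> borel_measurable S"
  unfolding displacement_def tilted_moment_def site_mean_def
  by (intro borel_measurable_diff borel_measurable_divide borel_measurable_sum borel_measurable_add
      measurable_overlap_moment measurable_tilted_moment borel_measurable_const)

lemma measurable_shared_moment: "(\<lambda>w. shared_moment N m n u v c (V w)) \<in> borel_measurable S"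
  unfolding shared_moment_def site_mean_def avg_def by measurable

lemma measurable_coeff_moment: "(\<lambda>w. coeff_moment N m n k r (V w)) \<in> borel_measurable S"
  unfolding coeff_moment_def site_mean_def avg_def ratio_coeff_def by measurable

end

section \<open>Disorder expectations of Gibbs quantities\<close>

context quenched_disorder begin

definition family_of :: "'w \<Rightarrow> bool \<times> nat \<Rightarrow> (int \<times> nat list) multiset" where
  "family_of w = (\<lambda>g\<in>groups. terms_of g w)"

lemma family_of_simps [simp]: "p \<ge> 1 \<Longrightarrow> family_of w (b, p) = terms_of (b, p) w"
  by (simp add: family_of_def groups_def)

lemma measurable_family_of: "family_of \<in> measurable M (term_family groups)"
  unfolding family_of_def[abs_def] using indep_terms_of
  by (intro measurable_restrict) (auto simp: indep_vars_def)

lemma boltzmann_hamiltonian: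
  "exp (- \<beta> * hamiltonian a b lam P P' J J' i j w \<sigma>) = boltzmann \<beta> a (\<lambda>p. b p * lam p) (family_of w) \<sigma>"
  by (simp add: hamiltonian_def boltzmann_def series_term_def[abs_def] Let_def energy_terms_of)

text \<open>The energies of different groups are independent and centred with variance at most the
  rate, so \<open>AE_summable_indep\<close> applies to the weighted series.\<close>

lemma AE_summable_energy:
  assumes N: "N \<ge> 1" and rate: "rate (u, 1) \<ge> 0" and c: "summable (\<lambda>t. (c (Suc t))\<^sup>2)" and \<sigma>: "\<sigma> \<in> configs N"
  shows "AE w in M. summable (\<lambda>t. c (Suc t) * energy (terms_of (u, Suc t) w) \<sigma>)"
proof (rule AE_summable_indep)
  define \<mu> where "\<mu> = rate (u, 1)"
  have rate_eq: "rate (u, p) = \<mu>" for p by (simp add: rate_def \<mu>_def)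
  have law: "distr M (count_space UNIV) (terms_of (u, Suc t)) = measure_pmf (poisson_mset \<mu> (term_law N (Suc t)))" for t
    using law_terms_of[OF N, of "(u, Suc t)"] by (simp add: rate_eq)
  have rv: "terms_of (u, Suc t) \<in> measurable M (count_space UNIV)" for t
    using indep_terms_of by (auto simp: indep_vars_def groups_def)
  have int_law: "integrable M (\<lambda>w. f (terms_of (u, Suc t) w)) \<longleftrightarrow> integrable (poisson_mset \<mu> (term_law N (Suc t))) f"
    and exp_law: "expectation (\<lambda>w. f (terms_of (u, Suc t) w)) = (\<integral>\<xi>. f \<xi> \<partial>poisson_mset \<mu> (term_law N (Suc t)))"
    for f :: "_ \<Rightarrow> real" and t
    using rv[of t] integrable_distr_eq[OF rv[of t], of f] integral_distr[OF rv[of t], of f] by (simp_all add: law)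
  note mom = energy_moments[OF N rate[folded \<mu>_def] \<sigma>]
  have "indep_vars (\<lambda>t. term_family {(u, Suc t)}) (\<lambda>t w. restrict (\<lambda>g. terms_of g w) {(u, Suc t)}) UNIV"
    by (rule indep_vars_restrict[OF indep_terms_of]) (auto simp: groups_def disjoint_family_on_def)
  note compose = indep_vars_compose2[OF this, of "\<lambda>t y. c (Suc t) * energy (y (u, Suc t)) \<sigma>" "\<lambda>_. borel"]
  show "indep_vars (\<lambda>_. borel) (\<lambda>t w. c (Suc t) * energy (terms_of (u, Suc t) w) \<sigma>) UNIV"
  proof -
    have "(\<lambda>y. c (Suc t) * energy (y (u, Suc t)) \<sigma>) \<in> borel_measurable (term_family {(u, Suc t)})" for t
      by (intro measurable_compose[OF measurable_component_singleton]) auto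
    then show ?thesis using compose by simp
  qed
  show "integrable M (\<lambda>w. c (Suc t) * energy (terms_of (u, Suc t) w) \<sigma>)" for t
    using mom(1) by (intro integrable_mult_right) (simp add: int_law[of "\<lambda>\<xi>. energy \<xi> \<sigma>"])
  show "integrable M (\<lambda>w. (c (Suc t) * energy (terms_of (u, Suc t) w) \<sigma>)\<^sup>2)" for t
    unfolding power_mult_distrib using mom(3)
    by (intro integrable_mult_right) (simp add: int_law[of "\<lambda>\<xi>. (energy \<xi> \<sigma>)\<^sup>2"])
  show "expectation (\<lambda>w. c (Suc t) * energy (terms_of (u, Suc t) w) \<sigma>) = 0" for t
    using mom(2) by (simp add: exp_law[of "\<lambda>\<xi>. energy \<xi> \<sigma>"])
  have "expectation (\<lambda>w. (c (Suc t) * energy (terms_of (u, Suc t) w) \<sigma>)\<^sup>2) \<le> (c (Suc t))\<^sup>2 * \<mu>" for t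
    unfolding power_mult_distrib using mom(4)
    by (simp add: exp_law[of "\<lambda>\<xi>. (energy \<xi> \<sigma>)\<^sup>2"] mult_left_mono)
  then show "summable (\<lambda>t. expectation (\<lambda>w. (c (Suc t) * energy (terms_of (u, Suc t) w) \<sigma>)\<^sup>2))"
    by (intro summable_comparison_test[OF _ summable_mult2[OF c, of \<mu>]]) (auto intro!: exI[of _ 0])
qed

lemma AE_summable_series:
  assumes N: "N \<ge> 1" and \<alpha>: "\<alpha> \<ge> 0" "\<alpha>' \<ge> 0"
    and a: "summable (\<lambda>t. (a (Suc t))\<^sup>2)" and d: "summable (\<lambda>t. (d (Suc t))\<^sup>2)"
  shows "AE w in M. \<forall>\<sigma>\<in>configs N. summable (series_term a d (family_of w) \<sigma>)"
proof (subst AE_ball_countable)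
  show "countable (configs N)" by (intro countable_finite) simp
  show "\<forall>\<sigma>\<in>configs N. AE w in M. summable (series_term a d (family_of w) \<sigma>)"
  proof
    fix \<sigma> assume \<sigma>: "\<sigma> \<in> configs N"
    have "AE w in M. summable (\<lambda>t. a (Suc t) * energy (terms_of (True, Suc t) w) \<sigma>)"
      using \<alpha> by (intro AE_summable_energy N a \<sigma>) (simp add: rate_def)
    moreover have "AE w in M. summable (\<lambda>t. d (Suc t) * energy (terms_of (False, Suc t) w) \<sigma>)"
      using \<alpha> by (intro AE_summable_energy N d \<sigma>) (simp add: rate_def)
    ultimately show "AE w in M. summable (series_term a d (family_of w) \<sigma>)"
      by eventually_elim (auto simp: series_term_def[abs_def] intro: summable_add)
  qed
qed

text \<open>The (m + q)-spin and the one-spin group are resampled and everything else is frozen into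
  the weight of \<open>displacement_bound\<close>. That bound is uniform in the weight and therefore
  survives the expectation over the remaining disorder.\<close>

lemma expectation_displacement_bound:
  assumes N: "N \<ge> 1" and \<alpha>: "\<alpha> > 0" "\<alpha>' \<ge> 0" and \<beta>: "\<beta> \<noteq> 0" and a1: "a 1 \<noteq> 0" and L: "L \<ge> 1"
    and q: "q \<ge> 1" and m: "m \<ge> 1"
    and a: "summable (\<lambda>t. (a (Suc t))\<^sup>2)" and d: "summable (\<lambda>t. (d (Suc t))\<^sup>2)"
  shows "\<bar>expectation (\<lambda>w. displacement N m n k (tanh (\<beta> * a (m + q))) (boltzmann \<beta> a d (family_of w)))\<bar>
    \<le> displacement_const \<alpha> q k (tanh (\<beta> * a (m + q))) L / sqrt (real N)
        + real k * (2 / (1 - \<bar>tanh (\<beta> * a (m + q))\<bar>)) * real q * (4 * exp (\<alpha> / 2) / (\<bar>tanh (\<beta> * a 1)\<bar> * real L))"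
    (is "_ \<le> ?bound")
proof -
  define p where "p = m + q"
  \<comment> \<open>The inserted term thus belongs to another group than the one-spin fields, and
    the two can be resampled separately.\<close>
  have p: "p \<ge> 2" using m q by (simp add: p_def)
  define F where "F = (\<lambda>y. displacement N m n k (tanh (\<beta> * a p)) (boltzmann \<beta> a d y))"
  have F2: "\<bar>F y\<bar> \<le> 2" for y
    unfolding F_def by (intro abs_displacement_le_2 N pos_weight_boltzmann abs_tanh_less_1)
  have F_meas: "F \<in> borel_measurable (term_family groups)"
    unfolding F_def by (intro measurable_displacement measurable_boltzmann) (simp add: groups_def)
  let ?q1 = "poisson_mset (\<alpha> * real N) (term_law N 1)" and ?qp = "poisson_mset (\<alpha> * real N) (term_law N p)"
  have law1: "distr M (count_space UNIV) (terms_of (True, 1)) = measure_pmf ?q1"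
    using law_terms_of[OF N, of "(True, 1)"] by (simp add: rate_def)
  have lawp: "distr M (count_space UNIV) (terms_of (True, p)) = measure_pmf ?qp"
    using law_terms_of[OF N, of "(True, p)"] p by (simp add: rate_def)
  have g1: "(True, 1) \<in> groups" and gp: "(True, p) \<in> groups" using p by (auto simp: groups_def)
  define F' where "F' = (\<lambda>y. \<integral>\<eta>. F (y((True, p) := \<eta>)) \<partial>?qp)"
  have F'2: "\<bar>F' y\<bar> \<le> 2" for y unfolding F'_def by (rule abs_expectation_pmf_le[OF F2])
  have F'_meas: "F' \<in> borel_measurable (term_family groups)"
    unfolding F'_def by (rule expectation_resample(2)[OF indep_terms_of gp lawp F_meas F2])
  have "expectation (\<lambda>w. F (family_of w)) = expectation (\<lambda>w. F' (family_of w))"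
    unfolding family_of_def F'_def by (rule expectation_resample(1)[OF indep_terms_of gp lawp F_meas F2])
  also have "\<dots> = expectation (\<lambda>w. \<integral>\<xi>. F' ((family_of w)((True, 1) := \<xi>)) \<partial>?q1)"
    unfolding family_of_def by (rule expectation_resample(1)[OF indep_terms_of g1 law1 F'_meas F'2])
  finally have eq: "expectation (\<lambda>w. F (family_of w)) = expectation (\<lambda>w. \<integral>\<xi>. F' ((family_of w)((True, 1) := \<xi>)) \<partial>?q1)" .
  have "AE w in M. \<bar>\<integral>\<xi>. F' ((family_of w)((True, 1) := \<xi>)) \<partial>?q1\<bar> \<le> ?bound"
    using AE_summable_series[OF N less_imp_le[OF \<alpha>(1)] \<alpha>(2) a d]
  proof eventually_elim
    case (elim w)
    let ?y = "family_of w"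
    let ?W = "boltzmann \<beta> a d (?y((True, 1) := {#}, (True, p) := {#}))"
    have "F' (?y((True, 1) := \<xi>)) = (\<integral>\<eta>. displacement N m n k (tanh (\<beta> * a p))
        (perturb (\<beta> * a p) \<eta> (perturb (\<beta> * a 1) \<xi> ?W)) \<partial>?qp)" for \<xi>
      unfolding F'_def F_def using elim
      by (intro Bochner_Integration.integral_cong refl displacement_cong boltzmann_update p) auto
    then show ?case
      using displacement_bound[OF N \<alpha>(1) pos_weight_boltzmann, where c = "\<beta> * a 1" and L = L and m = m and n = n
          and k = k and d = "\<beta> * a p" and q = q] \<beta> a1 L
      by (simp add: p_def)
  qed
  then have "\<bar>expectation (\<lambda>w. \<integral>\<xi>. F' ((family_of w)((True, 1) := \<xi>)) \<partial>?q1)\<bar> \<le> ?bound"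
  proof -
    have meas: "(\<lambda>w. \<integral>\<xi>. F' ((family_of w)((True, 1) := \<xi>)) \<partial>?q1) \<in> borel_measurable M"
      using measurable_compose[OF measurable_family_of expectation_resample(2)[OF indep_terms_of g1 law1 F'_meas F'2]] .
    have int: "integrable M (\<lambda>w. \<integral>\<xi>. F' ((family_of w)((True, 1) := \<xi>)) \<partial>?q1)"
      using meas abs_expectation_pmf_le[OF F'2] by (intro integrable_const_bound[where B = 2]) auto
    show ?thesis
      using \<open>AE w in M. _ \<le> ?bound\<close> int
      by (intro order_trans[OF integral_abs_bound] integral_le_const) auto
  qed
  then show ?thesis unfolding eq[symmetric] F_def p_def .
qed

lemma expectation_displacement_expansion:
  assumes N: "N \<ge> 1" and k: "k \<ge> 1" and t: "\<bar>t\<bar> \<le> 1 / 2" and R: "R \<ge> 1"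
  shows "\<bar>expectation (\<lambda>w. displacement N m n k t (boltzmann \<beta> a d (family_of w)))
      - (\<Sum>r=1..<R. t ^ (2 * r) * expectation (\<lambda>w. coeff_moment N m n k r (boltzmann \<beta> a d (family_of w))))\<bar>
     \<le> 3 ^ k * (2 * \<bar>t\<bar>) ^ (2 * R)"
proof -
  let ?W = "\<lambda>w. boltzmann \<beta> a d (family_of w)"
  have W: "(\<lambda>w. ?W w \<sigma>) \<in> borel_measurable M" for \<sigma>
    by (rule measurable_compose[OF measurable_family_of measurable_boltzmann]) (simp add: groups_def)
  have int_c: "integrable M (\<lambda>w. coeff_moment N m n k r (?W w))" for r
    using abs_coeff_moment_le[OF N pos_weight_boltzmann]
    by (intro integrable_const_bound[where B = "ratio_coeff k (2 * r) (- 1) 1 1"] measurable_coeff_moment W) auto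
  have int_d: "integrable M (\<lambda>w. displacement N m n k t (?W w))"
    using abs_displacement_le_2[OF N pos_weight_boltzmann, of t] t
    by (intro integrable_const_bound[where B = 2] measurable_displacement W) auto
  have "expectation (\<lambda>w. displacement N m n k t (?W w)) - (\<Sum>r=1..<R. t ^ (2 * r) * expectation (\<lambda>w. coeff_moment N m n k r (?W w)))
    = expectation (\<lambda>w. displacement N m n k t (?W w) - (\<Sum>r=1..<R. t ^ (2 * r) * coeff_moment N m n k r (?W w)))"
    using int_c int_d by (simp add: Bochner_Integration.integral_sum Bochner_Integration.integrable_sum)
  also have "\<bar>\<dots>\<bar> \<le> 3 ^ k * (2 * \<bar>t\<bar>) ^ (2 * R)"
    using int_c int_d displacement_expansion[OF N pos_weight_boltzmann k t R]
    by (intro order_trans[OF integral_abs_bound] integral_le_const)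
       (auto intro!: Bochner_Integration.integrable_diff Bochner_Integration.integrable_sum)
  finally show ?thesis .
qed

lemma shared_overlap_avg_eq:
  assumes c: "c \<le> 2 * r" "c \<le> 2 * s"
  shows "shared_overlap_avg M N \<beta> (hamiltonian a b lam P P' J J' i j) r s m n c
    = expectation (\<lambda>w. shared_moment N m n (2 * r) (2 * s) c (boltzmann \<beta> a (\<lambda>p. b p * lam p) (family_of w)))"
  unfolding shared_overlap_avg_def quenched_avg_def replica_avg_shared_overlap[OF c]
    boltzmann_hamiltonian[abs_def] shared_moment_def
  by (simp only: boltzmann_hamiltonian)

text \<open>As 2 r is even, \<open>(- 1) ^ (2 * r - c)\<close> equals \<open>(- 1) ^ c\<close>, one
  sign away from the identity; the factor \<open>2 * s\<close> comes from
  \<open>ratio_coeff_fact\<close>.\<close>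

lemma identity_sum_eq:
  assumes N: "N \<ge> 1" and s: "s \<ge> 1"
  shows "(\<Sum>c=0..min (2 * r) (2 * s).
          (- 1) ^ (c + 1) * (fact (2 * r + 2 * s - c - 1) / (fact c * fact (2 * r - c) * fact (2 * s - c)))
          * shared_overlap_avg M N \<beta> (hamiltonian a b lam P P' J J' i j) r s m n c)
    = - (1 / real (2 * s)) *
      expectation (\<lambda>w. coeff_moment N m n (2 * s) r (boltzmann \<beta> a (\<lambda>p. b p * lam p) (family_of w)))"
proof -
  let ?W = "\<lambda>w. boltzmann \<beta> a (\<lambda>p. b p * lam p) (family_of w)"
  let ?f = "\<lambda>c. fact (2 * r + 2 * s - c - 1) / (fact c * fact (2 * r - c) * fact (2 * s - c)) :: real"
  have W: "(\<lambda>w. ?W w \<sigma>) \<in> borel_measurable M" for \<sigma>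
    by (rule measurable_compose[OF measurable_family_of measurable_boltzmann]) (simp add: groups_def)
  have int: "integrable M (\<lambda>w. shared_moment N m n (2 * r) (2 * s) c (?W w))" for c
    using abs_shared_moment_le_1[OF N pos_weight_boltzmann]
    by (intro integrable_const_bound[where B = 1] measurable_shared_moment W) auto
  have "expectation (\<lambda>w. coeff_moment N m n (2 * s) r (?W w)) = real (2 * s) * (\<Sum>c=0..min (2 * r) (2 * s).
      (- 1) ^ (2 * r - c) * ?f c * expectation (\<lambda>w. shared_moment N m n (2 * r) (2 * s) c (?W w)))"
    using s int by (simp add: coeff_moment_eq_sum_shared Bochner_Integration.integral_sum)
  also have "(\<Sum>c=0..min (2 * r) (2 * s). (- 1) ^ (2 * r - c) * ?f c * expectation (\<lambda>w. shared_moment N m n (2 * r) (2 * s) c (?W w)))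
    = - (\<Sum>c=0..min (2 * r) (2 * s). (- 1) ^ (c + 1) * ?f c * shared_overlap_avg M N \<beta> (hamiltonian a b lam P P' J J' i j) r s m n c)"
    unfolding sum_negf[symmetric]
  proof (rule sum.cong[OF refl])
    fix c assume "c \<in> {0..min (2 * r) (2 * s)}"
    then have c: "c \<le> 2 * r" "c \<le> 2 * s" by auto
    have "(- 1 :: real) ^ (2 * r - c) = (- 1) ^ c" using c by (auto simp: minus_one_power_iff)
    then show "(- 1) ^ (2 * r - c) * ?f c * expectation (\<lambda>w. shared_moment N m n (2 * r) (2 * s) c (?W w))
       = - ((- 1) ^ (c + 1) * ?f c * shared_overlap_avg M N \<beta> (hamiltonian a b lam P P' J J' i j) r s m n c)"
      unfolding shared_overlap_avg_eq[OF c] by simp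
  qed
  finally show ?thesis using s by simp
qed

end

section \<open>Absence of bulk interactions\<close>

text \<open>Each of the \<open>u\<close> replicas of the first overlap contributes a mean of
  \<open>is\<close> or of \<open>is @ js\<close>. As \<open>u\<close> is at least two, the product
  is at most the square of the larger of these two means.\<close>

lemma abs_shared_moment_le_overlap_moments:
  assumes N: "N \<ge> 1" and W: "pos_weight N W" and u: "u \<ge> 2" "c \<le> u"
  shows "\<bar>shared_moment N m n u v c W\<bar> \<le> overlap_moment N m 2 W + overlap_moment N (m + n) 2 W"
proof -
  define x where "x = (\<lambda>is. avg N W (\<lambda>\<sigma>. spin \<sigma> is))"
  have pointwise: "\<bar>x is ^ (u - c) * x js ^ (v - c) * x (is @ js) ^ c\<bar> \<le> (x is)\<^sup>2 + (x (is @ js))\<^sup>2"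
    if "is": "is \<in> Sites N m" and js: "js \<in> Sites N n" for "is" js
  proof -
    define M where "M = max \<bar>x is\<bar> \<bar>x (is @ js)\<bar>"
    have "set (is @ js) \<subseteq> {1..N}" using SitesD[OF "is"] SitesD[OF js] by simp
    then have 1: "\<bar>x is\<bar> \<le> 1" "\<bar>x js\<bar> \<le> 1" "\<bar>x (is @ js)\<bar> \<le> 1"
      unfolding x_def using SitesD[OF "is"] SitesD[OF js] by (blast intro: abs_avg_spin_le_1[OF W])+
    have M: "0 \<le> M" "M \<le> 1" using 1 by (auto simp: M_def)
    have "\<bar>x is ^ (u - c) * x js ^ (v - c) * x (is @ js) ^ c\<bar> \<le> M ^ (u - c) * 1 * M ^ c"
      unfolding abs_mult power_abs using 1
      by (intro mult_mono power_mono power_le_one) (auto simp: M_def)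
    also have "\<dots> = M ^ u" using u by (simp flip: power_add)
    also have "\<dots> \<le> M\<^sup>2" using M u by (intro power_decreasing) auto
    also have "\<dots> \<le> (x is)\<^sup>2 + (x (is @ js))\<^sup>2" by (auto simp: M_def max_def)
    finally show ?thesis .
  qed
  have "\<bar>shared_moment N m n u v c W\<bar>
     \<le> site_mean N m (\<lambda>is. site_mean N n (\<lambda>js. \<bar>x is ^ (u - c) * x js ^ (v - c) * x (is @ js) ^ c\<bar>))"
    unfolding shared_moment_def x_def spin_append
    by (intro order_trans[OF abs_site_mean_le] site_mean_mono abs_site_mean_le)
  also have "\<dots> \<le> site_mean N m (\<lambda>is. site_mean N n (\<lambda>js. (x is)\<^sup>2 + (x (is @ js))\<^sup>2))"
    by (intro site_mean_mono pointwise)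
  also have "\<dots> = overlap_moment N m 2 W + overlap_moment N (m + n) 2 W"
    unfolding overlap_moment_def site_mean_append x_def by (simp add: site_mean_add site_mean_const[OF N])
  finally show ?thesis .
qed

text \<open>The first order in \<open>t\<close> cancels between the two signs. The constant 36 is 3
  ^ 2 * 2 ^ 2 from \<open>ratio_even_part_expansion\<close> with \<open>n = 2\<close> and
  \<open>R = 1\<close>; for larger \<open>t\<close> the bound exceeds one.\<close>

lemma tilted_moment_le:
  assumes N: "N \<ge> 1" and W: "pos_weight N W" and t: "\<bar>t\<bar> < 1" and "is": "set is \<subseteq> {1..N}"
  shows "tilted_moment N m 2 t is W \<le> overlap_moment N m 2 W + 36 * t\<^sup>2"
proof (cases "\<bar>t\<bar> \<le> 1 / 2")
  case True
  define x where "x = avg N W (\<lambda>\<sigma>. spin \<sigma> is)"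
  define y z where "y = (\<lambda>js. avg N W (\<lambda>\<sigma>. spin \<sigma> js))" and "z = (\<lambda>js. avg N W (\<lambda>\<sigma>. spin \<sigma> is * spin \<sigma> js))"
  have "tilted_moment N m 2 t is W - overlap_moment N m 2 W
     = site_mean N m (\<lambda>js. (((y js + t * z js) / (1 + t * x)) ^ 2 + ((y js + (- t) * z js) / (1 + (- t) * x)) ^ 2) / 2 - y js ^ 2)"
    by (simp add: tilted_moment_def overlap_moment_def site_mean_add[symmetric] site_mean_diff avg_tilt[OF W] x_def y_def z_def
          site_mean_cmult_right[of _ _ _ "1 / 2", simplified])
  also have "\<bar>\<dots>\<bar> \<le> 36 * t\<^sup>2"
  proof (rule abs_site_mean_bound[OF N])
    fix js assume js: "js \<in> Sites N m"
    have "set (is @ js) \<subseteq> {1..N}" using "is" SitesD[OF js] by simp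
    then have "\<bar>x\<bar> \<le> 1" "\<bar>y js\<bar> \<le> 1" "\<bar>z js\<bar> \<le> 1"
      unfolding x_def y_def z_def spin_append[symmetric] using "is" SitesD[OF js]
      by (blast intro: abs_avg_spin_le_1[OF W])+
    from ratio_even_part_expansion[OF _ True this, of 2 1]
    show "\<bar>(((y js + t * z js) / (1 + t * x)) ^ 2 + ((y js + (- t) * z js) / (1 + (- t) * x)) ^ 2) / 2 - y js ^ 2\<bar> \<le> 36 * t\<^sup>2"
      by (simp add: ratio_coeff_0 power_mult_distrib)
  qed
  finally show ?thesis by linarith
next
  case False
  then have "(1 / 2)\<^sup>2 \<le> \<bar>t\<bar>\<^sup>2" by (intro power_mono) auto
  then have "1 \<le> 36 * t\<^sup>2" by (simp add: power2_eq_square)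
  moreover have "0 \<le> overlap_moment N m 2 W"
    using site_mean_mono[of N m "\<lambda>_. 0" "\<lambda>js. avg N W (\<lambda>\<sigma>. spin \<sigma> js) ^ 2"] site_mean_const[OF N, of m 0]
    by (simp add: overlap_moment_def)
  ultimately show ?thesis using abs_tilted_moment_le_1[OF N W t "is", of m 2] by linarith
qed

lemma overlap_moment_2_nonneg: "0 \<le> overlap_moment N m 2 W"
  unfolding overlap_moment_def site_mean_def by (intro divide_nonneg_nonneg sum_nonneg) auto

text \<open>Averaged over its sites and coupling, each added term raises the moment by at most
  \<open>36 * (tanh c)\<^sup>2\<close>, and there are \<open>\<mu>\<close> terms in mean. The
  exchange of integrals in the induction lets the term added last be averaged first.\<close>

lemma expectation_overlap_moment_perturb_le:
  assumes N: "N \<ge> 1" and W: "pos_weight N W" and \<mu>: "\<mu> \<ge> 0"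
  shows "(\<integral>\<xi>. overlap_moment N m 2 (perturb c \<xi> W) \<partial>poisson_mset \<mu> (term_law N p))
    \<le> overlap_moment N m 2 W + 36 * (tanh c)\<^sup>2 * \<mu>"
proof -
  define f where "f = (\<lambda>\<xi>. overlap_moment N m 2 (perturb c \<xi> W))"
  let ?T = "36 * (tanh c)\<^sup>2"
  have f0: "0 \<le> f \<xi>" for \<xi> unfolding f_def by (rule overlap_moment_2_nonneg)
  have f1: "\<bar>f \<xi>\<bar> \<le> 1" for \<xi> unfolding f_def by (intro abs_overlap_moment_le_1 N pos_weight_perturb W)
  have add: "(\<integral>\<^sup>+x. ennreal (f (add_mset x \<xi>)) \<partial>term_law N p) \<le> ennreal (f \<xi>) + ennreal ?T" for \<xi>
  proof -
    have "(\<integral>\<^sup>+x. ennreal (f (add_mset x \<xi>)) \<partial>term_law N p) = ennreal (\<integral>x. f (add_mset x \<xi>) \<partial>term_law N p)"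
      by (intro nn_integral_eq_integral integrable_pmf_bounded[OF f1]) (simp add: f0)
    also have "(\<integral>x. f (add_mset x \<xi>) \<partial>term_law N p) = site_mean N p (\<lambda>is. tilted_moment N m 2 (tanh c) is (perturb c \<xi> W))"
      unfolding expectation_term_law[OF N] f_def
      by (intro site_mean_cong) (simp add: overlap_moment_perturb_add_mset[OF SitesD] tilted_moment_def)
    also have "\<dots> \<le> site_mean N p (\<lambda>is. f \<xi> + ?T)"
      unfolding f_def using SitesD
      by (intro site_mean_mono tilted_moment_le N pos_weight_perturb W abs_tanh_less_1) auto
    also have "\<dots> = f \<xi> + ?T" by (rule site_mean_const[OF N])
    finally show ?thesis using f0[of \<xi>] by (simp add: ennreal_plus[symmetric] ennreal_leI del: ennreal_plus)
  qed
  have iid: "(\<integral>\<^sup>+\<xi>. ennreal (f \<xi>) \<partial>iid_mset k (term_law N p)) \<le> ennreal (overlap_moment N m 2 W) + ennreal ?T * of_nat k" for k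
  proof (induction k)
    case 0
    have "perturb c {#} W = W" by (simp add: perturb_def fun_eq_iff)
    then show ?case by (simp add: f_def)
  next
    case (Suc k)
    have "(\<integral>\<^sup>+\<xi>. ennreal (f \<xi>) \<partial>iid_mset (Suc k) (term_law N p))
       = (\<integral>\<^sup>+\<xi>. \<integral>\<^sup>+x. ennreal (f (add_mset x \<xi>)) \<partial>term_law N p \<partial>iid_mset k (term_law N p))"
      unfolding nn_integral_iid_mset_Suc by (rule nn_integral_pmf_swap)
    also have "\<dots> \<le> (\<integral>\<^sup>+\<xi>. ennreal (f \<xi>) + ennreal ?T \<partial>iid_mset k (term_law N p))"
      by (intro nn_integral_mono add)
    also have "\<dots> = (\<integral>\<^sup>+\<xi>. ennreal (f \<xi>) \<partial>iid_mset k (term_law N p)) + ennreal ?T"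
      by (subst nn_integral_add) (simp_all add: measure_pmf.emeasure_space_1[simplified])
    also have "\<dots> \<le> ennreal (overlap_moment N m 2 W) + ennreal ?T * of_nat k + ennreal ?T"
      by (intro add_right_mono Suc.IH)
    also have "\<dots> = ennreal (overlap_moment N m 2 W) + ennreal ?T * of_nat (Suc k)"
      by (simp add: distrib_left distrib_right ac_simps)
    finally show ?case .
  qed
  have "ennreal (\<integral>\<xi>. f \<xi> \<partial>poisson_mset \<mu> (term_law N p)) = (\<integral>\<^sup>+\<xi>. ennreal (f \<xi>) \<partial>poisson_mset \<mu> (term_law N p))"
    by (intro nn_integral_eq_integral[symmetric] integrable_pmf_bounded[OF f1]) (simp add: f0)
  also have "\<dots> \<le> (\<integral>\<^sup>+k. ennreal (overlap_moment N m 2 W) + ennreal ?T * of_nat k \<partial>poisson_law \<mu>)"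
    unfolding poisson_mset_def nn_integral_bind_pmf by (intro nn_integral_mono iid)
  also have "\<dots> = ennreal (overlap_moment N m 2 W) + ennreal ?T * (\<integral>\<^sup>+k. of_nat k \<partial>poisson_law \<mu>)"
    by (subst nn_integral_add) (simp_all add: nn_integral_cmult measure_pmf.emeasure_space_1[simplified])
  also have "(\<integral>\<^sup>+k. of_nat k \<partial>poisson_law \<mu>) = ennreal \<mu>"
    using nn_integral_poisson_law_Suc[OF \<mu>, of "\<lambda>_. 1"] by (simp add: measure_pmf.emeasure_space_1[simplified])
  also have "ennreal (overlap_moment N m 2 W) + ennreal ?T * ennreal \<mu> = ennreal (overlap_moment N m 2 W + ?T * \<mu>)"
    using \<mu> overlap_moment_2_nonneg[of N m W] by (simp add: ennreal_mult ennreal_plus)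
  finally show ?thesis
    using \<mu> overlap_moment_2_nonneg[of N m W] unfolding f_def by (subst (asm) ennreal_le_iff) auto
qed

text \<open>Flipping \<open>x\<close> is an involution of the configurations that preserves the
  weight and reverses the spin product.\<close>

lemma avg_eq_0_of_flip:
  assumes x: "x \<in> {1..N}" and W: "\<And>\<sigma>. \<sigma> \<in> configs N \<Longrightarrow> W (\<sigma>(x := - \<sigma> x)) = W \<sigma>"
    and ks: "x \<notin> set ks"
  shows "avg N W (\<lambda>\<sigma>. spin \<sigma> (x # ks)) = 0"
proof -
  let ?flip = "\<lambda>\<sigma> :: nat \<Rightarrow> real. \<sigma>(x := - \<sigma> x)"
  have flip_mem: "?flip \<sigma> \<in> configs N" if "\<sigma> \<in> configs N" for \<sigma>
    using that x unfolding configs_def by (auto simp: PiE_iff extensional_def)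
  have spin_flip: "spin (?flip \<sigma>) (x # ks) = - spin \<sigma> (x # ks)" for \<sigma>
  proof -
    have "spin (?flip \<sigma>) ks = spin \<sigma> ks"
      unfolding spin_def using ks by (intro arg_cong[where f = prod_list] map_cong) auto
    then show ?thesis by simp
  qed
  have "(\<Sum>\<sigma>\<in>configs N. W \<sigma> * spin \<sigma> (x # ks)) = (\<Sum>\<sigma>\<in>configs N. W (?flip \<sigma>) * spin (?flip \<sigma>) (x # ks))"
    by (rule sum.reindex_bij_witness[where i = ?flip and j = ?flip]) (auto simp: flip_mem)
  also have "\<dots> = - (\<Sum>\<sigma>\<in>configs N. W \<sigma> * spin \<sigma> (x # ks))"
    unfolding sum_negf[symmetric] by (intro sum.cong refl) (simp only: W spin_flip mult_minus_right)
  finally show ?thesis by (simp add: avg_def)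
qed

text \<open>Unless the first site lies in \<open>T\<close> or recurs among the other
  \<open>m\<close>, \<open>avg_eq_0_of_flip\<close> makes the mean of the spin product
  vanish.\<close>

lemma overlap_moment_le_of_flips:
  assumes N: "N \<ge> 1" and pos: "pos_weight N W" and T: "finite T"
    and W: "\<And>\<sigma> x. \<sigma> \<in> configs N \<Longrightarrow> x \<in> {1..N} - T \<Longrightarrow> W (\<sigma>(x := - \<sigma> x)) = W \<sigma>"
  shows "overlap_moment N (Suc m) 2 W \<le> (real (card T) + real m) / real N"
proof -
  define h where "h = (\<lambda>x ks. avg N W (\<lambda>\<sigma>. spin \<sigma> (x # ks)) ^ 2)"
  have "overlap_moment N (Suc m) 2 W = site_mean N m (\<lambda>ks. \<Sum>x=1..N. h x ks) / real N"
    by (simp add: overlap_moment_def site_mean_Suc site_mean_sum h_def)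
  also have "\<dots> \<le> site_mean N m (\<lambda>ks. real (card T) + real m) / real N"
  proof (intro divide_right_mono site_mean_mono)
    fix ks assume ks: "ks \<in> Sites N m"
    have "h x ks \<le> of_bool (x \<in> T \<union> set ks)" if x: "x \<in> {1..N}" for x
    proof (cases "x \<in> T \<union> set ks")
      case True
      have "\<bar>avg N W (\<lambda>\<sigma>. spin \<sigma> (x # ks))\<bar> \<le> 1"
        using x SitesD[OF ks] by (intro abs_avg_spin_le_1[OF pos]) auto
      then show ?thesis using True by (simp add: h_def abs_square_le_1)
    next
      case False
      then have "avg N W (\<lambda>\<sigma>. spin \<sigma> (x # ks)) = 0" using x by (intro avg_eq_0_of_flip W) auto
      with False show ?thesis by (simp add: h_def)
    qed
    then have "(\<Sum>x=1..N. h x ks) \<le> (\<Sum>x=1..N. of_bool (x \<in> T \<union> set ks))" by (intro sum_mono) auto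
    also have "\<dots> = real (card ({1..N} \<inter> (T \<union> set ks)))"
      by (subst sum_of_bool_eq) (auto intro!: arg_cong[where f = card])
    also have "\<dots> \<le> real (card T + m)"
    proof -
      have "card ({1..N} \<inter> (T \<union> set ks)) \<le> card (T \<union> set ks)" using T by (intro card_mono) auto
      also have "\<dots> \<le> card T + card (set ks)" by (rule card_Un_le)
      also have "card (set ks) \<le> m" using card_length[of ks] ks by (simp add: Sites_def)
      finally show ?thesis by simp
    qed
    finally show "(\<Sum>x=1..N. h x ks) \<le> real (card T) + real m" by simp
  qed simp
  also have "\<dots> = (real (card T) + real m) / real N" by (simp add: site_mean_const[OF N])
  finally show ?thesis .
qed

section \<open>Truncated perturbations\<close>

lemma energy_flip:
  assumes "\<And>z. z \<in># \<xi> \<Longrightarrow> x \<notin> set (snd z)"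
  shows "energy \<xi> (\<sigma>(x := v)) = energy \<xi> \<sigma>"
proof -
  have "spin (\<sigma>(x := v)) (snd z) = spin \<sigma> (snd z)" if "z \<in># \<xi>" for z
    unfolding spin_def using assms[OF that] by (intro arg_cong[where f = prod_list] map_cong) auto
  then show ?thesis
    unfolding energy_def by (intro arg_cong[where f = sum_mset] image_mset_cong) simp
qed

lemma card_sites_of_terms_le:
  assumes "\<And>z. z \<in># \<xi> \<Longrightarrow> length (snd z) = p"
  shows "card (\<Union>z\<in>set_mset \<xi>. set (snd z)) \<le> p * size \<xi>"
  using assms
proof (induction \<xi>)
  case (add z \<xi>)
  have "card (\<Union>z\<in>set_mset (add_mset z \<xi>). set (snd z)) \<le> card (set (snd z)) + card (\<Union>z\<in>set_mset \<xi>. set (snd z))"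
    by (simp add: card_Un_le)
  also have "card (set (snd z)) \<le> p" using card_length[of "snd z"] add.prems by simp
  also have "card (\<Union>z\<in>set_mset \<xi>. set (snd z)) \<le> p * size \<xi>" using add by simp
  finally show ?case by simp
qed simp

text \<open>The weight of the perturbing terms of order at most \<open>R\<close>, with the inverse
  temperature absorbed in \<open>e\<close>. Bulk terms are left out, since for
  \<open>\<alpha> = 0\<close> or \<open>\<beta> = 0\<close> they do not act.\<close>

definition partial_weight ::
  "(nat \<Rightarrow> real) \<Rightarrow> nat \<Rightarrow> (bool \<times> nat \<Rightarrow> (int \<times> nat list) multiset) \<Rightarrow> (nat \<Rightarrow> real) \<Rightarrow> real" where
  "partial_weight e R y \<sigma> = exp (\<Sum>t<R. e (Suc t) * energy (y (False, Suc t)) \<sigma>)"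

lemma pos_weight_partial [simp]: "pos_weight N (partial_weight e R y)"
  by (simp add: pos_weight_def partial_weight_def)

lemma partial_weight_update:
  "partial_weight e (Suc R) (y((False, Suc R) := \<xi>)) = perturb (e (Suc R)) \<xi> (partial_weight e R y)"
proof
  fix \<sigma>
  have "(\<Sum>t<R. e (Suc t) * energy ((y((False, Suc R) := \<xi>)) (False, Suc t)) \<sigma>) = (\<Sum>t<R. e (Suc t) * energy (y (False, Suc t)) \<sigma>)"
    by (intro sum.cong) auto
  then show "partial_weight e (Suc R) (y((False, Suc R) := \<xi>)) \<sigma> = perturb (e (Suc R)) \<xi> (partial_weight e R y) \<sigma>"
    by (simp add: partial_weight_def perturb_def mult_exp_exp add.commute)
qed

lemma measurable_partial_weight:
  assumes "UNIV \<times> {1..} \<subseteq> G"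
  shows "(\<lambda>y. partial_weight e R y \<sigma>) \<in> borel_measurable (term_family G)"
proof -
  have [measurable]: "(\<lambda>y. energy (y (False, Suc t)) \<sigma>) \<in> borel_measurable (term_family G)" for t
    using assms by (intro measurable_compose[OF measurable_component_singleton]) auto
  show ?thesis unfolding partial_weight_def by measurable
qed

lemma tanh_square_le: "(tanh x)\<^sup>2 \<le> x\<^sup>2" for x :: real
proof -
  have le: "tanh y \<le> y" if "0 \<le> y" for y :: real
  proof -
    have "0 - tanh 0 \<le> y - tanh y"
    proof (rule DERIV_nonneg_imp_nondecreasing[OF that, where f = "\<lambda>y. y - tanh y"])
      fix z :: real
      have "((\<lambda>y. y - tanh y) has_field_derivative (tanh z)\<^sup>2) (at z)"
        using cosh_real_pos[of z] by (auto intro!: derivative_eq_intros)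
      then show "\<exists>d. ((\<lambda>y. y - tanh y) has_field_derivative d) (at z) \<and> 0 \<le> d" by force
    qed
    then show ?thesis by simp
  qed
  have "\<bar>tanh x\<bar> \<le> \<bar>x\<bar>" using le[of "\<bar>x\<bar>"] by simp
  then show ?thesis by (simp add: abs_le_square_iff)
qed

context quenched_disorder begin

lemma AE_terms_length:
  assumes N: "N \<ge> 1" and p: "snd g \<ge> 1"
  shows "AE w in M. \<forall>z\<in>#terms_of g w. length (snd z) = snd g"
proof -
  have rv: "terms_of g \<in> measurable M (count_space UNIV)"
    using indep_terms_of p by (cases g) (auto simp: indep_vars_def groups_def)
  have "AE \<xi> in distr M (count_space UNIV) (terms_of g). \<forall>z\<in>#\<xi>. length (snd z) = snd g"
    unfolding law_terms_of[OF N p] AE_measure_pmf_iff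
  proof (intro ballI)
    fix \<xi> z assume "\<xi> \<in> set_pmf (poisson_mset (rate g) (term_law N (snd g)))" "z \<in># \<xi>"
    then have "z \<in> {-1, 1} \<times> Sites N (snd g)"
      using set_pmf_poisson_mset set_pmf_term_law[OF N] by blast
    then show "length (snd z) = snd g" by (auto simp: Sites_def)
  qed
  then show ?thesis by (subst (asm) AE_distr_iff[OF rv]) auto
qed

lemma expectation_size_terms_of:
  assumes N: "N \<ge> 1" and p: "snd g \<ge> 1" and rate: "rate g \<ge> 0"
  shows "integrable M (\<lambda>w. real (size (terms_of g w)))" "expectation (\<lambda>w. real (size (terms_of g w))) = rate g"
proof -
  have rv: "terms_of g \<in> measurable M (count_space UNIV)"
    using indep_terms_of p by (cases g) (auto simp: indep_vars_def groups_def)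
  have "integrable (distr M (count_space UNIV) (terms_of g)) (\<lambda>\<xi>. real (size \<xi>))"
    unfolding law_terms_of[OF N p] by (rule integrable_size_poisson_mset[OF rate])
  then show "integrable M (\<lambda>w. real (size (terms_of g w)))"
    by (subst (asm) integrable_distr_eq[OF rv]) simp_all
  show "expectation (\<lambda>w. real (size (terms_of g w))) = rate g"
  proof -
    have "expectation (\<lambda>w. real (size (terms_of g w))) = (\<integral>\<xi>. real (size \<xi>) \<partial>distr M (count_space UNIV) (terms_of g))"
      by (rule integral_distr[OF rv, symmetric]) simp
    also have "\<dots> = rate g" unfolding law_terms_of[OF N p] by (rule expectation_size_poisson_mset[OF rate])
    finally show ?thesis .
  qed
qed

lemma integrable_overlap_moment_partial:
  assumes N: "N \<ge> 1"
  shows "integrable M (\<lambda>w. overlap_moment N m k (partial_weight e R (family_of w)))"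
  using abs_overlap_moment_le_1[OF N pos_weight_partial]
  by (intro integrable_const_bound[where B = 1] measurable_overlap_moment
      measurable_compose[OF measurable_family_of measurable_partial_weight]) (auto simp: groups_def)

text \<open>Resampling the last group reduces the step to
  \<open>expectation_overlap_moment_perturb_le\<close>; bounding tanh by its argument leaves
  increments that are summable in \<open>R\<close>.\<close>

lemma expectation_overlap_moment_partial_Suc:
  assumes N: "N \<ge> 1" and \<alpha>': "\<alpha>' \<ge> 0"
  shows "expectation (\<lambda>w. overlap_moment N m 2 (partial_weight e (Suc R) (family_of w)))
    \<le> expectation (\<lambda>w. overlap_moment N m 2 (partial_weight e R (family_of w))) + 36 * (e (Suc R))\<^sup>2 * \<alpha>'"
proof -
  let ?g = "(False, Suc R)" and ?q = "poisson_mset \<alpha>' (term_law N (Suc R))"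
  define F where "F = (\<lambda>y. overlap_moment N m 2 (partial_weight e (Suc R) y))"
  have F1: "\<bar>F y\<bar> \<le> 1" for y unfolding F_def by (intro abs_overlap_moment_le_1 N pos_weight_partial)
  have F_meas: "F \<in> borel_measurable (term_family groups)"
    unfolding F_def by (intro measurable_overlap_moment measurable_partial_weight) (simp add: groups_def)
  have law: "distr M (count_space UNIV) (terms_of ?g) = measure_pmf ?q"
    using law_terms_of[OF N, of ?g] by (simp add: rate_def)
  have g: "?g \<in> groups" by (simp add: groups_def)
  have "expectation (\<lambda>w. F (family_of w)) = expectation (\<lambda>w. \<integral>\<xi>. F ((family_of w)(?g := \<xi>)) \<partial>?q)"
    unfolding family_of_def by (rule expectation_resample(1)[OF indep_terms_of g law F_meas F1])
  also have "\<dots> \<le> expectation (\<lambda>w. overlap_moment N m 2 (partial_weight e R (family_of w)) + 36 * (e (Suc R))\<^sup>2 * \<alpha>')"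
  proof (rule integral_mono)
    have "(\<lambda>w. \<integral>\<xi>. F ((family_of w)(?g := \<xi>)) \<partial>?q) \<in> borel_measurable M"
      using measurable_compose[OF measurable_family_of expectation_resample(2)[OF indep_terms_of g law F_meas F1]] .
    then show "integrable M (\<lambda>w. \<integral>\<xi>. F ((family_of w)(?g := \<xi>)) \<partial>?q)"
      using abs_expectation_pmf_le[OF F1] by (intro integrable_const_bound[where B = 1]) auto
    show "integrable M (\<lambda>w. overlap_moment N m 2 (partial_weight e R (family_of w)) + 36 * (e (Suc R))\<^sup>2 * \<alpha>')"
      using integrable_overlap_moment_partial[OF N] by simp
    fix w
    have "(\<integral>\<xi>. F ((family_of w)(?g := \<xi>)) \<partial>?q)
       \<le> overlap_moment N m 2 (partial_weight e R (family_of w)) + 36 * (tanh (e (Suc R)))\<^sup>2 * \<alpha>'"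
      unfolding F_def partial_weight_update
      by (rule expectation_overlap_moment_perturb_le[OF N pos_weight_partial \<alpha>'])
    also have "(tanh (e (Suc R)))\<^sup>2 \<le> (e (Suc R))\<^sup>2"
      by (rule tanh_square_le)
    finally show "(\<integral>\<xi>. F ((family_of w)(?g := \<xi>)) \<partial>?q)
       \<le> overlap_moment N m 2 (partial_weight e R (family_of w)) + 36 * (e (Suc R))\<^sup>2 * \<alpha>'"
      using \<alpha>' by (simp add: mult_right_mono)
  qed
  also have "\<dots> = expectation (\<lambda>w. overlap_moment N m 2 (partial_weight e R (family_of w))) + 36 * (e (Suc R))\<^sup>2 * \<alpha>'"
    using integrable_overlap_moment_partial[OF N] by (simp add: prob_space)
  finally show ?thesis unfolding F_def .
qed

text \<open>A p-spin group touches at most p sites per term and has \<open>\<alpha>'\<close> terms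
  in mean, independently of N. All other sites can be flipped freely.\<close>

lemma expectation_overlap_moment_partial:
  assumes N: "N \<ge> 1" and \<alpha>': "\<alpha>' \<ge> 0"
  shows "expectation (\<lambda>w. overlap_moment N (Suc m) 2 (partial_weight e R (family_of w)))
    \<le> (real m + (\<Sum>t<R. real (Suc t) * \<alpha>')) / real N"
proof -
  have rate: "rate (False, p) = \<alpha>'" for p by (simp add: rate_def)
  have len: "AE w in M. \<forall>t. \<forall>z\<in>#terms_of (False, Suc t) w. length (snd z) = Suc t"
    unfolding AE_all_countable using AE_terms_length[OF N, of "(False, Suc t)" for t] by simp
  have "AE w in M. overlap_moment N (Suc m) 2 (partial_weight e R (family_of w))
      \<le> (real m + (\<Sum>t<R. real (Suc t) * real (size (terms_of (False, Suc t) w)))) / real N"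
    using len
  proof eventually_elim
    case (elim w)
    define T where "T = (\<Union>t<R. \<Union>z\<in>set_mset (terms_of (False, Suc t) w). set (snd z))"
    have "overlap_moment N (Suc m) 2 (partial_weight e R (family_of w)) \<le> (real (card T) + real m) / real N"
    proof (rule overlap_moment_le_of_flips[OF N pos_weight_partial])
      show "finite T" by (simp add: T_def)
      fix \<sigma> x assume x: "x \<in> {1..N} - T"
      show "partial_weight e R (family_of w) (\<sigma>(x := - \<sigma> x)) = partial_weight e R (family_of w) \<sigma>"
        unfolding partial_weight_def using x
        by (intro arg_cong[where f = exp] sum.cong refl arg_cong2[where f = times] energy_flip) (auto simp: T_def)
    qed
    also have "real (card T) \<le> (\<Sum>t<R. real (Suc t) * real (size (terms_of (False, Suc t) w)))"
    proof -
      have "card T \<le> (\<Sum>t<R. card (\<Union>z\<in>set_mset (terms_of (False, Suc t) w). set (snd z)))"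
        unfolding T_def by (rule card_UN_le) simp
      also have "\<dots> \<le> (\<Sum>t<R. Suc t * size (terms_of (False, Suc t) w))"
        using elim by (intro sum_mono card_sites_of_terms_le) auto
      finally have "real (card T) \<le> real (\<Sum>t<R. Suc t * size (terms_of (False, Suc t) w))"
        by (simp only: of_nat_le_iff)
      then show ?thesis by (simp only: of_nat_sum of_nat_mult)
    qed
    finally show ?case by (simp add: divide_right_mono add.commute)
  qed
  then have "expectation (\<lambda>w. overlap_moment N (Suc m) 2 (partial_weight e R (family_of w)))
    \<le> expectation (\<lambda>w. (real m + (\<Sum>t<R. real (Suc t) * real (size (terms_of (False, Suc t) w)))) / real N)"
    using expectation_size_terms_of(1)[OF N, of "(False, Suc t)" for t] \<alpha>'
    by (intro integral_mono_AE integrable_overlap_moment_partial N)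
       (auto simp: rate intro!: Bochner_Integration.integrable_add Bochner_Integration.integrable_sum)
  also have "\<dots> = (real m + (\<Sum>t<R. real (Suc t) * \<alpha>')) / real N"
    using expectation_size_terms_of[OF N, of "(False, Suc t)" for t] \<alpha>'
    by (simp add: rate Bochner_Integration.integral_sum prob_space del: of_nat_Suc)
  finally show ?thesis .
qed

text \<open>The perturbation is split at order \<open>R\<close>. The lower orders touch boundedly
  many sites in mean and cost O(1 / N); the higher ones raise the moment by at most a tail of a
  convergent series, uniformly in N.\<close>

lemma degenerate_overlap_moment:
  assumes N: "N \<ge> 1" and \<alpha>': "\<alpha>' \<ge> 0" and degenerate: "\<alpha> = 0 \<or> \<beta> = 0"
    and a: "summable (\<lambda>t. (a (Suc t))\<^sup>2)" and d: "summable (\<lambda>t. (d (Suc t))\<^sup>2)"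
  shows "expectation (\<lambda>w. overlap_moment N (Suc m) 2 (boltzmann \<beta> a d (family_of w)))
    \<le> (real m + (\<Sum>t<R. real (Suc t) * \<alpha>')) / real N + 36 * \<beta>\<^sup>2 * \<alpha>' * (\<Sum>t. (d (Suc (t + R)))\<^sup>2)"
proof -
  define e where "e = (\<lambda>p. \<beta> * d p)"
  have e: "summable (\<lambda>t. (e (Suc t))\<^sup>2)" using summable_mult[OF d, of "\<beta>\<^sup>2"] by (simp add: e_def power_mult_distrib)
  define E where "E = (\<lambda>k. expectation (\<lambda>w. overlap_moment N (Suc m) 2 (partial_weight e k (family_of w))))"
  have step: "E (k + R) \<le> E R + 36 * \<alpha>' * (\<Sum>t<k. (e (Suc (t + R)))\<^sup>2)" for k
  proof (induction k)
    case (Suc k)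
    have "E (Suc k + R) \<le> E (k + R) + 36 * (e (Suc (k + R)))\<^sup>2 * \<alpha>'"
      unfolding E_def add_Suc by (rule expectation_overlap_moment_partial_Suc[OF N \<alpha>'])
    with Suc.IH show ?case by (simp add: algebra_simps)
  qed simp
  have tail: "(\<Sum>t<k. (e (Suc (t + R)))\<^sup>2) \<le> (\<Sum>t. (e (Suc (t + R)))\<^sup>2)" for k
    using summable_ignore_initial_segment[OF e, of R] by (intro sum_le_suminf) auto
  have bound: "E k \<le> (real m + (\<Sum>t<R. real (Suc t) * \<alpha>')) / real N + 36 * \<alpha>' * (\<Sum>t. (e (Suc (t + R)))\<^sup>2)"
    if "k \<ge> R" for k
  proof -
    have "E k \<le> E R + 36 * \<alpha>' * (\<Sum>t<k - R. (e (Suc (t + R)))\<^sup>2)" using step[of "k - R"] that by simp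
    also have "\<dots> \<le> E R + 36 * \<alpha>' * (\<Sum>t. (e (Suc (t + R)))\<^sup>2)"
      using \<alpha>' tail by (intro add_left_mono mult_left_mono) auto
    also have "E R \<le> (real m + (\<Sum>t<R. real (Suc t) * \<alpha>')) / real N"
      unfolding E_def by (rule expectation_overlap_moment_partial[OF N \<alpha>'])
    finally show ?thesis by simp
  qed
  \<comment> \<open>For \<open>\<alpha> = 0\<close> the bulk samples are almost surely empty, and
    for \<open>\<beta> = 0\<close> the factor vanishes.\<close>
  have no_terms: "AE w in M. \<forall>t. \<forall>\<sigma>. \<beta> * energy (terms_of (True, Suc t) w) \<sigma> = 0"
  proof (cases "\<beta> = 0")
    case False
    with degenerate have \<alpha>0: "\<alpha> = 0" by simp
    show ?thesis
      unfolding AE_all_countable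
    proof
      fix t
      have rv: "terms_of (True, Suc t) \<in> measurable M (count_space UNIV)"
        using indep_terms_of by (auto simp: indep_vars_def groups_def)
      have law0: "distr M (count_space UNIV) (terms_of (True, Suc t)) = measure_pmf (return_pmf {#})"
      proof -
        have "rate (True, Suc t) = 0" by (simp add: rate_def) (simp add: \<alpha>0)
        then show ?thesis
          using law_terms_of[OF N, of "(True, Suc t)"] by (simp add: poisson_mset_def poisson_law_def bind_return_pmf)
      qed
      have "AE \<xi> in distr M (count_space UNIV) (terms_of (True, Suc t)). \<xi> = {#}"
        unfolding law0 AE_measure_pmf_iff by simp
      then have "AE w in M. terms_of (True, Suc t) w = {#}"
        by (subst (asm) AE_distr_iff[OF rv]) auto
      then show "AE w in M. \<forall>\<sigma>. \<beta> * energy (terms_of (True, Suc t) w) \<sigma> = 0"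
        by eventually_elim simp
    qed
  qed simp
  have summ: "AE w in M. \<forall>\<sigma>\<in>configs N. summable (\<lambda>t. d (Suc t) * energy (terms_of (False, Suc t) w) \<sigma>)"
  proof (subst AE_ball_countable)
    show "countable (configs N)" by (intro countable_finite) simp
    show "\<forall>\<sigma>\<in>configs N. AE w in M. summable (\<lambda>t. d (Suc t) * energy (terms_of (False, Suc t) w) \<sigma>)"
      using \<alpha>' by (intro ballI AE_summable_energy N d) (simp add: rate_def)
  qed
  have conv: "AE w in M. (\<lambda>k. overlap_moment N (Suc m) 2 (partial_weight e k (family_of w)))
      \<longlonglongrightarrow> overlap_moment N (Suc m) 2 (boltzmann \<beta> a d (family_of w))"
    using no_terms summ
  proof eventually_elim
    case (elim w)
    let ?y = "family_of w"
    have "(\<lambda>k. partial_weight e k ?y \<sigma>) \<longlonglongrightarrow> boltzmann \<beta> a d ?y \<sigma>" if \<sigma>: "\<sigma> \<in> configs N" for \<sigma>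
    proof (cases "\<beta> = 0")
      case True
      then show ?thesis by (simp add: partial_weight_def boltzmann_def e_def)
    next
      case False
      then have "series_term a d ?y \<sigma> t = d (Suc t) * energy (terms_of (False, Suc t) w) \<sigma>" for t
        using elim(1) by (simp add: series_term_def)
      then have "(\<lambda>k. \<Sum>t<k. d (Suc t) * energy (terms_of (False, Suc t) w) \<sigma>) \<longlonglongrightarrow> (\<Sum>t. series_term a d ?y \<sigma> t)"
        using summable_LIMSEQ[OF bspec[OF elim(2) \<sigma>]] by simp
      from tendsto_exp[OF tendsto_mult_left[OF this, of \<beta>]]
      show ?thesis by (simp add: partial_weight_def boltzmann_def e_def sum_distrib_left mult.assoc)
    qed
    moreover have "(\<Sum>\<sigma>\<in>configs N. boltzmann \<beta> a d ?y \<sigma>) \<noteq> 0"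
      by (intro less_imp_neq[THEN not_sym] pos_weight_sum pos_weight_boltzmann)
    ultimately show ?case
      unfolding overlap_moment_def site_mean_def avg_def using N by (intro tendsto_intros) auto
  qed
  have W: "(\<lambda>w. boltzmann \<beta> a d (family_of w) \<sigma>) \<in> borel_measurable M" for \<sigma>
    by (rule measurable_compose[OF measurable_family_of measurable_boltzmann]) (simp add: groups_def)
  \<comment> \<open>The full weight is an almost sure limit of truncated ones on the finitely many
    configurations; dominated convergence carries the bound over to it.\<close>
  have "E \<longlonglongrightarrow> expectation (\<lambda>w. overlap_moment N (Suc m) 2 (boltzmann \<beta> a d (family_of w)))"
    unfolding E_def
  proof (rule integral_dominated_convergence[where w = "\<lambda>_. 1"])
    show "(\<lambda>w. overlap_moment N (Suc m) 2 (boltzmann \<beta> a d (family_of w))) \<in> borel_measurable M"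
      by (rule measurable_overlap_moment[OF W])
    show "(\<lambda>w. overlap_moment N (Suc m) 2 (partial_weight e k (family_of w))) \<in> borel_measurable M" for k
      by (rule borel_measurable_integrable[OF integrable_overlap_moment_partial[OF N]])
  qed (use conv abs_overlap_moment_le_1[OF N pos_weight_partial] in auto)
  then have "expectation (\<lambda>w. overlap_moment N (Suc m) 2 (boltzmann \<beta> a d (family_of w)))
     \<le> (real m + (\<Sum>t<R. real (Suc t) * \<alpha>')) / real N + 36 * \<alpha>' * (\<Sum>t. (e (Suc (t + R)))\<^sup>2)"
    using bound by (intro LIMSEQ_le_const2) auto
  also have "(\<Sum>t. (e (Suc (t + R)))\<^sup>2) = \<beta>\<^sup>2 * (\<Sum>t. (d (Suc (t + R)))\<^sup>2)"
    unfolding e_def power_mult_distrib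
    by (rule suminf_mult) (rule summable_ignore_initial_segment[OF d, of R])
  finally show ?thesis by (simp add: mult_ac)
qed

end

section \<open>The identities\<close>

text \<open>\<open>L\<close> is chosen first to make \<open>T L\<close> small, then N, so
  \<open>A\<close> may grow arbitrarily. The parameter is the number of field strengths in the main
  case and the truncation order in the degenerate one.\<close>

lemma LIMSEQ_two_scale:
  fixes f g :: "nat \<Rightarrow> real" and A T :: "nat \<Rightarrow> real"
  assumes bound: "\<And>N L. N \<ge> 1 \<Longrightarrow> L \<ge> 1 \<Longrightarrow> \<bar>f N\<bar> \<le> A L * g N + T L"
    and g: "g \<longlonglongrightarrow> 0" and T: "T \<longlonglongrightarrow> 0"
  shows "f \<longlonglongrightarrow> 0"
proof (rule LIMSEQ_I)
  fix \<epsilon> :: real assume \<epsilon>: "\<epsilon> > 0"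
  have "\<forall>\<^sub>F L in sequentially. T L < \<epsilon> / 2" using T \<epsilon> by (intro order_tendstoD) auto
  then have "\<forall>\<^sub>F L in sequentially. T L < \<epsilon> / 2 \<and> L \<ge> 1"
    using eventually_ge_at_top[of 1] by eventually_elim auto
  then obtain L where L: "T L < \<epsilon> / 2" "L \<ge> 1"
    using eventually_happens'[OF sequentially_bot] by blast
  have "(\<lambda>N. A L * g N) \<longlonglongrightarrow> A L * 0" by (intro tendsto_intros g)
  then have "\<forall>\<^sub>F N in sequentially. A L * g N < \<epsilon> / 2" using \<epsilon> by (intro order_tendstoD) auto
  then have "\<forall>\<^sub>F N in sequentially. \<bar>f N\<bar> < \<epsilon>"
    using eventually_ge_at_top[of 1]
  proof eventually_elim
    case (elim N)
    then show ?case using bound[of N L] L by linarith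
  qed
  then show "\<exists>no. \<forall>N\<ge>no. norm (f N - 0) < \<epsilon>" by (simp add: eventually_sequentially)
qed

context quenched_disorder begin

text \<open>The existential functions of the strength and of the degree hide the disorder of size N,
  so that they can be chosen for all N at once outside the locale.\<close>

lemma identity_sum_expansion:
  assumes N: "N \<ge> 1" and \<alpha>: "\<alpha> > 0" "\<alpha>' \<ge> 0" and \<beta>: "\<beta> \<noteq> 0" and a1: "a 1 \<noteq> 0"
    and a: "summable (\<lambda>t. (a (Suc t))\<^sup>2)" and d: "summable (\<lambda>t. (b (Suc t) * lam (Suc t))\<^sup>2)"
    and m: "m \<ge> 1" and s: "s \<ge> 1"
  shows "\<exists>dN DN. (\<forall>R u. R \<ge> 1 \<longrightarrow> \<bar>u\<bar> \<le> 1 / 2 \<longrightarrow>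
        \<bar>dN u - (\<Sum>r=1..<R. u ^ (2 * r) * DN r)\<bar> \<le> 3 ^ (2 * s) * (2 * \<bar>u\<bar>) ^ (2 * R))
    \<and> (\<forall>q L. q \<ge> 1 \<longrightarrow> L \<ge> 1 \<longrightarrow> \<bar>dN (tanh (\<beta> * a (m + q)))\<bar>
        \<le> displacement_const \<alpha> q (2 * s) (tanh (\<beta> * a (m + q))) L / sqrt (real N)
          + real (2 * s) * (2 / (1 - \<bar>tanh (\<beta> * a (m + q))\<bar>)) * real q * (4 * exp (\<alpha> / 2) / (\<bar>tanh (\<beta> * a 1)\<bar> * real L)))
    \<and> (\<forall>r. (\<Sum>c=0..min (2 * r) (2 * s).
          (- 1) ^ (c + 1) * (fact (2 * r + 2 * s - c - 1) / (fact c * fact (2 * r - c) * fact (2 * s - c)))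
          * shared_overlap_avg M N \<beta> (hamiltonian a b lam P P' J J' i j) r s m n c) = - (1 / real (2 * s)) * DN r)"
proof -
  let ?W = "\<lambda>w. boltzmann \<beta> a (\<lambda>p. b p * lam p) (family_of w)"
  have s2: "2 * s \<ge> 1" using s by simp
  show ?thesis
  proof (intro exI[of _ "\<lambda>u. expectation (\<lambda>w. displacement N m n (2 * s) u (?W w))"]
        exI[of _ "\<lambda>r. expectation (\<lambda>w. coeff_moment N m n (2 * s) r (?W w))"] conjI allI impI)
  qed (rule expectation_displacement_expansion[OF N s2] expectation_displacement_bound[OF N \<alpha> \<beta> a1 _ _ m a d]
        identity_sum_eq[OF N s]; assumption)+
qed

text \<open>\<open>degenerate_overlap_moment\<close> is applied with m and with m + n sites, and the
  constants are merged into the form required by \<open>LIMSEQ_two_scale\<close>.\<close>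

lemma abs_shared_overlap_avg_degenerate:
  assumes N: "N \<ge> 1" and \<alpha>': "\<alpha>' \<ge> 0" and degenerate: "\<alpha> = 0 \<or> \<beta> = 0"
    and a: "summable (\<lambda>t. (a (Suc t))\<^sup>2)" and d: "summable (\<lambda>t. (b (Suc t) * lam (Suc t))\<^sup>2)"
    and m: "m \<ge> 1" and r: "r \<ge> 1" and c: "c \<le> 2 * r" "c \<le> 2 * s"
  shows "\<bar>shared_overlap_avg M N \<beta> (hamiltonian a b lam P P' J J' i j) r s m n c\<bar>
    \<le> (real (2 * m + n) + 2 * (\<Sum>t<R. real (Suc t) * \<alpha>')) * (1 / real N)
      + 2 * (36 * \<beta>\<^sup>2 * \<alpha>' * (\<Sum>t. (b (Suc (t + R)) * lam (Suc (t + R)))\<^sup>2))"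
proof -
  let ?W = "\<lambda>w. boltzmann \<beta> a (\<lambda>p. b p * lam p) (family_of w)"
  have W: "(\<lambda>w. ?W w \<sigma>) \<in> borel_measurable M" for \<sigma>
    by (rule measurable_compose[OF measurable_family_of measurable_boltzmann]) (simp add: groups_def)
  have int_s: "integrable M (\<lambda>w. \<bar>shared_moment N m n (2 * r) (2 * s) c (?W w)\<bar>)"
    using abs_shared_moment_le_1[OF N pos_weight_boltzmann]
    by (intro integrable_abs integrable_const_bound[where B = 1] measurable_shared_moment W) auto
  have int_o: "integrable M (\<lambda>w. overlap_moment N k 2 (?W w))" for k
    using abs_overlap_moment_le_1[OF N pos_weight_boltzmann]
    by (intro integrable_const_bound[where B = 1] measurable_overlap_moment W) auto
  have om: "expectation (\<lambda>w. overlap_moment N k 2 (?W w))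
      \<le> (real (k - 1) + (\<Sum>t<R. real (Suc t) * \<alpha>')) / real N + 36 * \<beta>\<^sup>2 * \<alpha>' * (\<Sum>t. (b (Suc (t + R)) * lam (Suc (t + R)))\<^sup>2)"
    if "k \<ge> 1" for k
    using degenerate_overlap_moment[OF N \<alpha>' degenerate a d, of "k - 1" R] that by simp
  have "\<bar>shared_overlap_avg M N \<beta> (hamiltonian a b lam P P' J J' i j) r s m n c\<bar>
      \<le> expectation (\<lambda>w. \<bar>shared_moment N m n (2 * r) (2 * s) c (?W w)\<bar>)"
    unfolding shared_overlap_avg_eq[OF c] by (rule integral_abs_bound)
  also have "\<dots> \<le> expectation (\<lambda>w. overlap_moment N m 2 (?W w) + overlap_moment N (m + n) 2 (?W w))"
    using r c by (intro integral_mono int_s Bochner_Integration.integrable_add int_o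
        abs_shared_moment_le_overlap_moments N pos_weight_boltzmann) auto
  also have "\<dots> = expectation (\<lambda>w. overlap_moment N m 2 (?W w)) + expectation (\<lambda>w. overlap_moment N (m + n) 2 (?W w))"
    by (intro Bochner_Integration.integral_add int_o)
  also have "\<dots> \<le> ((real (m - 1) + (\<Sum>t<R. real (Suc t) * \<alpha>')) / real N + 36 * \<beta>\<^sup>2 * \<alpha>' * (\<Sum>t. (b (Suc (t + R)) * lam (Suc (t + R)))\<^sup>2))
      + ((real (m + n - 1) + (\<Sum>t<R. real (Suc t) * \<alpha>')) / real N + 36 * \<beta>\<^sup>2 * \<alpha>' * (\<Sum>t. (b (Suc (t + R)) * lam (Suc (t + R)))\<^sup>2))"
    using m by (intro add_mono om) auto
  also have "\<dots> = (real (m - 1) + real (m + n - 1) + 2 * (\<Sum>t<R. real (Suc t) * \<alpha>')) * (1 / real N)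
      + 2 * (36 * \<beta>\<^sup>2 * \<alpha>' * (\<Sum>t. (b (Suc (t + R)) * lam (Suc (t + R)))\<^sup>2))"
    by (simp add: add_divide_distrib)
  also have "\<dots> \<le> (real (2 * m + n) + 2 * (\<Sum>t<R. real (Suc t) * \<alpha>')) * (1 / real N)
      + 2 * (36 * \<beta>\<^sup>2 * \<alpha>' * (\<Sum>t. (b (Suc (t + R)) * lam (Suc (t + R)))\<^sup>2))"
    by (intro add_right_mono mult_right_mono) auto
  finally show ?thesis .
qed

end

theorem corollary2:
  fixes \<alpha> \<alpha>' \<beta> :: real
    and a b :: "nat \<Rightarrow> real"
    and M :: "nat \<Rightarrow> 'w measure"
    and P P' :: "nat \<Rightarrow> nat \<Rightarrow> 'w \<Rightarrow> nat"
    and J J' :: "nat \<Rightarrow> nat \<Rightarrow> nat \<Rightarrow> 'w \<Rightarrow> int"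
    and i j :: "nat \<Rightarrow> nat \<Rightarrow> nat \<Rightarrow> nat \<Rightarrow> 'w \<Rightarrow> nat"
  assumes "\<alpha> \<ge> 0" "\<alpha>' \<ge> 0" "\<beta> \<ge> 0"
    and "\<And>p. p \<ge> 1 \<Longrightarrow> a p \<noteq> 0" "\<And>p. p \<ge> 1 \<Longrightarrow> b p \<noteq> 0"
    and "(\<lambda>p. \<bar>a (Suc p)\<bar>\<^sup>2) sums 1" "(\<lambda>p. \<bar>b (Suc p)\<bar>\<^sup>2) sums 1"
    and "\<And>N. N \<ge> 1 \<Longrightarrow>
           quenched_disorder (M N) N \<alpha> \<alpha>' (P N) (P' N) (J N) (J' N) (i N) (j N)"
  shows "\<exists>Z. zero_measure Z \<and>
    (\<forall>lam \<in> ({1..} \<rightarrow>\<^sub>E UNIV) - Z. \<forall>r\<ge>1. \<forall>s\<ge>1. \<forall>m\<ge>1. \<forall>n\<ge>1.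
      (\<lambda>N. \<Sum>c=0..min (2 * r) (2 * s).
          (- 1) ^ (c + 1) * (fact (2 * r + 2 * s - c - 1) / (fact c * fact (2 * r - c) * fact (2 * s - c)))
          * shared_overlap_avg (M N) N \<beta>
              (hamiltonian a b lam (P N) (P' N) (J N) (J' N) (i N) (j N)) r s m n c)
      \<longlonglongrightarrow> 0)"
proof -
  define Z where "Z = {lam :: nat \<Rightarrow> real. \<nexists>K. \<forall>p\<ge>1. \<bar>lam p\<bar> \<le> K}"
  \<comment> \<open>Sequences in a box are bounded, so \<open>Z\<close> misses every set by which
    \<open>zero_measure\<close> tests it.\<close>
  have "Z \<inter> ({1..} \<rightarrow>\<^sub>E {-K..K}) = {}" for K :: real
    by (force simp: Z_def PiE_def Pi_def abs_le_iff)
  then have Z: "zero_measure Z" unfolding zero_measure_def by simp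
  have a: "summable (\<lambda>t. (a (Suc t))\<^sup>2)" and b: "summable (\<lambda>t. (b (Suc t))\<^sup>2)"
    using sums_summable[OF assms(6)] sums_summable[OF assms(7)] by simp_all
  show ?thesis
  proof (intro exI[of _ Z] conjI Z ballI allI impI)
    fix lam and r s m n :: nat
    assume lam: "lam \<in> ({1..} \<rightarrow>\<^sub>E UNIV) - Z" and rsmn: "r \<ge> 1" "s \<ge> 1" "m \<ge> 1" "n \<ge> 1"
    obtain K where K: "\<And>p. p \<ge> 1 \<Longrightarrow> \<bar>lam p\<bar> \<le> K" using lam by (auto simp: Z_def)
    have d: "summable (\<lambda>t. (b (Suc t) * lam (Suc t))\<^sup>2)"
    proof (rule summable_comparison_test[OF _ summable_mult2[OF b, of "K\<^sup>2"]])
      have "(lam (Suc t))\<^sup>2 \<le> K\<^sup>2" for t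
        using power_mono[OF K[of "Suc t"] abs_ge_zero, of 2] by simp
      then show "\<exists>N. \<forall>t\<ge>N. norm ((b (Suc t) * lam (Suc t))\<^sup>2) \<le> (b (Suc t))\<^sup>2 * K\<^sup>2"
        by (simp add: power_mult_distrib mult_left_mono)
    qed
    define D where "D = (\<lambda>N. shared_overlap_avg (M N) N \<beta>
        (hamiltonian a b lam (P N) (P' N) (J N) (J' N) (i N) (j N)) r s m n)"
    let ?f = "\<lambda>c. (- 1) ^ (c + 1) * (fact (2 * r + 2 * s - c - 1) / (fact c * fact (2 * r - c) * fact (2 * s - c))) :: real"
    show "(\<lambda>N. \<Sum>c=0..min (2 * r) (2 * s). ?f c
          * shared_overlap_avg (M N) N \<beta>
              (hamiltonian a b lam (P N) (P' N) (J N) (J' N) (i N) (j N)) r s m n c) \<longlonglongrightarrow> 0"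
    proof (cases "\<alpha> > 0 \<and> \<beta> > 0")
      case True
      define t where "t = (\<lambda>p. tanh (\<beta> * a p))"
      have "(\<lambda>p. sqrt ((a (Suc p))\<^sup>2)) \<longlonglongrightarrow> sqrt 0"
        by (intro tendsto_real_sqrt summable_LIMSEQ_zero a)
      then have "a \<longlonglongrightarrow> 0"
        by (simp add: tendsto_rabs_zero_iff filterlim_sequentially_Suc)
      then have "(\<lambda>p. tanh (\<beta> * a p)) \<longlonglongrightarrow> tanh (\<beta> * 0)"
        by (intro tendsto_intros) auto
      then have t0: "t \<longlonglongrightarrow> 0" by (simp add: t_def)
      define Q where "Q = (\<lambda>N x. (\<forall>R u. R \<ge> 1 \<longrightarrow> \<bar>u\<bar> \<le> 1 / 2 \<longrightarrow>
        \<bar>fst x u - (\<Sum>r=1..<R. u ^ (2 * r) * snd x r)\<bar> \<le> 3 ^ (2 * s) * (2 * \<bar>u\<bar>) ^ (2 * R))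
        \<and> (\<forall>q L. q \<ge> 1 \<longrightarrow> L \<ge> 1 \<longrightarrow> \<bar>fst x (tanh (\<beta> * a (m + q)))\<bar>
            \<le> displacement_const \<alpha> q (2 * s) (tanh (\<beta> * a (m + q))) L / sqrt (real N)
              + real (2 * s) * (2 / (1 - \<bar>tanh (\<beta> * a (m + q))\<bar>)) * real q * (4 * exp (\<alpha> / 2) / (\<bar>tanh (\<beta> * a 1)\<bar> * real L)))
        \<and> (\<forall>r. (\<Sum>c=0..min (2 * r) (2 * s).
          (- 1) ^ (c + 1) * (fact (2 * r + 2 * s - c - 1) / (fact c * fact (2 * r - c) * fact (2 * s - c)))
          * shared_overlap_avg (M N) N \<beta> (hamiltonian a b lam (P N) (P' N) (J N) (J' N) (i N) (j N)) r s m n c)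
            = - (1 / real (2 * s)) * snd x r))"
      \<comment> \<open>Every N has its own probability space; only the deterministic functions of
        \<open>identity_sum_expansion\<close> are compared across different N.\<close>
      have "\<forall>N\<in>{1..}. \<exists>x. Q N x"
      proof
        fix N :: nat assume "N \<in> {1..}"
        then have N: "N \<ge> 1" by simp
        interpret quenched_disorder "M N" N \<alpha> \<alpha>' "P N" "P' N" "J N" "J' N" "i N" "j N" by (rule assms(8)[OF N])
        obtain dN DN where "Q N (dN, DN)"
          using identity_sum_expansion[OF N _ assms(2) _ _ a d rsmn(3) rsmn(2), of \<beta> n] True assms(4)[of 1]
          unfolding Q_def fst_conv snd_conv by auto
        then show "\<exists>x. Q N x" ..
      qed
      from bchoice[OF this] obtain x where "\<forall>N\<in>{1..}. Q N (x N)" ..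
      then have x: "Q N (x N)" if "N \<ge> 1" for N using that by simp
      \<comment> \<open>For p > m the bound is used with \<open>q = p - m\<close> surplus sites; its
        second part is a constant over the cutoff \<open>L\<close>.\<close>
      have dt: "(\<lambda>N. fst (x N) (t p)) \<longlonglongrightarrow> 0" if p: "p > m" for p
      proof (rule LIMSEQ_two_scale)
        let ?B = "real (2 * s) * (2 / (1 - \<bar>t p\<bar>)) * real (p - m) * (4 * exp (\<alpha> / 2) / \<bar>tanh (\<beta> * a 1)\<bar>)"
        fix N L :: nat assume N: "N \<ge> 1" and L: "L \<ge> 1"
        show "\<bar>fst (x N) (t p)\<bar> \<le> displacement_const \<alpha> (p - m) (2 * s) (t p) L * (1 / sqrt (real N)) + ?B * (1 / real L)"
          using x[OF N, unfolded Q_def, THEN conjunct2, THEN conjunct1, rule_format, of "p - m" L] p L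
          by (simp add: t_def mult.assoc Suc_le_eq)
      next
        show "(\<lambda>N. 1 / sqrt (real N)) \<longlonglongrightarrow> 0"
          by (intro tendsto_divide_0[OF tendsto_const] filterlim_at_top_imp_at_infinity
              filterlim_compose[OF sqrt_at_top filterlim_real_sequentially])
        show "(\<lambda>L. real (2 * s) * (2 / (1 - \<bar>t p\<bar>)) * real (p - m) * (4 * exp (\<alpha> / 2) / \<bar>tanh (\<beta> * a 1)\<bar>) * (1 / real L)) \<longlonglongrightarrow> 0"
          by (intro tendsto_mult_right_zero lim_1_over_n)
      qed
      have "(\<lambda>N. snd (x N) r) \<longlonglongrightarrow> 0"
      proof (rule coefficients_tendsto_0[where d = "\<lambda>N. fst (x N)" and D = "\<lambda>r N. snd (x N) r" and t = t and m = m
            and C = "3 ^ (2 * s)"])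
        show "t p \<noteq> 0" if "p > m" for p using that True assms(4)[of p] by (simp add: t_def)
        show "\<bar>fst (x N) u - (\<Sum>r=1..<R. u ^ (2 * r) * snd (x N) r)\<bar> \<le> 3 ^ (2 * s) * (2 * \<bar>u\<bar>) ^ (2 * R)"
          if "N \<ge> 1" "R \<ge> 1" "\<bar>u\<bar> \<le> 1 / 2" for N R u
          using x[OF that(1)] that unfolding Q_def by blast
      qed (use t0 dt rsmn in auto)
      then have lim: "(\<lambda>N. - (1 / real (2 * s)) * snd (x N) r) \<longlonglongrightarrow> 0" by (rule tendsto_mult_right_zero)
      show ?thesis
      proof (rule Lim_transform_eventually[OF lim])
        show "\<forall>\<^sub>F N in sequentially. - (1 / real (2 * s)) * snd (x N) r = (\<Sum>c=0..min (2 * r) (2 * s). ?f c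
          * shared_overlap_avg (M N) N \<beta> (hamiltonian a b lam (P N) (P' N) (J N) (J' N) (i N) (j N)) r s m n c)"
          using eventually_ge_at_top[of 1]
        proof eventually_elim
          case (elim N)
          then show ?case using x[of N] unfolding Q_def by simp
        qed
      qed
    next
      case False
      then have degenerate: "\<alpha> = 0 \<or> \<beta> = 0" using assms(1,3) by auto
      have "(\<lambda>N. shared_overlap_avg (M N) N \<beta>
          (hamiltonian a b lam (P N) (P' N) (J N) (J' N) (i N) (j N)) r s m n c) \<longlonglongrightarrow> 0"
        if c: "c \<in> {0..min (2 * r) (2 * s)}" for c
      proof (rule LIMSEQ_two_scale)
        fix N R :: nat assume N: "N \<ge> 1"
        interpret quenched_disorder "M N" N \<alpha> \<alpha>' "P N" "P' N" "J N" "J' N" "i N" "j N" by (rule assms(8)[OF N])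
        show "\<bar>shared_overlap_avg (M N) N \<beta> (hamiltonian a b lam (P N) (P' N) (J N) (J' N) (i N) (j N)) r s m n c\<bar>
          \<le> (real (2 * m + n) + 2 * (\<Sum>t<R. real (Suc t) * \<alpha>')) * (1 / real N)
            + 2 * (36 * \<beta>\<^sup>2 * \<alpha>' * (\<Sum>t. (b (Suc (t + R)) * lam (Suc (t + R)))\<^sup>2))"
          using c rsmn by (intro abs_shared_overlap_avg_degenerate N assms(2) degenerate a d) auto
      next
        show "(\<lambda>N. 1 / real N) \<longlonglongrightarrow> 0" by (rule lim_1_over_n)
        have "(\<lambda>R. \<Sum>t. (b (Suc (t + R)) * lam (Suc (t + R)))\<^sup>2) \<longlonglongrightarrow> 0"
          by (rule suminf_exist_split2[OF d])
        then show "(\<lambda>R. 2 * (36 * \<beta>\<^sup>2 * \<alpha>' * (\<Sum>t. (b (Suc (t + R)) * lam (Suc (t + R)))\<^sup>2))) \<longlonglongrightarrow> 0"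
          by (intro tendsto_mult_right_zero)
      qed
      then have "(\<lambda>N. \<Sum>c=0..min (2 * r) (2 * s). ?f c
          * shared_overlap_avg (M N) N \<beta>
              (hamiltonian a b lam (P N) (P' N) (J N) (J' N) (i N) (j N)) r s m n c)
          \<longlonglongrightarrow> (\<Sum>c=0..min (2 * r) (2 * s). ?f c * 0)"
        by (intro tendsto_sum tendsto_mult_left)
      then show ?thesis by simp
    qed
  qed
qed

end
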